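(* Let $\Bbbk$ be an algebraically closed field. If $I$ is the defining ideal of $s\geqslant 1$ very general points in $\mathbb{P}^N_{\Bbbk}$, then $$\widehat{\alpha}(I)\;\geqslant\;\frac{\alpha(I^{(3)})+N-2}{N+2}.$$
   Context: Let $R=\Bbbk[x_0,\dots,x_N]$ be the homogeneous coordinate ring of $\mathbb{P}^N_{\Bbbk}$. For a homogeneous ideal $J$, $\alpha(J)$ denotes its initial degree, i.e. the least degree of a nonzero homogeneous element of $J$. The $m$-th symbolic power of a homogeneous ideal $I$ is $I^{(m)}=\bigcap_{\mathfrak p\in \mathrm{Ass}(I)} (I^mR_{\mathfrak p}\cap R)$; when $I$ is the defining ideal of finitely many reduced points with point ideals $\mathfrak p_1,\dots,\mathfrak p_s$, $I^{(m)}=\mathfrak p_1^m\cap\dots\cap\mathfrak p_s^m$. The Waldschmidt constant of $I$ is $\widehat{\alpha}(I)=\lim_{t\to\infty}\alpha(I^{(t)})/t=\inf_{t\geqslant 1}\alpha(I^{(t)})/t$. Very general points: for $\underline a=(a_{i,j})_{1\le i\le s,\,0\le j\le N}\in\mathbb{A}^{s(N+1)}_{\Bbbk}$ let $\mathbb{X}(\underline a)=\{P_1(\underline a),\dots,P_s(\underline a)\}$ with $P_i(\underline a)=[a_{i,0}:\dots:a_{i,N}]$. A property holds for $s$ very general points in $\mathbb{P}^N_{\Bbbk}$ if there is a countable intersection $U$ of nonempty Zariski open subsets of $\mathbb{A}^{s(N+1)}_{\Bbbk}$ such that the property holds for $\mathbb{X}(\underline a)$ for every $\underline a\in U$. *)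

theory Defs
  imports
    Complex_Main
    "HOL-Library.FuncSet"
    "HOL-Library.Poly_Mapping"
    "HOL-Computational_Algebra.Polynomial"
    "HOL-Algebra.Ideal_Product"
begin

type_synonym ('v, 'k) mpoly = "('v \<Rightarrow>\<^sub>0 nat) \<Rightarrow>\<^sub>0 'k"

definition poly_vars :: "('v, 'k::zero) mpoly \<Rightarrow> 'v set" where
  "poly_vars f = (\<Union>m\<in>Poly_Mapping.keys f. Poly_Mapping.keys m)"

definition poly_ring :: "'v set \<Rightarrow> ('v, 'k::comm_ring_1) mpoly ring" where
  "poly_ring V = \<lparr>carrier = {f. poly_vars f \<subseteq> V}, mult = (*), one = 1, zero = 0, add = (+)\<rparr>"

lemma poly_ring_cring: "cring (poly_ring V :: ('v, 'k::comm_ring_1) mpoly ring)"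
proof (rule cringI)
  have add: "poly_vars (f + g) \<subseteq> V" if "poly_vars f \<subseteq> V" "poly_vars g \<subseteq> V"
    for f g :: "('v, 'k) mpoly"
    using that Poly_Mapping.keys_add[of f g] unfolding poly_vars_def by blast
  have mult: "poly_vars (f * g) \<subseteq> V" if fg: "poly_vars f \<subseteq> V" "poly_vars g \<subseteq> V"
    for f g :: "('v, 'k) mpoly"
  proof -
    have "Poly_Mapping.keys m \<subseteq> V" if m: "m \<in> Poly_Mapping.keys (f * g)" for m
    proof -
      obtain a b where ab: "m = a + b" "a \<in> Poly_Mapping.keys f" "b \<in> Poly_Mapping.keys g"
        using Poly_Mapping.keys_mult[of f g] m by blast
      then show ?thesis
        using Poly_Mapping.keys_add[of a b] fg
        unfolding poly_vars_def by blast
    qed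
    then show ?thesis unfolding poly_vars_def by blast
  qed
  show "abelian_group (poly_ring V :: ('v, 'k) mpoly ring)"
  proof (rule abelian_groupI, goal_cases)
    case (6 x)
    then have "- x \<in> carrier (poly_ring V)" "- x + x = 0"
      by (auto simp: poly_ring_def poly_vars_def)
    then show ?case by (auto simp: poly_ring_def)
  qed (auto simp: poly_ring_def add add.assoc add.commute poly_vars_def[of 0]
        intro: add[THEN subsetD])
  show "comm_monoid (poly_ring V :: ('v, 'k) mpoly ring)"
    by (rule comm_monoidI)
      (auto simp: poly_ring_def mult.assoc mult.commute poly_vars_def[of 1]
        intro: mult[THEN subsetD])
qed (simp add: poly_ring_def distrib_right)

definition poly_eval :: "('v \<Rightarrow> 'k) \<Rightarrow> ('v, 'k::comm_ring_1) mpoly \<Rightarrow> 'k" where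
  "poly_eval a f = (\<Sum>m\<in>Poly_Mapping.keys f.
     Poly_Mapping.lookup f m * (\<Prod>v\<in>Poly_Mapping.keys m. a v ^ Poly_Mapping.lookup m v))"

definition total_degree :: "('v \<Rightarrow>\<^sub>0 nat) \<Rightarrow> nat" where
  "total_degree m = (\<Sum>v\<in>Poly_Mapping.keys m. Poly_Mapping.lookup m v)"

definition homogeneous_of_degree :: "nat \<Rightarrow> ('v, 'k::zero) mpoly \<Rightarrow> bool" where
  "homogeneous_of_degree d f \<longleftrightarrow> (\<forall>m\<in>Poly_Mapping.keys f. total_degree m = d)"

text \<open>The initial degree is unspecified for an ideal without nonzero homogeneous elements,
  that is, for the zero ideal among the homogeneous ideals.\<close>

definition initial_degree :: "('v, 'k::zero) mpoly set \<Rightarrow> nat" where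
  "initial_degree J = (LEAST d. \<exists>f\<in>J. f \<noteq> 0 \<and> homogeneous_of_degree d f)"

text \<open>The associated primes of the \<open>R\<close>-module \<open>R/I\<close>: the prime ideals of the form
  \<open>(I : f)\<close>, i.e. the prime annihilators of residue classes.\<close>

definition associated_primes :: "('a, 'b) ring_scheme \<Rightarrow> 'a set \<Rightarrow> 'a set set" where
  "associated_primes R I =
     {p. primeideal p R \<and> (\<exists>f\<in>carrier R. p = {g \<in> carrier R. g \<otimes>\<^bsub>R\<^esub> f \<in> I})}"

text \<open>The contraction \<open>J R\<^sub>p \<inter> R\<close> along the localization map \<open>R \<rightarrow> R\<^sub>p\<close>, for an ideal \<open>J\<close>
  of a domain \<open>R\<close>: the elements of \<open>R\<close> that equal a fraction \<open>h / g\<close> with \<open>h \<in> J\<close> and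
  \<open>g \<notin> p\<close>.\<close>

definition localization_contraction :: "('a, 'b) ring_scheme \<Rightarrow> 'a set \<Rightarrow> 'a set \<Rightarrow> 'a set" where
  "localization_contraction R p J =
     {f \<in> carrier R. \<exists>g\<in>carrier R - p. \<exists>h\<in>J. g \<otimes>\<^bsub>R\<^esub> f = h}"

definition symbolic_power :: "('a, 'b) ring_scheme \<Rightarrow> 'a set \<Rightarrow> nat \<Rightarrow> 'a set" where
  "symbolic_power R I m =
     carrier R \<inter> (\<Inter>p\<in>associated_primes R I.
       localization_contraction R p (I [^]\<^bsub>ideals_set R\<^esub> m))"

definition waldschmidt_constant ::
  "(('v, 'k::zero) mpoly, 'b) ring_scheme \<Rightarrow> ('v, 'k) mpoly set \<Rightarrow> real" where
  "waldschmidt_constant R I =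
     lim (\<lambda>t. real (initial_degree (symbolic_power R I t)) / real t)"

text \<open>Points of affine space with coordinates indexed by \<open>A\<close> are extensional functions on \<open>A\<close>.\<close>

definition affine_space :: "'v set \<Rightarrow> ('v \<Rightarrow> 'k) set" where
  "affine_space A = (A \<rightarrow>\<^sub>E UNIV)"

definition zariski_closed :: "'v set \<Rightarrow> ('v \<Rightarrow> 'k::comm_ring_1) set \<Rightarrow> bool" where
  "zariski_closed A Z \<longleftrightarrow>
     (\<exists>S \<subseteq> carrier (poly_ring A). Z = {a \<in> affine_space A. \<forall>f\<in>S. poly_eval a f = 0})"

definition zariski_open :: "'v set \<Rightarrow> ('v \<Rightarrow> 'k::comm_ring_1) set \<Rightarrow> bool" where
  "zariski_open A U \<longleftrightarrow> U \<subseteq> affine_space A \<and> zariski_closed A (affine_space A - U)"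

text \<open>A point \<open>[v\<^sub>0 : \<dots> : v\<^sub>N]\<close> of projective space is the set of its vectors of homogeneous
  coordinates. The zero vector gives a set that is not a point of \<open>projective_space N\<close>.\<close>

definition projective_point :: "nat \<Rightarrow> (nat \<Rightarrow> 'k::field) \<Rightarrow> (nat \<Rightarrow> 'k) set" where
  "projective_point N v = {restrict (\<lambda>j. c * v j) {0..N} | c. c \<noteq> 0}"

definition projective_space :: "nat \<Rightarrow> (nat \<Rightarrow> 'k::field) set set" where
  "projective_space N =
     {projective_point N v | v. v \<in> affine_space {0..N} \<and> (\<exists>j\<in>{0..N}. v j \<noteq> 0)}"

definition coordinate_ring :: "nat \<Rightarrow> (nat, 'k::field) mpoly ring" where
  "coordinate_ring N = poly_ring {0..N}"

definition defining_ideal :: "nat \<Rightarrow> (nat \<Rightarrow> 'k::field) set set \<Rightarrow> (nat, 'k) mpoly set" where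
  "defining_ideal N X =
     Idl\<^bsub>coordinate_ring N\<^esub> {f \<in> carrier (coordinate_ring N).
       (\<exists>d. homogeneous_of_degree d f) \<and> (\<forall>P\<in>X. \<forall>v\<in>P. poly_eval v f = 0)}"

definition point_configuration ::
  "nat \<Rightarrow> nat \<Rightarrow> (nat \<times> nat \<Rightarrow> 'k::field) \<Rightarrow> (nat \<Rightarrow> 'k) set set" where
  "point_configuration N s a = (\<lambda>i. projective_point N (\<lambda>j. a (i, j))) ` {1..s}"

text \<open>The clause on \<open>projective_space N\<close> says that \<open>P\<^sub>1(a), \<dots>, P\<^sub>s(a)\<close> are points at all,
  i.e. that no row of \<open>a\<close> vanishes.\<close>

definition holds_for_very_general_points ::
  "nat \<Rightarrow> nat \<Rightarrow> ((nat \<Rightarrow> 'k::field) set set \<Rightarrow> bool) \<Rightarrow> bool" where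
  "holds_for_very_general_points N s Q \<longleftrightarrow>
     (\<exists>V :: nat \<Rightarrow> (nat \<times> nat \<Rightarrow> 'k) set.
        (\<forall>n. zariski_open ({1..s} \<times> {0..N}) (V n) \<and> V n \<noteq> {}) \<and>
        (\<forall>a\<in>(\<Inter>n. V n).
           point_configuration N s a \<subseteq> projective_space N \<and> Q (point_configuration N s a)))"

end

theory Submission
  imports Defs "HOL-Library.Nat_Bijection"
begin

text \<open>The inequality compares an upper bound for \<open>\<alpha>(I\<^sup>(\<^sup>3\<^sup>))\<close> with a lower bound for the Waldschmidt constant.

The upper bound is a count of conditions. A triple point imposes at most \<open>(N + 2) choose 2\<close> linear
conditions on forms of degree \<open>d\<close> (\<open>spanning_quadrics\<close>), and there are \<open>(N + d) choose N\<close> monomials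
of that degree. If \<open>s * ((N + 2) choose 2) < (N + d) choose N\<close>, then some nonzero form of degree \<open>d\<close>
lies in the third symbolic power (\<open>ex_triple_form\<close>).

The lower bound comes from specialization. That no nonzero form of degree \<open>d\<close> vanishes to order \<open>t\<close>
at \<open>s\<close> points says that a linear system, whose entries are polynomials in the coordinates of the
points, has trivial kernel. If this holds for one configuration, then it holds on a nonempty open set
(\<open>generic_no_form\<close>). Hence, if every form that vanishes to order \<open>t\<close> on one special configuration of
at most \<open>s\<close> points has degree at least \<open>(p / q) * t\<close>, then very general points have a Waldschmidt
constant of at least \<open>p / q\<close>: there are only countably many pairs \<open>(t, d)\<close>.

The special configurations are unions of grids. On a grid with \<open>k\<^sub>i\<close> values of the \<open>i\<close>-th coordinate,
a polynomial that vanishes to order \<open>t\<close> contains, above each of its monomials, a monomial \<open>m\<close> with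
\<open>\<Sum>i. m\<^sub>i div k\<^sub>i \<ge> t\<close>: otherwise a product of divided differences of total order less than \<open>t\<close>
would extract a nonzero coefficient (\<open>footprint\<close>). For several grids the same monomial can be used,
and adding the resulting inequalities bounds the degree (\<open>averaging_bound\<close>). One grid of side \<open>k\<close>
gives the bound \<open>k\<close> for \<open>k ^ N\<close> points; cubes of side 2 in groups of the coordinates give bounds
between 1 and 2 for fewer than \<open>2 ^ N\<close> points.

It remains to find, for all \<open>N\<close> and \<open>s\<close>, a degree \<open>d\<close> that satisfies the count and a configuration
of at most \<open>s\<close> points with \<open>(d + N - 2) / (N + 2) \<le> p / q\<close> (\<open>ex_degree_and_bound\<close>). For
\<open>s \<ge> 2 ^ N\<close> a grid of side \<open>k\<close> with \<open>k ^ N \<le> s < (k + 1) ^ N\<close> and \<open>d = (N + 2) * k - N + 2\<close> almost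
always suffice. For \<open>s < 2 ^ N\<close> the least degree \<open>4 + i\<close> that satisfies the count is compared with
groups of about \<open>2 * i\<close> coordinates.\<close>

section \<open>Polynomials and orders of vanishing\<close>

abbreviation lookup where "lookup \<equiv> Poly_Mapping.lookup"
abbreviation keys where "keys \<equiv> Poly_Mapping.keys"
abbreviation single where "single \<equiv> Poly_Mapping.single"

definition mon_eval :: "('v \<Rightarrow> 'b::comm_monoid_mult) \<Rightarrow> ('v \<Rightarrow>\<^sub>0 nat) \<Rightarrow> 'b" where
  "mon_eval a m = (\<Prod>v\<in>keys m. a v ^ lookup m v)"

lemma mon_eval_superset:
  assumes "finite S" "keys m \<subseteq> S"
  shows "mon_eval a m = (\<Prod>v\<in>S. a v ^ lookup m v)"
  unfolding mon_eval_def
  by (rule prod.mono_neutral_left) (use assms in \<open>auto simp: in_keys_iff\<close>)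

lemma mon_eval_0 [simp]: "mon_eval a 0 = 1"
  by (simp add: mon_eval_def)

lemma mon_eval_add: "mon_eval a (m + n) = mon_eval a m * mon_eval a n"
proof -
  let ?S = "keys m \<union> keys n"
  have "mon_eval a (m + n) = (\<Prod>v\<in>?S. a v ^ lookup (m + n) v)"
    by (rule mon_eval_superset) (use Poly_Mapping.keys_add[of m n] in auto)
  also have "\<dots> = (\<Prod>v\<in>?S. a v ^ lookup m v) * (\<Prod>v\<in>?S. a v ^ lookup n v)"
    by (simp add: lookup_add power_add prod.distrib)
  also have "\<dots> = mon_eval a m * mon_eval a n"
    by (subst (1 2) mon_eval_superset[of ?S]) auto
  finally show ?thesis .
qed

lemma mon_eval_single [simp]: "mon_eval a (single v n) = a v ^ n"
  by (subst mon_eval_superset[of "{v}"]) (auto simp: lookup_single)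

lemma mpoly_sum_single: "f = (\<Sum>m\<in>keys f. single m (lookup f m))"
  by (rule poly_mapping_eqI)
    (auto simp: lookup_sum lookup_single when_def in_keys_iff sum.delta' not_in_keys_iff_lookup_eq_zero)

definition subst :: "('k::comm_ring_1 \<Rightarrow> 'b::comm_ring_1) \<Rightarrow> ('v \<Rightarrow> 'b) \<Rightarrow> ('v, 'k) mpoly \<Rightarrow> 'b" where
  "subst c a f = (\<Sum>m\<in>keys f. c (lookup f m) * mon_eval a m)"

locale coeff_hom =
  fixes c :: "'k::comm_ring_1 \<Rightarrow> 'b::comm_ring_1"
  assumes c_0: "c 0 = 0" and c_1: "c 1 = 1"
    and c_add: "c (x + y) = c x + c y" and c_mult: "c (x * y) = c x * c y"
begin

lemma subst_superset:
  assumes "finite S" "keys f \<subseteq> S"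
  shows "subst c a f = (\<Sum>m\<in>S. c (lookup f m) * mon_eval a m)"
  unfolding subst_def
  by (rule sum.mono_neutral_left) (use assms in \<open>auto simp: in_keys_iff c_0\<close>)

lemma subst_0 [simp]: "subst c a 0 = 0"
  by (simp add: subst_def)

lemma subst_single [simp]: "subst c a (single m x) = c x * mon_eval a m"
  by (subst subst_superset[of "{m}"]) auto

lemma subst_1 [simp]: "subst c a 1 = 1"
  using subst_single[of a 0 1] by (simp add: c_1)

lemma subst_add: "subst c a (f + g) = subst c a f + subst c a g"
proof -
  let ?S = "keys f \<union> keys g"
  have "subst c a (f + g) = (\<Sum>m\<in>?S. c (lookup (f + g) m) * mon_eval a m)"
    by (rule subst_superset) (use Poly_Mapping.keys_add[of f g] in auto)
  also have "\<dots> = (\<Sum>m\<in>?S. c (lookup f m) * mon_eval a m) + (\<Sum>m\<in>?S. c (lookup g m) * mon_eval a m)"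
    by (simp add: lookup_add c_add algebra_simps sum.distrib)
  also have "\<dots> = subst c a f + subst c a g"
    by (subst (1 2) subst_superset[of ?S]) auto
  finally show ?thesis .
qed

lemma subst_sum: "subst c a (\<Sum>i\<in>A. f i) = (\<Sum>i\<in>A. subst c a (f i))"
  by (induction A rule: infinite_finite_induct) (auto simp: subst_add)

lemma subst_mult: "subst c a (f * g) = subst c a f * subst c a g"
proof -
  have "f * g = (\<Sum>m\<in>keys f. \<Sum>n\<in>keys g. single (m + n) (lookup f m * lookup g n))"
    by (subst (1) mpoly_sum_single[of f], subst (1) mpoly_sum_single[of g])
      (simp add: sum_product mult_single)
  then have "subst c a (f * g) =
      (\<Sum>m\<in>keys f. \<Sum>n\<in>keys g. c (lookup f m * lookup g n) * mon_eval a (m + n))"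
    by (simp add: subst_sum)
  also have "\<dots> = subst c a f * subst c a g"
    by (simp add: subst_def sum_product c_mult mon_eval_add mult_ac)
  finally show ?thesis .
qed

lemma subst_uminus: "subst c a (- f) = - subst c a f"
  using subst_add[of a f "- f"] by (simp add: add_eq_0_iff)

lemma subst_diff: "subst c a (f - g) = subst c a f - subst c a g"
  using subst_add[of a f "- g"] by (simp add: subst_uminus)

lemma subst_power: "subst c a (f ^ n) = subst c a f ^ n"
  by (induction n) (auto simp: subst_mult)

end

lemma poly_eval_eq_subst: "poly_eval a f = subst (\<lambda>x. x) a f"
  by (simp add: poly_eval_def subst_def mon_eval_def)

interpretation id_coeff: coeff_hom "\<lambda>x. x :: 'k::comm_ring_1"
  by unfold_locales auto

lemmas poly_eval_simps = id_coeff.subst_0[folded poly_eval_eq_subst] id_coeff.subst_1[folded poly_eval_eq_subst]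
  id_coeff.subst_single[folded poly_eval_eq_subst]
  id_coeff.subst_add[folded poly_eval_eq_subst] id_coeff.subst_mult[folded poly_eval_eq_subst]
  id_coeff.subst_uminus[folded poly_eval_eq_subst] id_coeff.subst_diff[folded poly_eval_eq_subst]
  id_coeff.subst_power[folded poly_eval_eq_subst] id_coeff.subst_sum[folded poly_eval_eq_subst]

interpretation const_coeff: coeff_hom "single 0 :: 'k::comm_ring_1 \<Rightarrow> ('v, 'k) mpoly"
  by unfold_locales (auto simp: single_add mult_single)

definition taylor :: "('v \<Rightarrow> 'k) \<Rightarrow> ('v, 'k::comm_ring_1) mpoly \<Rightarrow> ('v, 'k) mpoly" where
  "taylor P f = subst (single 0) (\<lambda>v. single 0 (P v) + single (single v 1) 1) f"

text \<open>Hasse derivatives, that is, partial derivatives divided by factorials: in positive characteristic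
the ordinary derivatives do not detect the order of vanishing.\<close>

definition hasse_mon :: "('v \<Rightarrow>\<^sub>0 nat) \<Rightarrow> ('v \<Rightarrow>\<^sub>0 nat) \<Rightarrow> ('v \<Rightarrow> 'k::comm_ring_1) \<Rightarrow> 'k" where
  "hasse_mon \<alpha> m P = (\<Prod>v\<in>keys m \<union> keys \<alpha>.
     of_nat (lookup m v choose lookup \<alpha> v) * P v ^ (lookup m v - lookup \<alpha> v))"

definition hasse :: "('v \<Rightarrow>\<^sub>0 nat) \<Rightarrow> ('v, 'k::comm_ring_1) mpoly \<Rightarrow> ('v \<Rightarrow> 'k) \<Rightarrow> 'k" where
  "hasse \<alpha> f P = (\<Sum>m\<in>keys f. lookup f m * hasse_mon \<alpha> m P)"

lemma hasse_mon_superset: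
  assumes "finite S" "keys m \<union> keys \<alpha> \<subseteq> S"
  shows "hasse_mon \<alpha> m P =
    (\<Prod>v\<in>S. of_nat (lookup m v choose lookup \<alpha> v) * P v ^ (lookup m v - lookup \<alpha> v))"
  unfolding hasse_mon_def
  by (rule prod.mono_neutral_left) (use assms in \<open>auto simp: not_in_keys_iff_lookup_eq_zero\<close>)

lemma single_power: "(single m x :: ('v, 'k::comm_ring_1) mpoly) ^ n = single (\<Sum>i<n. m) (x ^ n)"
  by (induction n) (auto simp: mult_single algebra_simps)

lemma prod_single: "(\<Prod>v\<in>S. single (m v) (x v) :: ('v, 'k::comm_ring_1) mpoly) = single (\<Sum>v\<in>S. m v) (\<Prod>v\<in>S. x v)"
  by (induction S rule: infinite_finite_induct) (auto simp: mult_single)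

lemma sum_single_const: "(\<Sum>i<n. single v (1::nat)) = single v n"
  by (induction n) (simp_all add: single_add[symmetric])

lemma linear_power_expansion:
  "(single 0 p + single (single v 1) 1 :: ('v, 'k::comm_ring_1) mpoly) ^ n =
    (\<Sum>e\<le>n. single (single v e) (of_nat (n choose e) * p ^ (n - e)))"
proof -
  have "(single (single v 1) 1 + single 0 p :: ('v, 'k) mpoly) ^ n =
      (\<Sum>e\<le>n. of_nat (n choose e) * single (single v 1) 1 ^ e * single 0 p ^ (n - e))"
    by (rule binomial_ring)
  also have "\<dots> = (\<Sum>e\<le>n. single (single v e) (of_nat (n choose e) * p ^ (n - e)))"
  proof (rule sum.cong[OF refl])
    fix e
    have "of_nat (n choose e) = (single 0 (of_nat (n choose e)) :: ('v, 'k) mpoly)"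
      by simp
    then show "of_nat (n choose e) * single (single v 1) 1 ^ e * single 0 p ^ (n - e) =
        (single (single v e) (of_nat (n choose e) * p ^ (n - e)) :: ('v, 'k) mpoly)"
      by (simp only: single_power mult_single sum_single_const) simp
  qed
  finally show ?thesis by (simp add: add.commute)
qed

lemma lookup_sum_single:
  assumes "finite S"
  shows "lookup (\<Sum>v\<in>S. single v (h v)) u = (if u \<in> S then h u else 0)"
  using assms by (auto simp: lookup_sum lookup_single when_def)

lemma lookup_taylor_mon:
  "lookup (mon_eval (\<lambda>v. single 0 (P v) + single (single v 1) 1) m) \<alpha> =
    hasse_mon \<alpha> m (P :: 'v \<Rightarrow> 'k::comm_ring_1)"
proof -
  let ?S = "keys m \<union> keys \<alpha>"
  let ?c = "\<lambda>v e. of_nat (lookup m v choose e) * P v ^ (lookup m v - e)"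
  have fin: "finite (PiE ?S (\<lambda>v. {..lookup m v}))"
    by (intro finite_PiE) auto
  have "mon_eval (\<lambda>v. single 0 (P v) + single (single v 1) 1) m =
      (\<Prod>v\<in>?S. \<Sum>e\<le>lookup m v. single (single v e) (?c v e))"
    by (subst mon_eval_superset[of ?S]) (auto simp: linear_power_expansion simp del: One_nat_def)
  also have "\<dots> = (\<Sum>h\<in>PiE ?S (\<lambda>v. {..lookup m v}). \<Prod>v\<in>?S. single (single v (h v)) (?c v (h v)))"
    by (rule prod_sum_PiE) auto
  also have "\<dots> = (\<Sum>h\<in>PiE ?S (\<lambda>v. {..lookup m v}).
      single (\<Sum>v\<in>?S. single v (h v)) (\<Prod>v\<in>?S. ?c v (h v)))"
    by (simp add: prod_single)
  finally have "lookup (mon_eval (\<lambda>v. single 0 (P v) + single (single v 1) 1) m) \<alpha> =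
      (\<Sum>h\<in>PiE ?S (\<lambda>v. {..lookup m v}). (\<Prod>v\<in>?S. ?c v (h v)) when (\<Sum>v\<in>?S. single v (h v)) = \<alpha>)"
    by (simp add: lookup_sum lookup_single)
  also have "\<dots> = (\<Sum>h\<in>PiE ?S (\<lambda>v. {..lookup m v}).
      if h = restrict (lookup \<alpha>) ?S then \<Prod>v\<in>?S. ?c v (lookup \<alpha> v) else 0)"
  proof (rule sum.cong[OF refl])
    fix h assume h: "h \<in> PiE ?S (\<lambda>v. {..lookup m v})"
    have eq: "(\<Sum>v\<in>?S. single v (h v)) = \<alpha> \<longleftrightarrow> h = restrict (lookup \<alpha>) ?S"
    proof
      assume "(\<Sum>v\<in>?S. single v (h v)) = \<alpha>"
      then have "h v = lookup \<alpha> v" if "v \<in> ?S" for v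
        using that lookup_sum_single[of ?S h v] by auto
      then show "h = restrict (lookup \<alpha>) ?S" using h by (auto simp: fun_eq_iff PiE_def extensional_def)
    next
      assume h': "h = restrict (lookup \<alpha>) ?S"
      show "(\<Sum>v\<in>?S. single v (h v)) = \<alpha>"
      proof (rule poly_mapping_eqI)
        fix u show "lookup (\<Sum>v\<in>?S. single v (h v)) u = lookup \<alpha> u"
          by (subst lookup_sum_single) (auto simp: h' not_in_keys_iff_lookup_eq_zero)
      qed
    qed
    show "((\<Prod>v\<in>?S. ?c v (h v)) when (\<Sum>v\<in>?S. single v (h v)) = \<alpha>) =
        (if h = restrict (lookup \<alpha>) ?S then \<Prod>v\<in>?S. ?c v (lookup \<alpha> v) else 0)"
      by (simp only: eq) (auto intro: prod.cong)
  qed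
  also have "\<dots> = (if restrict (lookup \<alpha>) ?S \<in> PiE ?S (\<lambda>v. {..lookup m v})
      then \<Prod>v\<in>?S. ?c v (lookup \<alpha> v) else 0)"
    using fin by (simp add: sum.delta)
  also have "\<dots> = (\<Prod>v\<in>?S. ?c v (lookup \<alpha> v))"
  proof (cases "restrict (lookup \<alpha>) ?S \<in> PiE ?S (\<lambda>v. {..lookup m v})")
    case False
    then obtain v where v: "v \<in> ?S" "\<not> lookup \<alpha> v \<le> lookup m v" by fastforce
    then have "?c v (lookup \<alpha> v) = 0" by (simp add: binomial_eq_0)
    then have "(\<Prod>v\<in>?S. ?c v (lookup \<alpha> v)) = 0" using v(1) by (intro prod_zero) auto
    then show ?thesis using False by simp
  qed simp
  finally show ?thesis by (simp add: hasse_mon_def)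
qed

lemma lookup_single0_mult [simp]:
  "lookup (single 0 x * f) m = x * lookup (f :: ('v, 'k::comm_ring_1) mpoly) m"
proof -
  have "single 0 x * f = (\<Sum>n\<in>keys f. single n (x * lookup f n))"
    by (subst (1) mpoly_sum_single[of f]) (simp add: sum_distrib_left mult_single)
  then show ?thesis
    by (auto simp: lookup_sum lookup_single when_def in_keys_iff)
qed

text \<open>The Taylor expansion is multiplicative in \<open>f\<close>, its coefficients are linear in \<open>f\<close> and polynomial
in \<open>P\<close>. The order of vanishing can thus be treated both as a valuation and as a linear system.\<close>

lemma lookup_taylor: "lookup (taylor P f) \<alpha> = hasse \<alpha> f P"
  by (simp add: taylor_def subst_def lookup_sum lookup_taylor_mon hasse_def del: One_nat_def)

definition vanishes_to_order :: "nat \<Rightarrow> ('v \<Rightarrow> 'k) \<Rightarrow> ('v, 'k::comm_ring_1) mpoly \<Rightarrow> bool" where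
  "vanishes_to_order t P f \<longleftrightarrow> (\<forall>\<alpha>. total_degree \<alpha> < t \<longrightarrow> hasse \<alpha> f P = 0)"

lemma total_degree_superset:
  assumes "finite S" "keys m \<subseteq> S"
  shows "total_degree m = (\<Sum>v\<in>S. lookup m v)"
  unfolding total_degree_def
  by (rule sum.mono_neutral_left) (use assms in \<open>auto simp: in_keys_iff\<close>)

lemma total_degree_add: "total_degree (m + n) = total_degree m + total_degree n"
proof -
  let ?S = "keys m \<union> keys n"
  have "total_degree (m + n) = (\<Sum>v\<in>?S. lookup (m + n) v)"
    by (rule total_degree_superset) (use Poly_Mapping.keys_add[of m n] in auto)
  also have "\<dots> = (\<Sum>v\<in>?S. lookup m v) + (\<Sum>v\<in>?S. lookup n v)"
    by (simp add: lookup_add sum.distrib)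
  finally show ?thesis by (subst (1 2) total_degree_superset[of ?S]) auto
qed

lemma total_degree_0 [simp]: "total_degree 0 = 0"
  by (simp add: total_degree_def)

lemma total_degree_single [simp]: "total_degree (single v n) = n"
  by (subst total_degree_superset[of "{v}"]) auto

lemma total_degree_eq_0_iff: "total_degree m = 0 \<longleftrightarrow> m = 0"
proof
  assume "total_degree m = 0"
  then have "lookup m v = 0" for v
    by (cases "v \<in> keys m") (auto simp: total_degree_def in_keys_iff)
  then show "m = 0" by (intro poly_mapping_eqI) simp
qed simp

lemma vanishes_to_order_iff_taylor:
  "vanishes_to_order t P f \<longleftrightarrow> (\<forall>\<alpha>\<in>keys (taylor P f). t \<le> total_degree \<alpha>)"
  by (auto simp: vanishes_to_order_def in_keys_iff lookup_taylor[symmetric] not_le[symmetric])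

lemma vanishes_to_order_0 [simp]: "vanishes_to_order 0 P f"
  by (simp add: vanishes_to_order_def)

lemma taylor_mult: "taylor P (f * g) = taylor P f * taylor P g"
  by (simp add: taylor_def const_coeff.subst_mult)

lemma taylor_add: "taylor P (f + g) = taylor P f + taylor P g"
  by (simp add: taylor_def const_coeff.subst_add)

lemma vanishes_to_order_mult:
  assumes "vanishes_to_order t P f" "vanishes_to_order u P g"
  shows "vanishes_to_order (t + u) P (f * g)"
  unfolding vanishes_to_order_iff_taylor taylor_mult
proof
  fix \<alpha> assume "\<alpha> \<in> keys (taylor P f * taylor P g)"
  then obtain \<beta> \<gamma> where "\<alpha> = \<beta> + \<gamma>" "\<beta> \<in> keys (taylor P f)" "\<gamma> \<in> keys (taylor P g)"
    using Poly_Mapping.keys_mult by blast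
  then show "t + u \<le> total_degree \<alpha>"
    using assms by (auto simp: vanishes_to_order_iff_taylor total_degree_add intro: add_mono)
qed

lemma vanishes_to_order_add:
  "vanishes_to_order t P f \<Longrightarrow> vanishes_to_order t P g \<Longrightarrow> vanishes_to_order t P (f + g)"
  unfolding vanishes_to_order_def
  by (simp add: lookup_taylor[symmetric] taylor_add lookup_add)

lemma hasse_0: "hasse 0 f P = poly_eval P f"
  by (simp add: hasse_def poly_eval_def hasse_mon_def)

lemma vanishes_to_order_1_iff: "vanishes_to_order 1 P f \<longleftrightarrow> poly_eval P f = 0"
  by (auto simp: vanishes_to_order_def total_degree_eq_0_iff hasse_0)

text \<open>Otherwise the lowest homogeneous part of the Taylor expansion of \<open>f\<close>, multiplied by the
  value of \<open>g\<close>, would occur in the expansion of \<open>g * f\<close>.\<close>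

lemma vanishes_to_order_cancel:
  fixes f g :: "('v, 'k::idom) mpoly"
  assumes "vanishes_to_order t P (g * f)" "poly_eval P g \<noteq> 0"
  shows "vanishes_to_order t P f"
proof (rule ccontr)
  assume not: "\<not> ?thesis"
  let ?F = "taylor P f" and ?G = "taylor P g"
  obtain \<alpha> where "\<alpha> \<in> keys ?F" "total_degree \<alpha> < t"
    using not by (auto simp: vanishes_to_order_iff_taylor not_le)
  then obtain \<alpha> where \<alpha>: "\<alpha> \<in> keys ?F" "total_degree \<alpha> < t"
    and min: "\<And>\<beta>. \<beta> \<in> keys ?F \<Longrightarrow> total_degree \<alpha> \<le> total_degree \<beta>"
    using ex_has_least_nat[of "\<lambda>\<alpha>. \<alpha> \<in> keys ?F \<and> total_degree \<alpha> < t" \<alpha> total_degree]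
    by (metis not_less le_trans nat_le_linear)
  have G0: "lookup ?G 0 \<noteq> 0" using assms(2) by (simp add: lookup_taylor hasse_0)
  define H where "H = ?G - single 0 (lookup ?G 0)"
  have GF: "?G * ?F = single 0 (lookup ?G 0) * ?F + H * ?F"
    by (simp add: H_def algebra_simps)
  have "\<alpha> \<notin> keys (H * ?F)"
  proof
    assume "\<alpha> \<in> keys (H * ?F)"
    then obtain \<beta> \<gamma> where bg: "\<alpha> = \<beta> + \<gamma>" "\<beta> \<in> keys H" "\<gamma> \<in> keys ?F"
      using Poly_Mapping.keys_mult by blast
    have "\<beta> \<noteq> 0" using bg(2) by (auto simp: H_def in_keys_iff lookup_minus)
    then have "total_degree \<gamma> < total_degree \<alpha>"
      using bg(1) total_degree_eq_0_iff[of \<beta>] by (simp add: total_degree_add)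
    then show False using min[OF bg(3)] by simp
  qed
  then have "lookup (?G * ?F) \<alpha> = lookup ?G 0 * lookup ?F \<alpha>"
    by (simp add: GF lookup_add in_keys_iff)
  then have "lookup (?G * ?F) \<alpha> \<noteq> 0" using G0 \<alpha> by (simp add: in_keys_iff)
  moreover have "lookup (?G * ?F) \<alpha> = 0"
    using assms(1) \<alpha>(2) by (simp add: vanishes_to_order_def taylor_mult[symmetric] lookup_taylor)
  ultimately show False by contradiction
qed

section \<open>Divided differences and the footprint of a grid\<close>

text \<open>As a function of \<open>j\<close>, this is the functional "\<open>e\<close>-th Hasse derivative at \<open>a\<close>" on univariate
polynomials, given by its values on the powers of the variable.\<close>

definition hasse_power :: "'k::comm_ring_1 \<Rightarrow> nat \<Rightarrow> nat \<Rightarrow> 'k" where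
  "hasse_power a e j = of_nat (j choose e) * a ^ (j - e)"

definition hasse_span :: "'k set \<Rightarrow> ('k \<Rightarrow> nat) \<Rightarrow> (nat \<Rightarrow> 'k::comm_ring_1) set" where
  "hasse_span A \<mu> = {\<lambda>j. \<Sum>a\<in>A. \<Sum>e<\<mu> a. c a e * hasse_power a e j | c. True}"

lemma hasse_span_gen:
  assumes "finite A" "a \<in> A" "e < \<mu> a"
  shows "hasse_power a e \<in> hasse_span A \<mu>"
proof -
  let ?c = "\<lambda>a' e'. if a' = a \<and> e' = e then 1 else 0"
  have "(\<Sum>a'\<in>A. \<Sum>e'<\<mu> a'. ?c a' e' * hasse_power a' e' j) = hasse_power a e j" for j
  proof -
    have "(\<Sum>e'<\<mu> a'. ?c a' e' * hasse_power a' e' j) = (if a' = a then hasse_power a e j else 0)" for a'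
      using assms(3) by (auto simp: if_distrib[of "\<lambda>x. x * _"] cong: if_cong)
    then show ?thesis using assms by simp
  qed
  then show ?thesis unfolding hasse_span_def
    by (intro CollectI exI[of _ ?c]) (auto simp: fun_eq_iff)
qed

lemma hasse_span_add:
  assumes "f \<in> hasse_span A \<mu>" "g \<in> hasse_span A \<mu>"
  shows "(\<lambda>j. f j + g j) \<in> hasse_span A \<mu>"
proof -
  obtain c c' where "f = (\<lambda>j. \<Sum>a\<in>A. \<Sum>e<\<mu> a. c a e * hasse_power a e j)"
    "g = (\<lambda>j. \<Sum>a\<in>A. \<Sum>e<\<mu> a. c' a e * hasse_power a e j)"
    using assms by (auto simp: hasse_span_def)
  then have "(\<lambda>j. f j + g j) = (\<lambda>j. \<Sum>a\<in>A. \<Sum>e<\<mu> a. (c a e + c' a e) * hasse_power a e j)"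
    by (simp add: algebra_simps sum.distrib)
  then show ?thesis unfolding hasse_span_def by (intro CollectI exI conjI) auto
qed

lemma hasse_span_scale:
  assumes "f \<in> hasse_span A \<mu>"
  shows "(\<lambda>j. x * f j) \<in> hasse_span A \<mu>"
proof -
  obtain c where "f = (\<lambda>j. \<Sum>a\<in>A. \<Sum>e<\<mu> a. c a e * hasse_power a e j)"
    using assms by (auto simp: hasse_span_def)
  then have "(\<lambda>j. x * f j) = (\<lambda>j. \<Sum>a\<in>A. \<Sum>e<\<mu> a. (x * c a e) * hasse_power a e j)"
    by (simp add: sum_distrib_left mult.assoc)
  then show ?thesis unfolding hasse_span_def by (intro CollectI exI conjI) auto
qed

lemma hasse_span_0: "(\<lambda>j. 0) \<in> hasse_span A \<mu>"
  unfolding hasse_span_def by (intro CollectI exI[of _ "\<lambda>_ _. 0"]) auto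

lemma hasse_span_sum:
  "(\<And>i. i \<in> I \<Longrightarrow> f i \<in> hasse_span A \<mu>) \<Longrightarrow> (\<lambda>j. \<Sum>i\<in>I. f i j) \<in> hasse_span A \<mu>"
  by (induction I rule: infinite_finite_induct) (auto intro: hasse_span_0 hasse_span_add)

lemma hasse_power_shift_0: "hasse_power a 0 (Suc j) - a * hasse_power a 0 j = 0"
  by (simp add: hasse_power_def)

lemma hasse_power_shift_Suc: "hasse_power a (Suc e) (Suc j) - a * hasse_power a (Suc e) j = hasse_power a e j"
proof (cases "e < j")
  case True
  then have "a ^ (j - e) = a * a ^ (j - Suc e)"
    by (metis Suc_diff_Suc power_Suc)
  then show ?thesis by (simp add: hasse_power_def algebra_simps)
next
  case False
  then show ?thesis by (cases "j = e") (auto simp: hasse_power_def binomial_eq_0)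
qed

text \<open>Sending \<open>f\<close> to \<open>\<lambda>j. f (j + 1) - a * f j\<close> is dual to the multiplication by \<open>x - a\<close>. At the node \<open>a\<close> it
lowers the order of a derivative by one; at another node \<open>b\<close> it is triangular, with \<open>b - a\<close> on the
diagonal.\<close>

lemma hasse_span_shift_surj_gen:
  fixes a :: "'k::field"
  assumes "finite A" "a \<in> A" "b \<in> A" "e < (\<mu>(a := \<mu> a - 1)) b"
  shows "\<exists>f\<in>hasse_span A \<mu>. \<forall>j. f (Suc j) - a * f j = hasse_power b e j"
proof (cases "b = a")
  case True
  then have "hasse_power a (Suc e) \<in> hasse_span A \<mu>" using assms by (intro hasse_span_gen) auto
  then show ?thesis using True hasse_power_shift_Suc by blast
next
  case False
  have "e < \<mu> b" using False assms(4) by simp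
  then show ?thesis
  proof (induction e)
    case 0
    have "(\<lambda>j. inverse (b - a) * hasse_power b 0 j) \<in> hasse_span A \<mu>"
      by (intro hasse_span_scale hasse_span_gen) (use assms 0 in auto)
    moreover have "inverse (b - a) * hasse_power b 0 (Suc j) - a * (inverse (b - a) * hasse_power b 0 j) = hasse_power b 0 j" for j
    proof -
      have "inverse (b - a) * hasse_power b 0 (Suc j) - a * (inverse (b - a) * hasse_power b 0 j) =
          inverse (b - a) * ((hasse_power b 0 (Suc j) - b * hasse_power b 0 j) + (b - a) * hasse_power b 0 j)"
        by (simp add: algebra_simps)
      also have "\<dots> = hasse_power b 0 j" using False by (simp add: hasse_power_shift_0)
      finally show ?thesis .
    qed
    ultimately show ?case by (intro bexI[of _ "\<lambda>j. inverse (b - a) * hasse_power b 0 j"]) auto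
  next
    case (Suc e)
    then obtain f where f: "f \<in> hasse_span A \<mu>" "\<And>j. f (Suc j) - a * f j = hasse_power b e j" by auto
    define g where "g = (\<lambda>j. inverse (b - a) * (hasse_power b (Suc e) j + (-1) * f j))"
    have "g \<in> hasse_span A \<mu>" unfolding g_def
      by (intro hasse_span_scale hasse_span_add hasse_span_gen) (use assms Suc f in auto)
    moreover have "g (Suc j) - a * g j = hasse_power b (Suc e) j" for j
    proof -
      have "g (Suc j) - a * g j = inverse (b - a) * ((hasse_power b (Suc e) (Suc j) - b * hasse_power b (Suc e) j)
          + (b - a) * hasse_power b (Suc e) j - (f (Suc j) - a * f j))"
        by (simp add: g_def algebra_simps)
      also have "\<dots> = hasse_power b (Suc e) j"
        using False by (simp add: hasse_power_shift_Suc f(2))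
      finally show ?thesis .
    qed
    ultimately show ?case by blast
  qed
qed

lemma hasse_span_shift_surj:
  fixes a :: "'k::field"
  assumes "finite A" "a \<in> A" "g \<in> hasse_span A (\<mu>(a := \<mu> a - 1))"
  shows "\<exists>f\<in>hasse_span A \<mu>. \<forall>j. f (Suc j) - a * f j = g j"
proof -
  let ?\<nu> = "\<mu>(a := \<mu> a - 1)"
  obtain c where g: "g = (\<lambda>j. \<Sum>b\<in>A. \<Sum>e<?\<nu> b. c b e * hasse_power b e j)"
    using assms(3) by (auto simp: hasse_span_def)
  have "\<forall>b e. \<exists>f. b \<in> A \<and> e < ?\<nu> b \<longrightarrow> f \<in> hasse_span A \<mu> \<and> (\<forall>j. f (Suc j) - a * f j = hasse_power b e j)"
    using hasse_span_shift_surj_gen[OF assms(1,2)] by metis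
  then obtain F where F: "\<And>b e. b \<in> A \<Longrightarrow> e < ?\<nu> b \<Longrightarrow> F b e \<in> hasse_span A \<mu>"
    "\<And>b e j. b \<in> A \<Longrightarrow> e < ?\<nu> b \<Longrightarrow> F b e (Suc j) - a * F b e j = hasse_power b e j"
    by metis
  define f where "f = (\<lambda>j. \<Sum>b\<in>A. \<Sum>e<?\<nu> b. c b e * F b e j)"
  have "f \<in> hasse_span A \<mu>" unfolding f_def
    by (intro hasse_span_sum hasse_span_scale F) auto
  moreover have "f (Suc j) - a * f j = g j" for j
  proof -
    have "f (Suc j) - a * f j = (\<Sum>b\<in>A. \<Sum>e<?\<nu> b. c b e * (F b e (Suc j) - a * F b e j))"
      unfolding f_def by (simp add: sum_distrib_left sum_subtractf right_diff_distrib mult.left_commute)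
    also have "\<dots> = g j" unfolding g by (intro sum.cong refl) (use F(2) in auto)
    finally show ?thesis .
  qed
  ultimately show ?thesis by blast
qed

text \<open>The divided difference with \<open>n + 1\<close> nodes extracts the leading coefficient of a polynomial of degree
\<open>n\<close>. It arises from the one with a node \<open>a\<close> fewer by inverting the multiplication by \<open>x - a\<close>; the
evaluation at \<open>a\<close> spans the kernel of this operation and is used to make the value at \<open>j = 0\<close> zero.\<close>

lemma divided_difference:
  fixes A :: "'k::field set"
  assumes "finite A" "(\<Sum>a\<in>A. \<mu> a) = Suc n"
  shows "\<exists>f\<in>hasse_span A \<mu>. (\<forall>j<n. f j = 0) \<and> f n = 1"
  using assms(2)
proof (induction n arbitrary: \<mu>)
  case 0
  then obtain a where "a \<in> A" "\<mu> a > 0"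
    by (metis gr0I nat.distinct(1) sum.neutral)
  then have "hasse_power a 0 \<in> hasse_span A \<mu>" using assms(1) by (intro hasse_span_gen) auto
  then show ?case by (intro bexI[of _ "hasse_power a 0"]) (auto simp: hasse_power_def)
next
  case (Suc n)
  then obtain a where a: "a \<in> A" "\<mu> a > 0" by (metis gr0I nat.distinct(1) sum.neutral)
  have "(\<Sum>b\<in>A. (\<mu>(a := \<mu> a - 1)) b) = Suc n"
    using Suc.prems a assms(1) by (simp add: sum.remove[of A a])
  then obtain g where g: "g \<in> hasse_span A (\<mu>(a := \<mu> a - 1))" "\<forall>j<n. g j = 0" "g n = 1"
    using Suc.IH by blast
  obtain f where f: "f \<in> hasse_span A \<mu>" "\<And>j. f (Suc j) - a * f j = g j"
    using hasse_span_shift_surj[OF assms(1) a(1) g(1)] by auto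
  \<comment> \<open>Evaluation at \<open>a\<close> is annihilated by the shift and has the value 1 at \<open>j = 0\<close>.\<close>
  define h where "h = (\<lambda>j. f j + (- f 0) * hasse_power a 0 j)"
  have h: "h \<in> hasse_span A \<mu>" unfolding h_def
    by (intro hasse_span_add hasse_span_scale hasse_span_gen f) (use a assms(1) in auto)
  have h0: "h 0 = 0" by (simp add: h_def hasse_power_def)
  have step: "h (Suc j) = a * h j + g j" for j
    using f(2)[of j] hasse_power_shift_0[of a j] by (simp add: h_def algebra_simps)
  have "h j = 0" if "j \<le> n" for j
    using that by (induction j) (auto simp: h0 step g)
  then show ?case using h step[of n] g(3) by (intro bexI[of _ h]) auto
qed

lemma ex_bounded_sum:
  assumes "finite A" "n \<le> card A * B"
  shows "\<exists>\<mu>. (\<forall>a. \<mu> a \<le> B) \<and> (\<Sum>a\<in>A. \<mu> a) = (n::nat)"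
  using assms
proof (induction A arbitrary: n rule: finite_induct)
  case empty
  then show ?case by (intro exI[of _ "\<lambda>_. 0"]) auto
next
  case (insert x A)
  obtain \<mu> where \<mu>: "\<forall>a. \<mu> a \<le> B" "(\<Sum>a\<in>A. \<mu> a) = n - min B n"
  proof -
    have "n - min B n \<le> card A * B" using insert.prems insert.hyps by (auto simp: min_def)
    then show ?thesis using insert.IH[of "n - min B n"] that by blast
  qed
  have "(\<Sum>a\<in>A. (\<mu>(x := min B n)) a) = (\<Sum>a\<in>A. \<mu> a)"
    using insert.hyps by (intro sum.cong) auto
  then show ?case using \<mu> insert.hyps
    by (intro exI[of _ "\<mu>(x := min B n)"]) auto
qed

text \<open>If \<open>n + 1\<close> nodes are spread evenly over \<open>A\<close>, then only derivatives of order at most \<open>n div card A\<close>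
occur. At the single node 0, the \<open>n\<close>-th derivative extracts the \<open>n\<close>-th coefficient also from
polynomials of higher degree.\<close>

lemma coefficient_functional:
  fixes A :: "'k::field set"
  assumes "finite A" "A \<noteq> {}"
  shows "\<exists>c. let l = \<lambda>j. \<Sum>(a, e)\<in>A \<times> {..n div card A}. c a e * hasse_power a e j
    in (\<forall>j<n. l j = 0) \<and> l n = 1 \<and> (A = {0} \<longrightarrow> (\<forall>j>n. l j = 0))"
proof (cases "A = {0}")
  case True
  let ?c = "\<lambda>(a::'k) e. if e = n then 1 else 0"
  have "(\<Sum>(a, e)\<in>A \<times> {..n div card A}. ?c a e * hasse_power a e j) = hasse_power 0 n j" for j
    unfolding True sum.cartesian_product[symmetric]
    by (simp add: if_distrib[of "\<lambda>x. x * _"] cong: if_cong)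
  then show ?thesis by (intro exI[of _ ?c]) (auto simp: hasse_power_def Let_def binomial_eq_0)
next
  case False
  let ?q = "n div card A"
  have "card A > 0" using assms by (simp add: card_gt_0_iff)
  then have "Suc n \<le> card A * Suc ?q"
    using dividend_less_times_div[of "card A" n] by simp
  then obtain \<mu> where \<mu>: "\<forall>a. \<mu> a \<le> Suc ?q" "(\<Sum>a\<in>A. \<mu> a) = Suc n"
    using ex_bounded_sum[OF assms(1)] by metis
  obtain f c where f: "f = (\<lambda>j. \<Sum>a\<in>A. \<Sum>e<\<mu> a. c a e * hasse_power a e j)" "\<forall>j<n. f j = 0" "f n = 1"
    using divided_difference[OF assms(1) \<mu>(2)] by (auto simp: hasse_span_def)
  let ?c = "\<lambda>a e. if e < \<mu> a then c a e else 0"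
  have "(\<Sum>(a, e)\<in>A \<times> {..?q}. ?c a e * hasse_power a e j) = f j" for j
  proof -
    have "(\<Sum>e\<le>?q. ?c a e * hasse_power a e j) = (\<Sum>e<\<mu> a. c a e * hasse_power a e j)" for a
      by (rule sum.mono_neutral_cong_right) (use \<mu>(1)[rule_format, of a] in auto)
    then show ?thesis by (simp add: f(1) sum.cartesian_product[symmetric])
  qed
  then show ?thesis using f(2,3) False by (intro exI[of _ ?c]) (auto simp: Let_def)
qed

text \<open>The product of the coefficient functionals for the exponents of \<open>m\<close>, over all variables but \<open>b\<close>, is a
combination of Hasse derivatives of order at most \<open>\<Sum>i. m\<^sub>i div card (A i)\<close> at points of the grid. By
the maximality of \<open>m\<close> its value at \<open>f\<close> is the coefficient of \<open>m\<close>, which is not zero.\<close>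

lemma footprint:
  fixes f :: "('v, 'k::field) mpoly"
  assumes V: "finite V" "b \<in> V" "poly_vars f \<subseteq> V"
    and A: "\<And>i. i \<in> V - {b} \<Longrightarrow> finite (A i) \<and> A i \<noteq> {}"
    and van: "\<And>P. P b = 1 \<Longrightarrow> (\<And>i. i \<in> V - {b} \<Longrightarrow> P i \<in> A i) \<Longrightarrow> (\<And>i. i \<notin> V \<Longrightarrow> P i = 0)
      \<Longrightarrow> vanishes_to_order t P f"
    and m: "m \<in> keys f"
    and max: "\<And>m'. m' \<in> keys f \<Longrightarrow> (\<And>i. i \<in> V - {b} \<Longrightarrow> lookup m i \<le> lookup m' i)
      \<Longrightarrow> (\<And>i. i \<in> V - {b} \<Longrightarrow> A i = {0} \<Longrightarrow> lookup m' i = lookup m i) \<Longrightarrow> m' = m"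
  shows "t \<le> (\<Sum>i\<in>V - {b}. lookup m i div card (A i))"
proof (rule ccontr)
  let ?W = "V - {b}"
  assume "\<not> ?thesis"
  then have less: "(\<Sum>i\<in>?W. lookup m i div card (A i)) < t" by simp
  have fW: "finite ?W" using V by simp
  let ?B = "\<lambda>i. A i \<times> {..lookup m i div card (A i)}"
  let ?l = "\<lambda>c i j. \<Sum>(a, e)\<in>?B i. c a e * hasse_power a e j"
  define Q where "Q i c \<longleftrightarrow> (\<forall>j<lookup m i. ?l c i j = 0) \<and> ?l c i (lookup m i) = 1 \<and>
      (A i = {0} \<longrightarrow> (\<forall>j>lookup m i. ?l c i j = 0))" for i c
  have "\<forall>i\<in>?W. \<exists>c. Q i c"
  proof
    fix i assume "i \<in> ?W"
    then show "\<exists>c. Q i c"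
      using coefficient_functional[of "A i" "lookup m i"] A[of i] unfolding Let_def Q_def by simp
  qed
  then obtain c where c: "\<forall>i\<in>?W. Q i (c i)" by (rule bchoice[THEN exE])
  have c1: "?l (c i) i j = 0" if "i \<in> ?W" "j < lookup m i" for i j
    using c[rule_format, OF that(1)] that(2) unfolding Q_def by simp
  have c2: "?l (c i) i (lookup m i) = 1" if "i \<in> ?W" for i
    using c[rule_format, OF that] unfolding Q_def by simp
  have c3: "?l (c i) i j = 0" if "i \<in> ?W" "A i = {0}" "j > lookup m i" for i j
    using c[rule_format, OF that(1)] that(2,3) unfolding Q_def by simp
  define L where "L m' = (\<Prod>i\<in>?W. ?l (c i) i (lookup m' i))" for m'
  have L0: "L m' = 0" if m': "m' \<in> keys f" "m' \<noteq> m" for m'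
  proof -
    obtain i where i: "i \<in> ?W" "lookup m' i < lookup m i \<or> A i = {0} \<and> lookup m' i > lookup m i"
      using max[OF m'(1)] m'(2) by (meson linorder_neqE_nat not_le)
    then have "?l (c i) i (lookup m' i) = 0" using c1 c3 by blast
    then show ?thesis unfolding L_def using i(1) fW by (intro prod_zero) auto
  qed
  have Lm: "L m = 1" unfolding L_def by (rule prod.neutral) (use c2 in blast)
  define pt where "pt h = (\<lambda>i. if i = b then 1 else if i \<in> V then fst (h i) else (0::'k))" for h :: "'v \<Rightarrow> 'k \<times> nat"
  define ex where "ex h = (\<Sum>i\<in>?W. single i (snd (h i)))" for h :: "'v \<Rightarrow> 'k \<times> nat"
  have lex: "lookup (ex h) i = (if i \<in> ?W then snd (h i) else 0)" for h i
    unfolding ex_def using lookup_sum_single[OF fW, of "\<lambda>i. snd (h i)"] by simp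
  have L_eq: "L m' = (\<Sum>h\<in>PiE ?W ?B. (\<Prod>i\<in>?W. c i (fst (h i)) (snd (h i))) * hasse_mon (ex h) m' (pt h))"
    if m': "m' \<in> keys f" for m'
  proof -
    have "L m' = (\<Sum>h\<in>PiE ?W ?B. \<Prod>i\<in>?W. (case h i of (a, e) \<Rightarrow> c i a e * hasse_power a e (lookup m' i)))"
      unfolding L_def by (rule prod_sum_PiE) (use fW A in auto)
    also have "\<dots> = (\<Sum>h\<in>PiE ?W ?B. (\<Prod>i\<in>?W. c i (fst (h i)) (snd (h i))) * hasse_mon (ex h) m' (pt h))"
    proof (rule sum.cong[OF refl])
      fix h
      have "keys m' \<subseteq> V" using m' V(3) by (auto simp: poly_vars_def)
      moreover have "keys (ex h) \<subseteq> V" by (auto simp: in_keys_iff lex split: if_splits)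
      ultimately have "hasse_mon (ex h) m' (pt h) = (\<Prod>v\<in>V. of_nat (lookup m' v choose lookup (ex h) v)
          * pt h v ^ (lookup m' v - lookup (ex h) v))"
        using V(1) by (intro hasse_mon_superset) auto
      also have "\<dots> = (\<Prod>v\<in>?W. of_nat (lookup m' v choose lookup (ex h) v)
          * pt h v ^ (lookup m' v - lookup (ex h) v))"
        by (rule prod.mono_neutral_right) (use V in \<open>auto simp: lex pt_def\<close>)
      also have "\<dots> = (\<Prod>i\<in>?W. hasse_power (fst (h i)) (snd (h i)) (lookup m' i))"
        by (intro prod.cong refl) (auto simp: lex pt_def hasse_power_def)
      finally show "(\<Prod>i\<in>?W. (case h i of (a, e) \<Rightarrow> c i a e * hasse_power a e (lookup m' i))) =
          (\<Prod>i\<in>?W. c i (fst (h i)) (snd (h i))) * hasse_mon (ex h) m' (pt h)"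
        by (simp add: prod.distrib[symmetric] case_prod_unfold)
    qed
    finally show ?thesis .
  qed
  have "(\<Sum>m'\<in>keys f. lookup f m' * L m') =
      (\<Sum>m'\<in>keys f. \<Sum>h\<in>PiE ?W ?B. (\<Prod>i\<in>?W. c i (fst (h i)) (snd (h i))) * (lookup f m' * hasse_mon (ex h) m' (pt h)))"
    by (intro sum.cong refl) (simp add: L_eq sum_distrib_left mult_ac)
  also have "\<dots> = (\<Sum>h\<in>PiE ?W ?B. (\<Prod>i\<in>?W. c i (fst (h i)) (snd (h i))) * hasse (ex h) f (pt h))"
    by (subst sum.swap) (simp add: hasse_def sum_distrib_left)
  also have "\<dots> = 0"
  proof (rule sum.neutral, rule ballI)
    fix h assume h: "h \<in> PiE ?W ?B"
    have hi: "fst (h i) \<in> A i" "snd (h i) \<le> lookup m i div card (A i)" if "i \<in> ?W" for i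
      using PiE_mem[OF h that] by auto
    have "vanishes_to_order t (pt h) f"
      by (rule van) (use V hi in \<open>auto simp: pt_def\<close>)
    moreover have "total_degree (ex h) = (\<Sum>i\<in>?W. snd (h i))"
      by (subst total_degree_superset[of ?W]) (use fW in \<open>auto simp: lex in_keys_iff split: if_splits\<close>)
    moreover have "(\<Sum>i\<in>?W. snd (h i)) \<le> (\<Sum>i\<in>?W. lookup m i div card (A i))"
      by (intro sum_mono hi)
    ultimately have "hasse (ex h) f (pt h) = 0" using less by (auto simp: vanishes_to_order_def)
    then show "(\<Prod>i\<in>?W. c i (fst (h i)) (snd (h i))) * hasse (ex h) f (pt h) = 0" by simp
  qed
  finally have "(\<Sum>m'\<in>keys f. lookup f m' * L m') = 0" .
  moreover have "(\<Sum>m'\<in>keys f. lookup f m' * L m') = lookup f m"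
    using m by (subst sum.remove[of _ m]) (auto simp: L0 Lm)
  ultimately show False using m by (simp add: in_keys_iff)
qed

section \<open>Configurations with a large Waldschmidt constant\<close>

definition waldschmidt_bound :: "nat \<Rightarrow> (nat \<Rightarrow> 'k::field) set \<Rightarrow> nat \<Rightarrow> nat \<Rightarrow> bool" where
  "waldschmidt_bound N X p q \<longleftrightarrow> (\<forall>f d t. f \<noteq> 0 \<longrightarrow> poly_vars f \<subseteq> {0..N} \<longrightarrow>
     homogeneous_of_degree d f \<longrightarrow> (\<forall>P\<in>X. vanishes_to_order t P f) \<longrightarrow> p * t \<le> q * d)"

text \<open>A grid in the chart \<open>x\<^sub>b = 1\<close>. The coordinates outside \<open>{0..N}\<close> are fixed so that the points can be
counted.\<close>

definition grid :: "nat \<Rightarrow> nat \<Rightarrow> (nat \<Rightarrow> 'k::field set) \<Rightarrow> (nat \<Rightarrow> 'k) set" where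
  "grid N b A = {P. P b = 1 \<and> (\<forall>i\<in>{0..N} - {b}. P i \<in> A i) \<and> (\<forall>i. i \<notin> {0..N} \<longrightarrow> P i = 0)}"

lemma grid_finite_card:
  assumes "b \<le> N" "\<And>i. i \<in> {0..N} - {b} \<Longrightarrow> finite (A i)"
  shows "finite (grid N b A)" "card (grid N b A) = (\<Prod>i\<in>{0..N} - {b}. card (A i))"
proof -
  let ?W = "{0..N} - {b}"
  let ?g = "\<lambda>h i. if i = b then 1 else if i \<le> N then h i else 0"
  have bij: "bij_betw (\<lambda>P. restrict P ?W) (grid N b A) (PiE ?W A)"
    by (rule bij_betwI[where g = ?g])
      (use assms(1) in \<open>auto simp: grid_def fun_eq_iff PiE_iff extensional_def\<close>)
  have fin: "finite (PiE ?W A)" using assms(2) by (intro finite_PiE) auto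
  show "finite (grid N b A)" using bij_betw_finite[OF bij] fin by simp
  show "card (grid N b A) = (\<Prod>i\<in>?W. card (A i))"
    using bij_betw_same_card[OF bij] by (simp add: card_PiE)
qed

lemma homogeneous_total_degree:
  fixes f :: "(nat, 'k::zero) mpoly"
  assumes "homogeneous_of_degree d f" "poly_vars f \<subseteq> {0..N}" "m \<in> keys f"
  shows "(\<Sum>i\<in>{0..N}. lookup m i) = d"
proof -
  have "keys m \<subseteq> {0..N}" using assms(2,3) by (auto simp: poly_vars_def)
  then have "total_degree m = (\<Sum>i\<in>{0..N}. lookup m i)" by (intro total_degree_superset[of "{0..N}"]) auto
  then show ?thesis using assms(1,3) by (simp add: homogeneous_of_degree_def)
qed

text \<open>In a form, a monomial that dominates \<open>m\<close> away from \<open>b\<close> has a smaller exponent at \<open>b\<close>. The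
maximality required by the footprint bound therefore follows from the minimality of the exponent at
\<open>b\<close>.\<close>

lemma footprint_form:
  fixes f :: "(nat, 'k::field) mpoly"
  assumes f: "homogeneous_of_degree d f" "poly_vars f \<subseteq> {0..N}" and b: "b \<le> N"
    and A: "\<And>i. i \<in> {0..N} - {b} \<Longrightarrow> finite (A i) \<and> A i \<noteq> {}"
    and van: "\<forall>P\<in>grid N b A. vanishes_to_order t P f"
    and m: "m \<in> keys f"
    and min: "\<And>m'. m' \<in> keys f \<Longrightarrow> (\<And>i. i \<in> {0..N} - {b} \<Longrightarrow> A i = {0} \<Longrightarrow> lookup m' i = lookup m i)
      \<Longrightarrow> lookup m b \<le> lookup m' b"
  shows "t \<le> (\<Sum>i\<in>{0..N} - {b}. lookup m i div card (A i))"
proof (rule footprint[where f = f])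
  show "m \<in> keys f" by (fact m)
  fix P :: "nat \<Rightarrow> 'k"
  assume "P b = 1" "\<And>i. i \<in> {0..N} - {b} \<Longrightarrow> P i \<in> A i" "\<And>i. i \<notin> {0..N} \<Longrightarrow> P i = 0"
  then have "P \<in> grid N b A" by (auto simp: grid_def)
  then show "vanishes_to_order t P f" using van by blast
next
  fix m' assume m': "m' \<in> keys f" and le: "\<And>i. i \<in> {0..N} - {b} \<Longrightarrow> lookup m i \<le> lookup m' i"
    and eq: "\<And>i. i \<in> {0..N} - {b} \<Longrightarrow> A i = {0} \<Longrightarrow> lookup m' i = lookup m i"
  have mb: "lookup m b \<le> lookup m' b" by (rule min[OF m' eq])
  have all: "lookup m i \<le> lookup m' i" if "i \<in> {0..N}" for i
    using le[of i] mb that by (cases "i = b") auto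
  have sum: "(\<Sum>i\<in>{0..N}. lookup m' i) = (\<Sum>i\<in>{0..N}. lookup m i)"
    using homogeneous_total_degree[OF f] m m' by simp
  show "m' = m"
  proof (rule poly_mapping_eqI)
    fix i
    show "lookup m' i = lookup m i"
    proof (cases "i \<in> {0..N}")
      case True
      show ?thesis
      proof (rule ccontr)
        assume "lookup m' i \<noteq> lookup m i"
        then have "lookup m i < lookup m' i" using all[OF True] by simp
        then have "(\<Sum>i\<in>{0..N}. lookup m i) < (\<Sum>i\<in>{0..N}. lookup m' i)"
          using True all by (intro sum_strict_mono_ex1) auto
        then show False using sum by simp
      qed
    next
      case False
      then show ?thesis using f(2) m m'
        by (metis (no_types, lifting) UN_subset_iff in_mono not_in_keys_iff_lookup_eq_zero poly_vars_def)
    qed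
  qed
qed (use assms in auto)

lemma ex_min_key:
  assumes "(f :: ('v, 'k::zero) mpoly) \<noteq> 0"
  shows "\<exists>m\<in>keys f. \<forall>m'\<in>keys f. lookup m b \<le> lookup m' b"
proof -
  obtain m0 where "m0 \<in> keys f" using assms by (metis all_not_in_conv keys_eq_empty)
  then show ?thesis
    using ex_has_least_nat[of "\<lambda>m. m \<in> keys f" m0 "\<lambda>m. lookup m b"] by blast
qed

text \<open>The monomial with the least exponent at \<open>x\<^sub>0\<close> serves for all grids at once. The \<open>j\<close>-th grid gives
\<open>t \<le> \<Sum>i. m\<^sub>i / card (A j i)\<close>, where \<open>1 / card (A j i) = c j i / L\<close>; summing over \<open>j\<close> bounds
\<open>card J * t\<close> by \<open>B / L\<close> times the degree.\<close>

lemma averaging_bound: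
  fixes A :: "'j \<Rightarrow> nat \<Rightarrow> 'k::field set"
  assumes J: "finite J"
    and A: "\<And>j i. j \<in> J \<Longrightarrow> i \<in> {1..N} \<Longrightarrow> finite (A j i) \<and> c j i * card (A j i) = L"
    and L: "L > 0"
    and w: "\<And>i. i \<in> {1..N} \<Longrightarrow> (\<Sum>j\<in>J. c j i) \<le> B"
  shows "waldschmidt_bound N (\<Union>j\<in>J. grid N 0 (A j)) (L * card J) B"
  unfolding waldschmidt_bound_def
proof (intro allI impI)
  fix f :: "(nat, 'k) mpoly" and d t
  assume f: "f \<noteq> 0" "poly_vars f \<subseteq> {0..N}" "homogeneous_of_degree d f"
    and van: "\<forall>P\<in>\<Union>j\<in>J. grid N 0 (A j). vanishes_to_order t P f"
  obtain m where m: "m \<in> keys f" "\<And>m'. m' \<in> keys f \<Longrightarrow> lookup m 0 \<le> lookup m' 0"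
    using ex_min_key[OF f(1), of 0] by blast
  have W: "{0..N} - {0} = {1..N}" by auto
  have "L * t \<le> (\<Sum>i\<in>{1..N}. lookup m i * c j i)" if j: "j \<in> J" for j
  proof -
    have "t \<le> (\<Sum>i\<in>{0..N} - {0}. lookup m i div card (A j i))"
    proof (rule footprint_form[OF f(3,2)])
      fix i assume "i \<in> {0..N} - {0}"
      then have "finite (A j i)" "c j i * card (A j i) = L" using A[OF j, of i] by auto
      then show "finite (A j i) \<and> A j i \<noteq> {}" using L by auto
    qed (use van j m in auto)
    then have "L * t \<le> (\<Sum>i\<in>{1..N}. L * (lookup m i div card (A j i)))"
      unfolding W sum_distrib_left[symmetric] by simp
    also have "\<dots> \<le> (\<Sum>i\<in>{1..N}. lookup m i * c j i)"
    proof (rule sum_mono)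
      fix i assume "i \<in> {1..N}"
      then have "L * (lookup m i div card (A j i)) = c j i * (card (A j i) * (lookup m i div card (A j i)))"
        using A[OF j, of i] by (simp add: mult.assoc[symmetric])
      also have "\<dots> \<le> c j i * lookup m i" by (intro mult_left_mono) auto
      finally show "L * (lookup m i div card (A j i)) \<le> lookup m i * c j i" by (simp add: mult.commute)
    qed
    finally show ?thesis .
  qed
  then have "(\<Sum>j\<in>J. L * t) \<le> (\<Sum>j\<in>J. \<Sum>i\<in>{1..N}. lookup m i * c j i)"
    by (rule sum_mono)
  also have "\<dots> = (\<Sum>i\<in>{1..N}. lookup m i * (\<Sum>j\<in>J. c j i))"
    by (subst sum.swap) (simp add: sum_distrib_left)
  also have "\<dots> \<le> (\<Sum>i\<in>{1..N}. lookup m i * B)"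
    by (intro sum_mono mult_left_mono w) auto
  also have "\<dots> = B * (\<Sum>i\<in>{1..N}. lookup m i)" by (simp add: sum_distrib_left mult.commute)
  also have "\<dots> \<le> B * (\<Sum>i\<in>{0..N}. lookup m i)" by (intro mult_left_mono sum_mono2) auto
  also have "\<dots> = B * d" using homogeneous_total_degree[OF f(3,2) m(1)] by simp
  finally show "L * card J * t \<le> B * d" by (simp add: mult_ac)
qed

definition has_bound :: "'k::field itself \<Rightarrow> nat \<Rightarrow> nat \<Rightarrow> nat \<Rightarrow> nat \<Rightarrow> bool" where
  "has_bound TYPE('k) N s p q \<longleftrightarrow>
     (\<exists>X :: (nat \<Rightarrow> 'k) set. finite X \<and> card X \<le> s \<and> waldschmidt_bound N X p q)"

lemma has_bound_mono: "has_bound TYPE('k::field) N s p q \<Longrightarrow> s \<le> s' \<Longrightarrow> has_bound TYPE('k) N s' p q"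
  unfolding has_bound_def by (meson le_trans)

lemma infinite_alg_closed: "infinite (UNIV :: 'k::alg_closed_field set)"
proof
  assume fin: "finite (UNIV :: 'k set)"
  define p :: "'k poly" where "p = (\<Prod>a\<in>UNIV. [:- a, 1:]) + 1"
  have deg: "degree (\<Prod>a\<in>(UNIV :: 'k set). [:- a, 1:]) = card (UNIV :: 'k set)"
    by (subst degree_prod_eq_sum_degree) auto
  have "card (UNIV :: 'k set) > 0" using fin by (simp add: finite_UNIV_card_ge_0)
  then have "degree p > 0" unfolding p_def by (subst degree_add_eq_left) (auto simp: deg)
  then obtain x where "poly p x = 0" using alg_closed_imp_poly_has_root by blast
  moreover have "poly (\<Prod>a\<in>(UNIV :: 'k set). [:- a, 1:]) x = 0"
    using fin by (auto simp: poly_prod intro!: prod_zero)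
  ultimately show False by (simp add: p_def)
qed

lemma chart_origin_in_grid: "(\<And>i. i \<in> {0..N} - {0} \<Longrightarrow> 0 \<in> A i) \<Longrightarrow> (\<lambda>i. if i = 0 then 1 else 0) \<in> grid N 0 A"
  by (auto simp: grid_def)

lemma chart_coordinates: "{0..N} - {0} = {1..N::nat}" by auto

lemma cube_bound:
  assumes "k \<ge> 1"
  shows "has_bound TYPE('k::alg_closed_field) N (k ^ N) k 1"
proof -
  obtain B :: "'k set" where B: "finite B" "card B = k"
    using infinite_arbitrarily_large[OF infinite_alg_closed] by metis
  let ?X = "\<Union>j\<in>{()}. grid N 0 ((\<lambda>_ _. B) j)"
  have "waldschmidt_bound N ?X (k * card {()}) 1"
    by (rule averaging_bound[where c = "\<lambda>_ _. 1"]) (use B assms in auto)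
  moreover have "finite ?X" "card ?X \<le> k ^ N"
    using grid_finite_card[of 0 N "\<lambda>_. B"] B unfolding chart_coordinates by auto
  ultimately show ?thesis unfolding has_bound_def by (intro exI[of _ ?X]) simp
qed

text \<open>Two grids with sides 3 and 2, which exchange their roles on the first \<open>x\<close> and on the remaining
coordinates: each coordinate has the weight \<open>1/3 + 1/2 = 5/6\<close>, and \<open>2 / (5/6) = 12/5\<close>. Both contain
a cube of side 2, which has to be discounted, since for \<open>N = 2\<close> and \<open>N = 3\<close> no point may be wasted.\<close>

lemma two_grids_bound:
  assumes "x \<le> N"
  shows "has_bound TYPE('k::alg_closed_field) N (3 ^ x * 2 ^ (N - x) + 2 ^ x * 3 ^ (N - x) - 2 ^ N) 12 5"
proof -
  obtain B :: "'k set" where B: "finite B" "card B = 3"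
    using infinite_arbitrarily_large[OF infinite_alg_closed] by metis
  obtain C where C: "C \<subseteq> B" "card C = 2" using obtain_subset_with_card_n[of 2 B] B by auto
  have fC: "finite C" using C B finite_subset by blast
  define A where "A j i = (if (i \<le> x) = j then B else C)" for j :: bool and i :: nat
  let ?X = "\<Union>j\<in>UNIV. grid N 0 (A j)"
  have "waldschmidt_bound N ?X (6 * card (UNIV :: bool set)) 5"
  proof (rule averaging_bound[where c = "\<lambda>j i. if (i \<le> x) = j then 2 else 3"])
    fix i
    show "(\<Sum>j\<in>UNIV. if (i \<le> x) = j then 2 else 3) \<le> (5::nat)" by (simp add: UNIV_bool)
  qed (use B C fC in \<open>auto simp: A_def\<close>)
  then have "waldschmidt_bound N ?X 12 5" by (simp add: UNIV_bool)
  moreover have fin: "finite (grid N 0 (A j))" for j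
    by (rule grid_finite_card) (use B fC in \<open>auto simp: A_def\<close>)
  moreover have "card ?X \<le> 3 ^ x * 2 ^ (N - x) + 2 ^ x * 3 ^ (N - x) - 2 ^ N"
  proof -
    have split: "{1..N} = {1..x} \<union> {x<..N}" "{1..x} \<inter> {x<..N} = {}" using assms by auto
    have c: "card (grid N 0 (A j)) \<le> (if j then 3 ^ x * 2 ^ (N - x) else 2 ^ x * 3 ^ (N - x))" for j
    proof -
      have "card (grid N 0 (A j)) \<le> (\<Prod>i\<in>{1..N}. card (A j i))"
        using grid_finite_card(2)[of 0 N "A j"] B fC unfolding chart_coordinates by (auto simp: A_def)
      also have "\<dots> = (\<Prod>i\<in>{1..x}. card (A j i)) * (\<Prod>i\<in>{x<..N}. card (A j i))"
        unfolding split(1) by (rule prod.union_disjoint) (use split(2) in auto)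
      also have "\<dots> = (if j then 3 ^ x * 2 ^ (N - x) else 2 ^ x * 3 ^ (N - x))"
        using B C by (auto simp: A_def)
      finally show ?thesis .
    qed
    have "card (grid N 0 (\<lambda>_. C)) = 2 ^ N"
      using grid_finite_card(2)[of 0 N "\<lambda>_. C"] fC C(2) unfolding chart_coordinates by simp
    moreover have "grid N 0 (\<lambda>_. C) \<subseteq> grid N 0 (A True) \<inter> grid N 0 (A False)"
      using C(1) by (auto simp: grid_def A_def)
    ultimately have "2 ^ N \<le> card (grid N 0 (A True) \<inter> grid N 0 (A False))"
      by (metis card_mono fin finite_Int)
    moreover have "card (grid N 0 (A True)) + card (grid N 0 (A False)) =
        card ?X + card (grid N 0 (A True) \<inter> grid N 0 (A False))"
      using card_Un_Int[OF fin[of True] fin[of False]] by (simp add: UNIV_bool Un_commute)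
    ultimately show ?thesis using c[of True] c[of False] by simp
  qed
  ultimately show ?thesis unfolding has_bound_def by (intro exI[of _ ?X]) simp
qed

text \<open>A cube of side 2 in each of \<open>r\<close> groups of coordinates: a coordinate has the weight \<open>1/2\<close> for one
grid and 1 for the others. All these cubes contain the origin of the chart.\<close>

lemma groups_bound:
  assumes "N \<le> r * g" "r \<ge> 1" "g \<ge> 1"
  shows "has_bound TYPE('k::alg_closed_field) N (1 + r * (2 ^ g - 1)) (2 * r) (2 * r - 1)"
proof -
  define A where "A j i = (if (i - 1) div g = j then {0, 1::'k} else {0})" for j i :: nat
  let ?X = "\<Union>j\<in>{..<r}. grid N 0 (A j)"
  let ?o = "\<lambda>i::nat. if i = 0 then 1 else 0 :: 'k"
  have r0: "0 < r" using assms(2) by simp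
  have fin: "finite (grid N 0 (A j))" for j
    by (rule grid_finite_card) (auto simp: A_def)
  have o: "?o \<in> grid N 0 (A j)" for j by (rule chart_origin_in_grid) (auto simp: A_def)
  have "waldschmidt_bound N ?X (2 * card {..<r}) (2 * r - 1)"
  proof (rule averaging_bound[where c = "\<lambda>j i. if (i - 1) div g = j then 1 else 2"])
    fix i assume i: "i \<in> {1..N}"
    have lt: "(i - 1) div g < r" using i assms by (auto simp: div_less_iff_less_mult)
    have "(\<Sum>j<r. if (i - 1) div g = j then 1 else 2::nat) =
        1 + (\<Sum>j\<in>{..<r} - {(i - 1) div g}. 2)"
      using lt by (subst sum.remove[of _ "(i - 1) div g"]) (auto intro!: sum.cong)
    also have "\<dots> = 2 * r - 1" using lt assms by (simp add: diff_mult_distrib2)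
    finally show "(\<Sum>j<r. if (i - 1) div g = j then 1 else 2) \<le> 2 * r - 1" by simp
  qed (auto simp: A_def)
  then have "waldschmidt_bound N ?X (2 * r) (2 * r - 1)" by simp
  moreover have "card ?X \<le> 1 + r * (2 ^ g - 1)"
  proof -
    have "card (grid N 0 (A j) - {?o}) \<le> 2 ^ g - 1" for j
    proof -
      have "card (grid N 0 (A j)) \<le> (\<Prod>i\<in>{1..N}. card (A j i))"
        using grid_finite_card(2)[of 0 N "A j"] unfolding chart_coordinates by (auto simp: A_def)
      also have "\<dots> = (\<Prod>i\<in>{1..N}. if (i - 1) div g = j then 2 else 1)"
        by (intro prod.cong) (auto simp: A_def)
      also have "\<dots> = 2 ^ card {i\<in>{1..N}. (i - 1) div g = j}"
        by (subst prod.inter_filter[symmetric]) auto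
      also have "\<dots> \<le> 2 ^ g"
      proof (rule power_increasing)
        have "{i\<in>{1..N}. (i - 1) div g = j} \<subseteq> (\<lambda>e. j * g + e + 1) ` {..<g}"
        proof
          fix i assume i: "i \<in> {i\<in>{1..N}. (i - 1) div g = j}"
          then have "i = j * g + (i - 1) mod g + 1"
            using div_mult_mod_eq[of "i - 1" g] by auto
          then show "i \<in> (\<lambda>e. j * g + e + 1) ` {..<g}" using assms(3) by (intro image_eqI[of _ _ "(i - 1) mod g"]) auto
        qed
        then show "card {i\<in>{1..N}. (i - 1) div g = j} \<le> g"
          using surj_card_le[of "{..<g}"] by (metis card_lessThan finite_lessThan)
      qed simp
      finally show ?thesis using o[of j] fin[of j] by simp
    qed
    then have le: "(\<Sum>j<r. card (grid N 0 (A j) - {?o})) \<le> (\<Sum>j<r. 2 ^ g - 1)"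
      by (intro sum_mono)
    have "?X = insert ?o (\<Union>j<r. grid N 0 (A j) - {?o})"
      using o r0 by auto
    then have "card ?X = card (insert ?o (\<Union>j<r. grid N 0 (A j) - {?o}))" by (rule arg_cong)
    also have "\<dots> \<le> Suc (card (\<Union>j<r. grid N 0 (A j) - {?o}))"
      by (rule card_insert_le_m1) auto
    also have "\<dots> \<le> Suc (\<Sum>j<r. card (grid N 0 (A j) - {?o}))"
      by (intro Suc_leI le_imp_less_Suc card_UN_le) simp
    also have "\<dots> \<le> Suc (\<Sum>j<r. 2 ^ g - 1)" using le by (rule Suc_leI[OF le_imp_less_Suc])
    also have "\<dots> = 1 + r * (2 ^ g - 1)" by simp
    finally show ?thesis .
  qed
  moreover have "finite ?X" using fin by auto
  ultimately show ?thesis unfolding has_bound_def by (intro exI[of _ ?X]) simp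
qed

text \<open>A cube of side 2 in any two of three groups of coordinates: three grids, for which every coordinate
has the total weight \<open>1/2 + 1/2 + 1 = 2\<close>.\<close>

lemma three_groups_bound:
  "has_bound TYPE('k::alg_closed_field) N (3 * 2 ^ (N - N div 3)) 3 2"
proof -
  define A where "A j i = (if i mod 3 = j then {0} else {0, 1::'k})" for j i :: nat
  let ?X = "\<Union>j\<in>{..<3}. grid N 0 (A j)"
  have three: "{..<3::nat} = {0, 1, 2}" by auto
  have fin: "finite (grid N 0 (A j))" for j
    by (rule grid_finite_card) (auto simp: A_def)
  have "waldschmidt_bound N ?X (2 * card {..<3::nat}) 4"
  proof (rule averaging_bound[where c = "\<lambda>j i. if i mod 3 = j then 2 else 1"])
    fix i :: nat
    have "i mod 3 \<in> {0, 1, 2}" by auto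
    then show "(\<Sum>j<3. if i mod 3 = j then 2 else 1) \<le> (4::nat)"
      by (auto simp: three)
  qed (auto simp: A_def)
  then have "waldschmidt_bound N ?X 6 4" by simp
  then have "waldschmidt_bound N ?X 3 2" unfolding waldschmidt_bound_def
  proof (intro allI impI, goal_cases)
    case (1 f d t)
    then have "6 * t \<le> 4 * d" by blast
    then show ?case by simp
  qed
  moreover have "card ?X \<le> 3 * 2 ^ (N - N div 3)"
  proof -
    have "card (grid N 0 (A j)) \<le> 2 ^ (N - N div 3)" if j: "j < 3" for j
    proof -
      have "card (grid N 0 (A j)) \<le> (\<Prod>i\<in>{1..N}. card (A j i))"
        using grid_finite_card(2)[of 0 N "A j"] unfolding chart_coordinates by (auto simp: A_def)
      also have "\<dots> = (\<Prod>i\<in>{1..N}. if i mod 3 \<noteq> j then 2 else 1)"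
        by (intro prod.cong) (auto simp: A_def)
      also have "\<dots> = 2 ^ card {i\<in>{1..N}. i mod 3 \<noteq> j}"
        by (subst prod.inter_filter[symmetric]) auto
      also have "\<dots> \<le> 2 ^ (N - N div 3)"
      proof (rule power_increasing)
        let ?D = "{i\<in>{1..N}. i mod 3 = j}"
        define e where "e = (if j = 0 then 3 else j)"
        have "(\<lambda>l. 3 * l + e) ` {..<N div 3} \<subseteq> ?D"
          using j by (auto simp: e_def)
        moreover have "inj_on (\<lambda>l. 3 * l + e) {..<N div 3}" by (auto simp: inj_on_def)
        ultimately have "N div 3 \<le> card ?D"
          using card_inj_on_le[of "\<lambda>l. 3 * l + e" "{..<N div 3}" ?D] by auto
        moreover have "card {i\<in>{1..N}. i mod 3 \<noteq> j} = card ({1..N} - ?D)"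
          by (rule arg_cong[of _ _ card]) auto
        moreover have "card ({1..N} - ?D) = N - card ?D" by (subst card_Diff_subset) auto
        ultimately show "card {i\<in>{1..N}. i mod 3 \<noteq> j} \<le> N - N div 3"
          by (metis diff_le_mono2)
      qed simp
      finally show ?thesis .
    qed
    then have "(\<Sum>j<3. card (grid N 0 (A j))) \<le> (\<Sum>j<(3::nat). 2 ^ (N - N div 3))" by (intro sum_mono) auto
    moreover have "card ?X \<le> (\<Sum>j<3. card (grid N 0 (A j)))" by (rule card_UN_le) simp
    ultimately show ?thesis by simp
  qed
  moreover have "finite ?X" using fin by auto
  ultimately show ?thesis unfolding has_bound_def by (intro exI[of _ ?X]) simp
qed

text \<open>At a coordinate vertex the footprint bound says that the exponent of the corresponding variable is at
most \<open>d - t\<close>. The bound for the cube, doubled, becomes \<open>2 * t \<le> d + v * (d - t)\<close>.\<close>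

lemma cube_and_vertices_bound:
  assumes "v \<le> N"
  shows "has_bound TYPE('k::alg_closed_field) N (2 ^ (N - v) + v) (v + 2) (v + 1)"
proof -
  let ?C = "{N - v<..N}"
  define A where "A i = (if i \<in> ?C then {0} else {0, 1::'k})" for i :: nat
  define X where "X = grid N 0 A \<union> (\<Union>b\<in>?C. grid N b (\<lambda>_. {0}))"
  have "waldschmidt_bound N X (v + 2) (v + 1)"
    unfolding waldschmidt_bound_def
  proof (intro allI impI)
    fix f :: "(nat, 'k) mpoly" and d t
    assume f: "f \<noteq> 0" "poly_vars f \<subseteq> {0..N}" "homogeneous_of_degree d f"
      and van: "\<forall>P\<in>X. vanishes_to_order t P f"
    obtain m where m: "m \<in> keys f" "\<And>m'. m' \<in> keys f \<Longrightarrow> lookup m 0 \<le> lookup m' 0"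
      using ex_min_key[OF f(1), of 0] by blast
    have d: "(\<Sum>i\<in>{0..N}. lookup m i) = d" by (rule homogeneous_total_degree[OF f(3,2) m(1)])
    have vert: "t + lookup m b \<le> d" if b: "b \<in> ?C" for b
    proof -
      have "t \<le> (\<Sum>i\<in>{0..N} - {b}. lookup m i div card {0::'k})"
      proof (rule footprint_form[OF f(3,2), of _ "\<lambda>_. {0}"])
        fix m' assume m': "m' \<in> keys f"
          and eq: "\<And>i. i \<in> {0..N} - {b} \<Longrightarrow> {0::'k} = {0} \<Longrightarrow> lookup m' i = lookup m i"
        have "(\<Sum>i\<in>{0..N} - {b}. lookup m' i) = (\<Sum>i\<in>{0..N} - {b}. lookup m i)"
          by (intro sum.cong) (use eq in auto)
        moreover have "(\<Sum>i\<in>{0..N}. lookup m' i) = d" by (rule homogeneous_total_degree[OF f(3,2) m'])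
        ultimately show "lookup m b \<le> lookup m' b" using d b by (simp add: sum.remove[of "{0..N}" b])
      qed (use van b m in \<open>auto simp: X_def\<close>)
      then show ?thesis using d b by (simp add: sum.remove[of "{0..N}" b])
    qed
    have "t \<le> (\<Sum>i\<in>{0..N} - {0}. lookup m i div card (A i))"
    proof (rule footprint_form[OF f(3,2)])
      show "\<forall>P\<in>grid N 0 A. vanishes_to_order t P f" using van by (auto simp: X_def)
    qed (use m in \<open>auto simp: A_def\<close>)
    then have "2 * t \<le> (\<Sum>i\<in>{1..N}. 2 * (lookup m i div card (A i)))"
      unfolding chart_coordinates sum_distrib_left[symmetric] by simp
    also have "\<dots> \<le> (\<Sum>i\<in>{1..N}. lookup m i + (if i \<in> ?C then lookup m i else 0))"
      by (intro sum_mono) (auto simp: A_def numeral_2_eq_2[symmetric])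
    also have "\<dots> = (\<Sum>i\<in>{1..N}. lookup m i) + (\<Sum>i\<in>{1..N} \<inter> ?C. lookup m i)"
      by (simp add: sum.distrib sum.inter_restrict)
    also have "{1..N} \<inter> ?C = ?C" using assms by auto
    also have "(\<Sum>i\<in>{1..N}. lookup m i) \<le> d" unfolding d[symmetric] by (intro sum_mono2) auto
    also have "(\<Sum>i\<in>?C. lookup m i) \<le> (\<Sum>i\<in>?C. d - t)"
      by (intro sum_mono) (use vert in force)
    also have "(\<Sum>i\<in>?C. d - t) = v * (d - t)" using assms by simp
    finally have le: "2 * t \<le> d + v * (d - t)" by simp
    have "t \<le> d \<or> v = 0"
    proof (cases "v = 0")
      case False
      then have "N \<in> ?C" using assms by auto
      then show ?thesis using vert[of N] by simp
    qed simp
    then show "(v + 2) * t \<le> (v + 1) * d"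
    proof
      assume "t \<le> d"
      then obtain e where "d = t + e" using le_Suc_ex by blast
      then show ?thesis using le by (simp add: algebra_simps)
    qed (use le in simp)
  qed
  moreover have fin: "finite (grid N 0 A)" "card (grid N 0 A) \<le> 2 ^ (N - v)"
  proof -
    show "finite (grid N 0 A)" by (rule grid_finite_card) (auto simp: A_def)
    have "card (grid N 0 A) \<le> (\<Prod>i\<in>{1..N}. card (A i))"
      using grid_finite_card(2)[of 0 N A] unfolding chart_coordinates by (auto simp: A_def)
    also have "\<dots> = (\<Prod>i\<in>{1..N - v}. 2)"
      by (rule prod.mono_neutral_cong_right) (auto simp: A_def)
    finally show "card (grid N 0 A) \<le> 2 ^ (N - v)" by simp
  qed
  moreover have "finite (grid N b (\<lambda>_. {0::'k}))" "card (grid N b (\<lambda>_. {0::'k})) \<le> 1" if "b \<in> ?C" for b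
    using grid_finite_card[of b N "\<lambda>_. {0::'k}"] that by auto
  then have "finite (\<Union>b\<in>?C. grid N b (\<lambda>_. {0::'k}))" "card (\<Union>b\<in>?C. grid N b (\<lambda>_. {0::'k})) \<le> v"
  proof -
    assume *: "\<And>b. b \<in> ?C \<Longrightarrow> finite (grid N b (\<lambda>_. {0::'k}))"
      "\<And>b. b \<in> ?C \<Longrightarrow> card (grid N b (\<lambda>_. {0::'k})) \<le> 1"
    show "finite (\<Union>b\<in>?C. grid N b (\<lambda>_. {0::'k}))" using *(1) by blast
    have "card (\<Union>b\<in>?C. grid N b (\<lambda>_. {0::'k})) \<le> (\<Sum>b\<in>?C. card (grid N b (\<lambda>_. {0::'k})))"
      by (rule card_UN_le) simp
    also have "\<dots> \<le> (\<Sum>b\<in>?C. 1)" by (rule sum_mono) (use * in auto)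
    also have "\<dots> = v" using assms by simp
    finally show "card (\<Union>b\<in>?C. grid N b (\<lambda>_. {0::'k})) \<le> v" .
  qed
  ultimately have "finite X" "card X \<le> 2 ^ (N - v) + v"
    unfolding X_def using card_Un_le[of "grid N 0 A" "\<Union>b\<in>?C. grid N b (\<lambda>_. {0::'k})"] by auto
  then show ?thesis using \<open>waldschmidt_bound N X (v + 2) (v + 1)\<close>
    unfolding has_bound_def by (intro exI[of _ X]) simp
qed

section \<open>Semicontinuity\<close>

lemma carrier_poly_ring: "carrier (poly_ring V) = {f. poly_vars f \<subseteq> V}"
  by (simp add: poly_ring_def)

lemma poly_vars_closed:
  fixes f g :: "('v, 'k::comm_ring_1) mpoly"
  shows "poly_vars f \<subseteq> V \<Longrightarrow> poly_vars g \<subseteq> V \<Longrightarrow> poly_vars (f + g) \<subseteq> V"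
    and "poly_vars f \<subseteq> V \<Longrightarrow> poly_vars g \<subseteq> V \<Longrightarrow> poly_vars (f * g) \<subseteq> V"
    and "poly_vars f \<subseteq> V \<Longrightarrow> poly_vars (- f) \<subseteq> V"
    and "poly_vars f \<subseteq> V \<Longrightarrow> poly_vars g \<subseteq> V \<Longrightarrow> poly_vars (f - g) \<subseteq> V"
    and "poly_vars (0 :: ('v, 'k) mpoly) \<subseteq> V"
    and "poly_vars (1 :: ('v, 'k) mpoly) \<subseteq> V"
proof -
  interpret R: cring "poly_ring V :: ('v, 'k) mpoly ring" by (rule poly_ring_cring)
  show add: "poly_vars f \<subseteq> V \<Longrightarrow> poly_vars g \<subseteq> V \<Longrightarrow> poly_vars (f + g) \<subseteq> V" for f g :: "('v, 'k) mpoly"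
    using R.a_closed[of f g] by (simp add: poly_ring_def)
  show "poly_vars f \<subseteq> V \<Longrightarrow> poly_vars g \<subseteq> V \<Longrightarrow> poly_vars (f * g) \<subseteq> V"
    using R.m_closed[of f g] by (simp add: poly_ring_def)
  show neg: "poly_vars f \<subseteq> V \<Longrightarrow> poly_vars (- f) \<subseteq> V" for f :: "('v, 'k) mpoly"
    by (simp add: poly_vars_def in_keys_iff)
  show "poly_vars f \<subseteq> V \<Longrightarrow> poly_vars g \<subseteq> V \<Longrightarrow> poly_vars (f - g) \<subseteq> V"
    using add[of f "- g"] neg[of g] by simp
  show "poly_vars (0 :: ('v, 'k) mpoly) \<subseteq> V" "poly_vars (1 :: ('v, 'k) mpoly) \<subseteq> V"
    by (simp_all add: poly_vars_def)
qed

lemma poly_vars_single: "keys m \<subseteq> V \<Longrightarrow> poly_vars (single m c) \<subseteq> V"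
  by (auto simp: poly_vars_def)

lemma poly_vars_power:
  fixes f :: "('v, 'k::comm_ring_1) mpoly"
  shows "poly_vars f \<subseteq> V \<Longrightarrow> poly_vars (f ^ n) \<subseteq> V"
  by (induction n) (simp_all add: poly_vars_closed)

definition polyfun :: "'v set \<Rightarrow> (('v \<Rightarrow> 'k::comm_ring_1) \<Rightarrow> 'k) \<Rightarrow> bool" where
  "polyfun A F \<longleftrightarrow> (\<exists>g. poly_vars g \<subseteq> A \<and> (\<forall>a. F a = poly_eval a g))"

lemma polyfun_const: "polyfun A (\<lambda>a. c)"
  unfolding polyfun_def
  by (intro exI[of _ "single 0 c"]) (simp add: poly_vars_single poly_eval_simps)

lemma polyfun_coord: "v \<in> A \<Longrightarrow> polyfun A (\<lambda>a. a v)"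
  unfolding polyfun_def
  by (intro exI[of _ "single (single v 1) 1"] conjI poly_vars_single) (simp_all add: poly_eval_simps)

lemma polyfun_diff: "polyfun A F \<Longrightarrow> polyfun A G \<Longrightarrow> polyfun A (\<lambda>a. F a - G a)"
  unfolding polyfun_def by (metis poly_vars_closed(4) poly_eval_simps(7))

lemma polyfun_mult: "polyfun A F \<Longrightarrow> polyfun A G \<Longrightarrow> polyfun A (\<lambda>a. F a * G a)"
  unfolding polyfun_def by (metis poly_vars_closed(2) poly_eval_simps(5))

lemma polyfun_power: "polyfun A F \<Longrightarrow> polyfun A (\<lambda>a. F a ^ n)"
  by (induction n) (auto intro: polyfun_const polyfun_mult)

lemma polyfun_prod: "(\<And>i. i \<in> I \<Longrightarrow> polyfun A (F i)) \<Longrightarrow> polyfun A (\<lambda>a. \<Prod>i\<in>I. F i a)"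
  by (induction I rule: infinite_finite_induct) (auto intro: polyfun_const polyfun_mult)

lemma zariski_open_nonzero:
  assumes "polyfun A F"
  shows "zariski_open A {a \<in> affine_space A. F a \<noteq> 0}"
proof -
  obtain g where g: "poly_vars g \<subseteq> A" "\<And>a. F a = poly_eval a g"
    using assms by (auto simp: polyfun_def)
  have "affine_space A - {a \<in> affine_space A. F a \<noteq> 0} =
      {a \<in> affine_space A. \<forall>f\<in>{g}. poly_eval a f = 0}"
    by (auto simp: g(2))
  moreover have "{g} \<subseteq> carrier (poly_ring A)" using g(1) by (simp add: carrier_poly_ring)
  ultimately show ?thesis unfolding zariski_open_def zariski_closed_def by blast
qed

text \<open>Gaussian elimination without division. The function \<open>F\<close> is the product of the pivots, which are chosen
to be nonzero at \<open>a0\<close>; wherever it does not vanish, the same elimination succeeds.\<close>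

lemma generic_trivial_kernel:
  fixes M :: "'r \<Rightarrow> 'c \<Rightarrow> ('v \<Rightarrow> 'k::field) \<Rightarrow> 'k"
  assumes "finite C" "\<And>r c. r \<in> R \<Longrightarrow> c \<in> C \<Longrightarrow> polyfun A (M r c)"
    and "\<And>x. (\<And>r. r \<in> R \<Longrightarrow> (\<Sum>c\<in>C. M r c a0 * x c) = 0) \<Longrightarrow> \<forall>c\<in>C. x c = 0"
  shows "\<exists>F. polyfun A F \<and> F a0 \<noteq> 0 \<and> (\<forall>a x. F a \<noteq> 0 \<longrightarrow>
    (\<forall>r\<in>R. (\<Sum>c\<in>C. M r c a * x c) = 0) \<longrightarrow> (\<forall>c\<in>C. x c = 0))"
  using assms
proof (induction C arbitrary: M rule: finite_induct)
  case empty
  then show ?case by (intro exI[of _ "\<lambda>_. 1"]) (auto intro: polyfun_const)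
next
  case (insert c C)
  have "\<exists>r\<in>R. M r c a0 \<noteq> 0"
  proof (rule ccontr)
    assume "\<not> ?thesis"
    then have "(\<Sum>c'\<in>insert c C. M r c' a0 * (if c' = c then 1 else 0)) = 0" if "r \<in> R" for r
      using that insert.hyps by (auto simp: if_distrib cong: if_cong intro!: sum.neutral)
    then have "\<forall>c'\<in>insert c C. (if c' = c then 1 else 0 :: 'k) = 0"
      by (rule insert.prems(2))
    then show False by simp
  qed
  then obtain r where r: "r \<in> R" "M r c a0 \<noteq> 0" by blast
  \<comment> \<open>The rows after elimination of the column \<open>c\<close> by the pivot \<open>M r c\<close>.\<close>
  define M' where "M' = (\<lambda>r' j a. M r c a * M r' j a - M r' c a * M r j a)"
  have M'_sum: "(\<Sum>j\<in>C. M' r' j a * x j) =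
      M r c a * (\<Sum>j\<in>C. M r' j a * x j) - M r' c a * (\<Sum>j\<in>C. M r j a * x j)" for r' a x
    by (simp add: M'_def left_diff_distrib sum_subtractf sum_distrib_left mult.assoc)
  have "\<exists>F. polyfun A F \<and> F a0 \<noteq> 0 \<and> (\<forall>a x. F a \<noteq> 0 \<longrightarrow>
    (\<forall>r\<in>R. (\<Sum>c\<in>C. M' r c a * x c) = 0) \<longrightarrow> (\<forall>c\<in>C. x c = 0))"
  proof (rule insert.IH)
    show "polyfun A (M' r' j)" if "r' \<in> R" "j \<in> C" for r' j
      unfolding M'_def by (intro polyfun_diff polyfun_mult insert.prems(1)) (use r that in auto)
  next
    fix x assume x: "\<And>r'. r' \<in> R \<Longrightarrow> (\<Sum>j\<in>C. M' r' j a0 * x j) = 0"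
    define y where "y = x(c := - (\<Sum>j\<in>C. M r j a0 * x j) / M r c a0)"
    have y: "(\<Sum>j\<in>C. M r' j a0 * y j) = (\<Sum>j\<in>C. M r' j a0 * x j)" for r'
      using insert.hyps by (intro sum.cong) (auto simp: y_def)
    have "\<forall>j\<in>insert c C. y j = 0"
    proof (rule insert.prems(2))
      fix r' assume r': "r' \<in> R"
      have "M r c a0 * (\<Sum>j\<in>insert c C. M r' j a0 * y j) = (\<Sum>j\<in>C. M' r' j a0 * x j)"
        using insert.hyps r(2) by (simp add: y M'_sum) (simp add: y_def field_simps)
      then show "(\<Sum>j\<in>insert c C. M r' j a0 * y j) = 0"
        using x[OF r'] r(2) by simp
    qed
    then show "\<forall>j\<in>C. x j = 0" using insert.hyps by (auto simp: y_def split: if_splits)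
  qed
  then obtain F where F: "polyfun A F" "F a0 \<noteq> 0"
    "\<And>a x. F a \<noteq> 0 \<Longrightarrow> (\<forall>r\<in>R. (\<Sum>c\<in>C. M' r c a * x c) = 0) \<Longrightarrow> \<forall>c\<in>C. x c = 0"
    by blast
  show ?case
  proof (intro exI[of _ "\<lambda>a. M r c a * F a"] conjI allI impI)
    show "polyfun A (\<lambda>a. M r c a * F a)" using F(1) insert.prems(1) r by (intro polyfun_mult) auto
    show "M r c a0 * F a0 \<noteq> 0" using F(2) r(2) by simp
    fix a x assume nz: "M r c a * F a \<noteq> 0"
      and x: "\<forall>r\<in>R. (\<Sum>c\<in>insert c C. M r c a * x c) = 0"
    have row: "(\<Sum>j\<in>C. M r' j a * x j) = - (M r' c a * x c)" if "r' \<in> R" for r'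
      using x that insert.hyps by (simp add: add_eq_0_iff)
    have "\<forall>r'\<in>R. (\<Sum>j\<in>C. M' r' j a * x j) = 0"
      by (simp add: M'_sum row r(1))
    then have "\<forall>j\<in>C. x j = 0" using F(3) nz by auto
    moreover from this have "x c = 0" using row[OF r(1)] nz by simp
    ultimately show "\<forall>c\<in>insert c C. x c = 0" by simp
  qed
qed

lemma ex_nontrivial_kernel:
  fixes M :: "'r \<Rightarrow> 'c \<Rightarrow> 'k::field"
  assumes "finite R" "finite C" "card R < card C"
  shows "\<exists>x. (\<exists>c\<in>C. x c \<noteq> 0) \<and> (\<forall>r\<in>R. (\<Sum>c\<in>C. M r c * x c) = 0)"
  using assms
proof (induction R arbitrary: C M rule: finite_induct)
  case empty
  then obtain c where "c \<in> C" by fastforce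
  then show ?case by (intro exI[of _ "\<lambda>_. 1"]) auto
next
  case (insert r R)
  show ?case
  proof (cases "\<forall>c\<in>C. M r c = 0")
    case True
    obtain x where "\<exists>c\<in>C. x c \<noteq> 0" "\<forall>r\<in>R. (\<Sum>c\<in>C. M r c * x c) = 0"
      using insert.IH[of C M] insert.prems insert.hyps by auto
    then show ?thesis using True by (intro exI[of _ x]) auto
  next
    case False
    then obtain c where c: "c \<in> C" "M r c \<noteq> 0" by blast
    let ?C = "C - {c}"
    have "finite ?C" "card R < card ?C" using insert.prems insert.hyps c(1) by auto
    from insert.IH[OF this, of "\<lambda>r' j. M r c * M r' j - M r' c * M r j"]
    obtain x where x: "\<exists>j\<in>?C. x j \<noteq> 0"
      "\<forall>r'\<in>R. (\<Sum>j\<in>?C. (M r c * M r' j - M r' c * M r j) * x j) = 0"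
      by blast
    define y where "y = x(c := - (\<Sum>j\<in>?C. M r j * x j) / M r c)"
    have y: "(\<Sum>j\<in>C. M r' j * y j) = M r' c * y c + (\<Sum>j\<in>?C. M r' j * x j)" for r'
      using insert.prems(1) c(1) by (subst sum.remove[of C c]) (auto simp: y_def intro!: sum.cong)
    have "(\<Sum>j\<in>C. M r j * y j) = 0" using c(2) by (simp add: y) (simp add: y_def)
    moreover have "(\<Sum>j\<in>C. M r' j * y j) = 0" if "r' \<in> R" for r'
    proof -
      have "M r c * (\<Sum>j\<in>C. M r' j * y j) =
          M r c * (\<Sum>j\<in>?C. M r' j * x j) - M r' c * (\<Sum>j\<in>?C. M r j * x j)"
        using c(2) by (simp add: y) (simp add: y_def field_simps)
      also have "\<dots> = (\<Sum>j\<in>?C. (M r c * M r' j - M r' c * M r j) * x j)"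
        by (simp add: left_diff_distrib sum_subtractf sum_distrib_left mult.assoc)
      finally show ?thesis using x(2) that c(2) by simp
    qed
    moreover have "\<exists>j\<in>C. y j \<noteq> 0" using x(1) by (auto simp: y_def)
    ultimately show ?thesis by (intro exI[of _ y]) auto
  qed
qed

definition monomials :: "nat \<Rightarrow> nat \<Rightarrow> (nat \<Rightarrow>\<^sub>0 nat) set" where
  "monomials N d = {m. keys m \<subseteq> {0..N} \<and> total_degree m = d}"

lemma monomials_finite_card: "finite (monomials N d)" "card (monomials N d) = (N + d) choose N"
proof -
  let ?L = "{l::nat list. length l = Suc N \<and> sum_list l = d}"
  let ?h = "\<lambda>m::nat \<Rightarrow>\<^sub>0 nat. map (lookup m) [0..<Suc N]"
  have bij: "bij_betw ?h (monomials N d) ?L"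
  proof (rule bij_betwI[where g = "\<lambda>l. \<Sum>i\<in>{0..N}. single i (l ! i)"])
    show "?h \<in> monomials N d \<rightarrow> ?L"
    proof
      fix m assume "m \<in> monomials N d"
      then have "(\<Sum>i\<in>{0..N}. lookup m i) = d"
        using total_degree_superset[of "{0..N}" m] by (simp add: monomials_def)
      then show "?h m \<in> ?L"
        by (simp add: interv_sum_list_conv_sum_set_nat atLeast0AtMost atLeastLessThanSuc_atLeastAtMost del: upt_Suc)
    qed
    show "(\<lambda>l. \<Sum>i\<in>{0..N}. single i (l ! i)) \<in> ?L \<rightarrow> monomials N d"
    proof
      fix l assume l: "l \<in> ?L"
      let ?m = "\<Sum>i\<in>{0..N}. single i (l ! i)"
      have lk: "lookup ?m i = (if i \<in> {0..N} then l ! i else 0)" for i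
        by (rule lookup_sum_single) simp
      have "keys ?m \<subseteq> {0..N}" by (auto simp: in_keys_iff lk split: if_splits)
      moreover from this have "total_degree ?m = (\<Sum>i\<in>{0..N}. l ! i)"
        by (subst total_degree_superset[of "{0..N}"]) (auto simp: lk)
      moreover have "(\<Sum>i\<in>{0..N}. l ! i) = d"
      proof -
        have "sum_list l = (\<Sum>i\<in>{0..<length l}. l ! i)" by (rule sum_list_sum_nth)
        also have "{0..<length l} = {0..N}" using l by auto
        finally show ?thesis using l by simp
      qed
      ultimately show "?m \<in> monomials N d" by (simp add: monomials_def)
    qed
    fix m assume m: "m \<in> monomials N d"
    show "(\<Sum>i\<in>{0..N}. single i (?h m ! i)) = m"
    proof (rule poly_mapping_eqI)
      fix i
      have "lookup (\<Sum>i\<in>{0..N}. single i (?h m ! i)) i = (if i \<in> {0..N} then ?h m ! i else 0)"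
        by (rule lookup_sum_single) simp
      also have "\<dots> = lookup m i"
        using m by (auto simp: monomials_def in_keys_iff simp del: upt_Suc) 
      finally show "lookup (\<Sum>i\<in>{0..N}. single i (?h m ! i)) i = lookup m i" .
    qed
  next
    fix l assume l: "l \<in> ?L"
    show "?h (\<Sum>i\<in>{0..N}. single i (l ! i)) = l"
      using l by (intro nth_equalityI) (auto simp: lookup_sum_single simp del: upt_Suc)
  qed
  have card: "card ?L = (N + d) choose N"
    using card_length_sum_list[of "Suc N" d] binomial_symmetric[of N "N + d"] by (simp add: add.commute)
  then have "card ?L > 0" by simp
  then have "finite ?L" by (rule card_ge_0_finite)
  then show "finite (monomials N d)" using bij_betw_finite[OF bij] by simp
  show "card (monomials N d) = (N + d) choose N" using bij_betw_same_card[OF bij] card by simp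
qed

lemma keys_form:
  fixes f :: "(nat, 'k::zero) mpoly"
  assumes "poly_vars f \<subseteq> {0..N}" "homogeneous_of_degree d f"
  shows "keys f \<subseteq> monomials N d"
  using assms by (auto simp: monomials_def poly_vars_def homogeneous_of_degree_def)

lemma lookup_form_of_coeffs:
  "lookup (\<Sum>m\<in>monomials N d. single m (x m)) m = (if m \<in> monomials N d then x m else 0)"
  by (simp add: lookup_sum lookup_single when_def monomials_finite_card(1))

lemma form_of_coeffs:
  "poly_vars (\<Sum>m\<in>monomials N d. single m (x m)) \<subseteq> {0..N}"
  "homogeneous_of_degree d (\<Sum>m\<in>monomials N d. single m (x m))"
proof -
  have "keys (\<Sum>m\<in>monomials N d. single m (x m)) \<subseteq> monomials N d"
    by (auto simp: in_keys_iff lookup_form_of_coeffs split: if_splits)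
  then show "poly_vars (\<Sum>m\<in>monomials N d. single m (x m)) \<subseteq> {0..N}"
    "homogeneous_of_degree d (\<Sum>m\<in>monomials N d. single m (x m))"
    unfolding poly_vars_def homogeneous_of_degree_def by (auto simp: monomials_def)
qed

lemma hasse_form:
  fixes f :: "(nat, 'k::comm_ring_1) mpoly"
  assumes "keys f \<subseteq> monomials N d"
  shows "hasse \<alpha> f P = (\<Sum>m\<in>monomials N d. hasse_mon \<alpha> m P * lookup f m)"
proof -
  have "hasse \<alpha> f P = (\<Sum>m\<in>monomials N d. lookup f m * hasse_mon \<alpha> m P)"
    unfolding hasse_def
    by (rule sum.mono_neutral_left) (use assms monomials_finite_card(1) in \<open>auto simp: in_keys_iff\<close>)
  then show ?thesis by (simp add: mult.commute)
qed

lemma hasse_cong: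
  assumes "\<And>v. v \<in> poly_vars f \<Longrightarrow> P v = Q v"
  shows "hasse \<alpha> f P = hasse \<alpha> f Q"
proof -
  have "hasse_mon \<alpha> m P = hasse_mon \<alpha> m Q" if m: "m \<in> keys f" for m
    unfolding hasse_mon_def
  proof (rule prod.cong[OF refl])
    fix v assume v: "v \<in> keys m \<union> keys \<alpha>"
    show "of_nat (lookup m v choose lookup \<alpha> v) * P v ^ (lookup m v - lookup \<alpha> v) =
        of_nat (lookup m v choose lookup \<alpha> v) * Q v ^ (lookup m v - lookup \<alpha> v)"
    proof (cases "v \<in> keys m")
      case True
      then have "v \<in> poly_vars f" using m by (auto simp: poly_vars_def)
      then show ?thesis by (simp add: assms)
    next
      case False
      then have "lookup m v = 0" by (simp add: in_keys_iff)
      then show ?thesis by simp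
    qed
  qed
  then show ?thesis by (simp add: hasse_def)
qed

lemma vanishes_to_order_cong:
  assumes "\<And>v. v \<in> poly_vars f \<Longrightarrow> P v = Q v"
  shows "vanishes_to_order t P f \<longleftrightarrow> vanishes_to_order t Q f"
  using hasse_cong[of f P Q, OF assms] by (simp add: vanishes_to_order_def)

definition row :: "(nat \<times> nat \<Rightarrow> 'k) \<Rightarrow> nat \<Rightarrow> nat \<Rightarrow> 'k" where
  "row a i = (\<lambda>j. a (i, j))"

text \<open>Semicontinuity of the initial degree of the ideals of points with multiplicity \<open>t\<close>. The unknowns of
the linear system are the coefficients of the form, its rows are the Hasse derivatives of order less
than \<open>t\<close> at the \<open>s\<close> points, and \<open>a0\<close> is a configuration that contains \<open>X\<close>.\<close>

lemma generic_no_form: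
  fixes X :: "(nat \<Rightarrow> 'k::field) set"
  assumes X: "finite X" "card X \<le> s" "waldschmidt_bound N X p q"
    and less: "q * d < p * t"
  shows "\<exists>F. polyfun ({1..s} \<times> {0..N}) F \<and> (\<exists>a\<in>affine_space ({1..s} \<times> {0..N}). F a \<noteq> 0) \<and>
    (\<forall>a f. F a \<noteq> (0 :: 'k) \<longrightarrow> f \<noteq> 0 \<longrightarrow> poly_vars f \<subseteq> {0..N} \<longrightarrow> homogeneous_of_degree d f \<longrightarrow>
      (\<exists>i\<in>{1..s}. \<not> vanishes_to_order t (row a i) f))"
proof -
  let ?A = "{1..s} \<times> {0..N}" and ?C = "monomials N d"
  let ?R = "{1..s} \<times> {\<alpha>. keys \<alpha> \<subseteq> {0..N} \<and> total_degree \<alpha> < t}"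
  let ?M = "\<lambda>(i, \<alpha>) m a. hasse_mon \<alpha> m (row a i) :: 'k"
  obtain e where "bij_betw e {1..card X} X" using ex_bij_betw_nat_finite_1[OF X(1)] by blast
  then have "X = e ` {1..card X}" by (simp add: bij_betw_def)
  also have "\<dots> \<subseteq> e ` {1..s}" using X(2) by (intro image_mono) auto
  finally have e: "X \<subseteq> e ` {1..s}" .
  define a0 where "a0 = restrict (\<lambda>(i, j). e i j) ?A"
  have a0: "a0 \<in> affine_space ?A" by (auto simp: a0_def affine_space_def)
  have row_iff: "(\<forall>r\<in>?R. (\<Sum>m\<in>?C. ?M r m a * lookup f m) = 0) \<longleftrightarrow> (\<forall>i\<in>{1..s}. vanishes_to_order t (row a i) f)"
    if f: "poly_vars f \<subseteq> {0..N}" "homogeneous_of_degree d f" for a and f :: "(nat, 'k) mpoly"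
  proof -
    note keys = keys_form[OF f]
    have out: "hasse \<alpha> f P = 0" if nk: "\<not> keys \<alpha> \<subseteq> {0..N}" for \<alpha> and P :: "nat \<Rightarrow> 'k"
    proof -
      obtain v where v: "v \<in> keys \<alpha>" "v \<notin> {0..N}" using nk by blast
      have "hasse_mon \<alpha> m P = 0" if m: "m \<in> keys f" for m
      proof -
        have "keys m \<subseteq> {0..N}" using m keys by (auto simp: monomials_def)
        then have "lookup m v = 0" using v(2) by (metis in_keys_iff subsetD)
        then have "of_nat (lookup m v choose lookup \<alpha> v) * P v ^ (lookup m v - lookup \<alpha> v) = 0"
          using v(1) by (simp add: in_keys_iff binomial_eq_0)
        then show ?thesis unfolding hasse_mon_def using v(1) by (intro prod_zero) auto
      qed
      then show ?thesis by (simp add: hasse_def)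
    qed
    have eq: "(\<Sum>m\<in>?C. ?M (i, \<alpha>) m a * lookup f m) = hasse \<alpha> f (row a i)" for i \<alpha>
      by (simp add: hasse_form[OF keys])
    show ?thesis
    proof (intro iffI ballI)
      fix i assume i: "i \<in> {1..s}" and all: "\<forall>r\<in>?R. (\<Sum>m\<in>?C. ?M r m a * lookup f m) = 0"
      show "vanishes_to_order t (row a i) f"
        unfolding vanishes_to_order_def
      proof (intro allI impI)
        fix \<alpha> :: "nat \<Rightarrow>\<^sub>0 nat" assume "total_degree \<alpha> < t"
        then show "hasse \<alpha> f (row a i) = 0"
          using out[of \<alpha>] all[rule_format, of "(i, \<alpha>)"] i unfolding eq by (cases "keys \<alpha> \<subseteq> {0..N}") auto
      qed
    next
      fix r assume r: "r \<in> ?R" and all: "\<forall>i\<in>{1..s}. vanishes_to_order t (row a i) f"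
      obtain i \<alpha> where r': "r = (i, \<alpha>)" by (cases r)
      show "(\<Sum>m\<in>?C. ?M r m a * lookup f m) = 0"
        unfolding r' eq using r all by (auto simp: r' vanishes_to_order_def)
    qed
  qed
  have "\<exists>F. polyfun ?A F \<and> F a0 \<noteq> 0 \<and> (\<forall>a x. F a \<noteq> 0 \<longrightarrow>
    (\<forall>r\<in>?R. (\<Sum>m\<in>?C. ?M r m a * x m) = 0) \<longrightarrow> (\<forall>m\<in>?C. x m = 0))"
  proof (rule generic_trivial_kernel)
    show "finite ?C" by (rule monomials_finite_card)
  next
    fix r m assume r: "r \<in> ?R" and m: "m \<in> ?C"
    obtain i \<alpha> where r': "r = (i, \<alpha>)" by (cases r)
    show "polyfun ?A (?M r m)"
      unfolding r' hasse_mon_def prod.case row_def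
      by (intro polyfun_prod polyfun_mult polyfun_const polyfun_power polyfun_coord)
        (use r m in \<open>auto simp: r' monomials_def\<close>)
  next
    fix x assume x: "\<And>r. r \<in> ?R \<Longrightarrow> (\<Sum>m\<in>?C. ?M r m a0 * x m) = 0"
    define f where "f = (\<Sum>m\<in>?C. single m (x m))"
    have f: "poly_vars f \<subseteq> {0..N}" "homogeneous_of_degree d f"
      unfolding f_def by (rule form_of_coeffs)+
    have lf: "lookup f m = x m" if "m \<in> ?C" for m
      using that by (simp add: f_def lookup_form_of_coeffs)
    have "\<forall>i\<in>{1..s}. vanishes_to_order t (row a0 i) f"
      unfolding row_iff[OF f, symmetric] using x by (simp add: lf)
    then have "vanishes_to_order t (e i) f" if "i \<in> {1..s}" for i
      using that f(1) by (subst vanishes_to_order_cong[of _ _ "row a0 i"]) (auto simp: row_def a0_def)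
    then have "\<forall>P\<in>X. vanishes_to_order t P f" using e by blast
    then have "f = 0" using X(3) f less unfolding waldschmidt_bound_def by (meson leD)
    then show "\<forall>m\<in>?C. x m = 0" using lf by simp
  qed
  then obtain F where F: "polyfun ?A F" "F a0 \<noteq> 0"
    "\<And>a x. F a \<noteq> 0 \<Longrightarrow> (\<forall>r\<in>?R. (\<Sum>m\<in>?C. ?M r m a * x m) = 0) \<Longrightarrow> \<forall>m\<in>?C. x m = 0"
    by blast
  have "\<exists>i\<in>{1..s}. \<not> vanishes_to_order t (row a i) f"
    if Fa: "F a \<noteq> 0" and f: "f \<noteq> 0" "poly_vars f \<subseteq> {0..N}" "homogeneous_of_degree d f"
    for a and f :: "(nat, 'k) mpoly"
  proof (rule ccontr)
    assume "\<not> ?thesis"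
    then have "\<forall>r\<in>?R. (\<Sum>m\<in>?C. ?M r m a * lookup f m) = 0"
      unfolding row_iff[OF f(2,3)] by blast
    then have "\<forall>m\<in>?C. lookup f m = 0" using F(3)[OF Fa] by blast
    then have "lookup f m = 0" for m
      using keys_form[OF f(2,3)] by (cases "m \<in> ?C") (auto simp: in_keys_iff)
    then have "f = 0" by (intro poly_mapping_eqI) simp
    then show False using f(1) by contradiction
  qed
  then show ?thesis using F(1,2) a0 by blast
qed

section \<open>Forms on lines through the origin\<close>

abbreviation Var :: "'v \<Rightarrow> ('v, 'k::comm_ring_1) mpoly" where "Var v \<equiv> single (single v 1) 1"
abbreviation Const :: "'k \<Rightarrow> ('v, 'k::comm_ring_1) mpoly" where "Const c \<equiv> single 0 c"

lemma poly_vars_C: "poly_vars (Const c) \<subseteq> V"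
  by (rule poly_vars_single) simp

lemma poly_vars_X: "v \<in> V \<Longrightarrow> poly_vars (Var v) \<subseteq> V"
  by (rule poly_vars_single) simp

lemma poly_eval_C [simp]: "poly_eval a (Const c) = c"
  by (simp add: poly_eval_simps)

lemma poly_eval_X [simp]: "poly_eval a (Var v) = a v"
  by (simp add: poly_eval_simps)

lemma homogeneous_mult:
  fixes f g :: "('v, 'k::comm_ring_1) mpoly"
  assumes "homogeneous_of_degree d f" "homogeneous_of_degree e g"
  shows "homogeneous_of_degree (d + e) (f * g)"
  unfolding homogeneous_of_degree_def
proof
  fix m assume "m \<in> keys (f * g)"
  then obtain a b where "m = a + b" "a \<in> keys f" "b \<in> keys g"
    using Poly_Mapping.keys_mult by blast
  then show "total_degree m = d + e" using assms
    by (simp add: homogeneous_of_degree_def total_degree_add)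
qed

lemma homogeneous_1: "homogeneous_of_degree 0 (1 :: ('v, 'k::comm_ring_1) mpoly)"
  by (simp add: homogeneous_of_degree_def)

lemma homogeneous_power:
  fixes f :: "('v, 'k::comm_ring_1) mpoly"
  shows "homogeneous_of_degree d f \<Longrightarrow> homogeneous_of_degree (n * d) (f ^ n)"
  by (induction n) (auto intro: homogeneous_mult homogeneous_1)

lemma homogeneous_diff:
  fixes f g :: "('v, 'k::comm_ring_1) mpoly"
  assumes "homogeneous_of_degree d f" "homogeneous_of_degree d g"
  shows "homogeneous_of_degree d (f - g)"
  using assms by (auto simp: homogeneous_of_degree_def in_keys_iff lookup_minus)

lemma homogeneous_single: "total_degree m = d \<Longrightarrow> homogeneous_of_degree d (single m c)"
  by (simp add: homogeneous_of_degree_def)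

lemma poly_eval_cong:
  assumes "\<And>v. v \<in> poly_vars f \<Longrightarrow> a v = b v"
  shows "poly_eval a f = poly_eval b f"
  using hasse_cong[of f a b 0, OF assms] by (simp add: hasse_0)

lemma mon_eval_scale: "mon_eval (\<lambda>v. c * u v) m = c ^ total_degree m * mon_eval u (m :: 'v \<Rightarrow>\<^sub>0 nat)"
  for c :: "'k::comm_ring_1"
  by (simp add: mon_eval_def total_degree_def power_mult_distrib prod.distrib power_sum)

definition line_poly :: "('v \<Rightarrow> 'k) \<Rightarrow> ('v, 'k::comm_ring_1) mpoly \<Rightarrow> 'k poly" where
  "line_poly u f = (\<Sum>m\<in>keys f. monom (lookup f m * mon_eval u m) (total_degree m))"

lemma poly_line_poly: "poly (line_poly u f) c = poly_eval (\<lambda>v. c * u v) f"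
  by (simp add: line_poly_def poly_sum poly_monom poly_eval_eq_subst subst_def mon_eval_scale mult_ac)

text \<open>The polynomial vanishes at the point of projective space represented by \<open>u\<close>. For a polynomial that
is not homogeneous the value at \<open>u\<close> alone would not express this.\<close>

definition cone_zero :: "('v \<Rightarrow> 'k) \<Rightarrow> ('v, 'k::comm_ring_1) mpoly \<Rightarrow> bool" where
  "cone_zero u f \<longleftrightarrow> (\<forall>c. c \<noteq> 0 \<longrightarrow> poly_eval (\<lambda>v. c * u v) f = 0)"

lemma infinite_field_common_nonroot:
  fixes p :: "'k::field poly"
  assumes "infinite (UNIV :: 'k set)" "p \<noteq> 0"
  shows "\<exists>c. c \<noteq> 0 \<and> poly p c \<noteq> 0"
proof -
  have "finite {c. poly ([:0, 1:] * p) c = 0}"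
    by (rule poly_roots_finite) (use assms(2) in simp)
  then obtain c where "poly ([:0, 1:] * p) c \<noteq> 0"
    using assms(1) by (metis (mono_tags, lifting) UNIV_eq_I mem_Collect_eq)
  then show ?thesis by (intro exI[of _ c]) auto
qed

lemma cone_zero_iff:
  fixes u :: "'v \<Rightarrow> 'k::field"
  assumes "infinite (UNIV :: 'k set)"
  shows "cone_zero u f \<longleftrightarrow> line_poly u f = 0"
  using infinite_field_common_nonroot[OF assms, of "line_poly u f"]
  by (auto simp: cone_zero_def poly_line_poly[symmetric])

lemma cone_zero_mult:
  fixes u :: "'v \<Rightarrow> 'k::field"
  assumes "infinite (UNIV :: 'k set)"
  shows "cone_zero u (f * g) \<longleftrightarrow> cone_zero u f \<or> cone_zero u g"
proof
  assume fg: "cone_zero u (f * g)"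
  show "cone_zero u f \<or> cone_zero u g"
  proof (rule ccontr)
    assume "\<not> ?thesis"
    then have "line_poly u f * line_poly u g \<noteq> 0" by (simp add: cone_zero_iff[OF assms])
    then obtain c where "c \<noteq> 0" "poly (line_poly u f * line_poly u g) c \<noteq> 0"
      using infinite_field_common_nonroot[OF assms] by blast
    then show False using fg by (auto simp: cone_zero_def poly_line_poly poly_eval_simps)
  qed
qed (auto simp: cone_zero_def poly_eval_simps)

lemma cone_zero_form:
  fixes u :: "'v \<Rightarrow> 'k::field"
  assumes "homogeneous_of_degree d f"
  shows "cone_zero u f \<longleftrightarrow> poly_eval u f = 0"
proof -
  have "poly_eval (\<lambda>v. c * u v) f = c ^ d * poly_eval u f" for c
    using assms unfolding poly_eval_eq_subst subst_def sum_distrib_left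
    by (intro sum.cong) (auto simp: mon_eval_scale homogeneous_of_degree_def)
  then show ?thesis by (auto simp: cone_zero_def intro: exI[of _ 1] dest: spec[of _ 1])
qed

definition hom_part :: "nat \<Rightarrow> ('v, 'k::comm_ring_1) mpoly \<Rightarrow> ('v, 'k) mpoly" where
  "hom_part d f = (\<Sum>m\<in>{m\<in>keys f. total_degree m = d}. single m (lookup f m))"

lemma lookup_hom_part: "lookup (hom_part d f) m = (if total_degree m = d then lookup f m else 0)"
proof -
  have "finite {m\<in>keys f. total_degree m = d}" by simp
  then show ?thesis
    unfolding hom_part_def lookup_sum lookup_single when_def
    by (auto simp: sum.delta in_keys_iff)
qed

lemma hom_part_keys: "keys (hom_part d f) = {m\<in>keys f. total_degree m = d}"
  by (auto simp: in_keys_iff lookup_hom_part split: if_splits)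

lemma hom_part_sum: "f = (\<Sum>d\<in>total_degree ` keys f. hom_part d f)"
proof (rule poly_mapping_eqI)
  fix m show "lookup f m = lookup (\<Sum>d\<in>total_degree ` keys f. hom_part d f) m"
    by (simp add: lookup_sum lookup_hom_part) (auto simp: in_keys_iff)
qed

lemma cone_zero_hom_part:
  fixes u :: "'v \<Rightarrow> 'k::field"
  assumes "infinite (UNIV :: 'k set)" "cone_zero u f"
  shows "poly_eval u (hom_part d f) = 0"
proof -
  have "coeff (line_poly u f) d = (\<Sum>m\<in>keys f. if total_degree m = d then lookup f m * mon_eval u m else 0)"
    by (auto simp: line_poly_def coeff_sum intro!: sum.cong)
  also have "\<dots> = (\<Sum>m\<in>{m\<in>keys f. total_degree m = d}. lookup f m * mon_eval u m)"
    by (simp add: sum.inter_filter)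
  also have "\<dots> = poly_eval u (hom_part d f)"
    unfolding poly_eval_eq_subst subst_def hom_part_keys
    by (intro sum.cong) (auto simp: lookup_hom_part)
  finally show ?thesis using assms by (simp add: cone_zero_iff)
qed

lemma hasse_scale:
  fixes u :: "'v \<Rightarrow> 'k::field"
  assumes "homogeneous_of_degree d f"
  shows "c ^ total_degree \<alpha> * hasse \<alpha> f (\<lambda>v. c * u v) = c ^ d * hasse \<alpha> f u"
proof -
  have mon: "c ^ total_degree \<alpha> * hasse_mon \<alpha> m (\<lambda>v. c * u v) = c ^ total_degree m * hasse_mon \<alpha> m u" for m
  proof -
    let ?S = "keys m \<union> keys \<alpha>"
    have deg: "c ^ total_degree n = (\<Prod>v\<in>?S. c ^ lookup n v)" if "keys n \<subseteq> ?S" for n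
      using total_degree_superset[of ?S n] that by (simp add: power_sum)
    have "c ^ total_degree \<alpha> * hasse_mon \<alpha> m (\<lambda>v. c * u v) = (\<Prod>v\<in>?S. c ^ lookup \<alpha> v *
        (of_nat (lookup m v choose lookup \<alpha> v) * (c * u v) ^ (lookup m v - lookup \<alpha> v)))"
      by (simp add: deg hasse_mon_def prod.distrib)
    also have "\<dots> = (\<Prod>v\<in>?S. c ^ lookup m v *
        (of_nat (lookup m v choose lookup \<alpha> v) * u v ^ (lookup m v - lookup \<alpha> v)))"
    proof (rule prod.cong[OF refl])
      fix v
      show "c ^ lookup \<alpha> v * (of_nat (lookup m v choose lookup \<alpha> v) * (c * u v) ^ (lookup m v - lookup \<alpha> v)) =
          c ^ lookup m v * (of_nat (lookup m v choose lookup \<alpha> v) * u v ^ (lookup m v - lookup \<alpha> v))"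
      proof (cases "lookup \<alpha> v \<le> lookup m v")
        case True
        then have "c ^ lookup m v = c ^ lookup \<alpha> v * c ^ (lookup m v - lookup \<alpha> v)"
          by (simp add: power_add[symmetric])
        then show ?thesis by (simp add: power_mult_distrib)
      qed (simp add: binomial_eq_0)
    qed
    also have "\<dots> = c ^ total_degree m * hasse_mon \<alpha> m u"
      by (simp add: deg hasse_mon_def prod.distrib)
    finally show ?thesis .
  qed
  have "c ^ total_degree \<alpha> * hasse \<alpha> f (\<lambda>v. c * u v) =
      (\<Sum>m\<in>keys f. lookup f m * (c ^ total_degree \<alpha> * hasse_mon \<alpha> m (\<lambda>v. c * u v)))"
    by (simp add: hasse_def sum_distrib_left mult_ac)
  also have "\<dots> = (\<Sum>m\<in>keys f. lookup f m * (c ^ d * hasse_mon \<alpha> m u))"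
    by (intro sum.cong refl) (use assms in \<open>simp add: mon homogeneous_of_degree_def\<close>)
  finally show ?thesis by (simp add: hasse_def sum_distrib_left mult_ac)
qed

lemma vanishes_to_order_scale:
  fixes u :: "'v \<Rightarrow> 'k::field"
  assumes "homogeneous_of_degree d f" "c \<noteq> 0" "vanishes_to_order t (\<lambda>v. c * u v) f"
  shows "vanishes_to_order t u f"
  using assms(3) hasse_scale[OF assms(1), of c _ u] assms(2)
  by (auto simp: vanishes_to_order_def) (metis mult_zero_right no_zero_divisors power_not_zero)

lemma monomials_SucE:
  assumes "m \<in> monomials N (Suc d)"
  obtains l m' where "l \<le> N" "m' \<in> monomials N d" "m = single l 1 + m'"
proof -
  have "total_degree m = Suc d" using assms by (simp add: monomials_def)
  then have "m \<noteq> 0" by auto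
  then obtain l where l: "lookup m l \<noteq> 0" by (metis lookup_zero poly_mapping_eqI)
  then have "l \<in> keys m" by (simp add: in_keys_iff)
  then have lN: "l \<le> N" using assms by (auto simp: monomials_def)
  define m' where "m' = m - single l 1"
  have m: "m = single l 1 + m'"
    by (rule poly_mapping_eqI) (use l in \<open>auto simp: m'_def lookup_add lookup_minus lookup_single when_def\<close>)
  have "keys m' \<subseteq> keys m" by (auto simp: m'_def in_keys_iff lookup_minus)
  moreover have "total_degree m' = d"
    using assms total_degree_add[of "single l 1" m'] m by (simp add: monomials_def)
  ultimately have "m' \<in> monomials N d" using assms by (auto simp: monomials_def)
  then show thesis using that lN m by blast
qed

lemma monomials_2E:
  assumes "m \<in> monomials N 2"
  obtains a b where "a \<le> N" "b \<le> N" "m = single a 1 + single b 1"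
proof -
  have "m \<in> monomials N (Suc 1)" using assms by (simp add: numeral_2_eq_2)
  then obtain a m1 where a: "a \<le> N" "m1 \<in> monomials N 1" "m = single a 1 + m1"
    by (rule monomials_SucE)
  have "m1 \<in> monomials N (Suc 0)" using a(2) by simp
  then obtain b m0 where b: "b \<le> N" "m0 \<in> monomials N 0" "m1 = single b 1 + m0"
    by (rule monomials_SucE)
  then have "m0 = 0" by (simp add: monomials_def total_degree_eq_0_iff)
  then show thesis using that a b by simp
qed

text \<open>Modulo triple products of the linear forms \<open>y\<^sub>1, \<dots>, y\<^sub>N\<close>, the products of two of \<open>y\<^sub>0, \<dots>, y\<^sub>N\<close> with
a power of \<open>x\<^sub>0 = y\<^sub>0\<close> span all forms: multiplication by \<open>x\<^sub>l = y\<^sub>l + w\<^sub>l * x\<^sub>0\<close> either exchanges a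
factor \<open>y\<^sub>0\<close> for \<open>y\<^sub>l\<close> or produces a triple product. If \<open>y\<^sub>1, \<dots>, y\<^sub>N\<close> are equations of a point, this
says that being triple there amounts to at most \<open>(N + 2) choose 2\<close> conditions.\<close>

lemma spanning_quadrics:
  fixes w :: "nat \<Rightarrow> 'k::field" and Q :: "(nat, 'k) mpoly set"
  defines "y \<equiv> \<lambda>l. if l = 0 then Var 0 else Var l - Const (w l) * Var 0"
  assumes Q0: "0 \<in> Q" and Qadd: "\<And>f g. f \<in> Q \<Longrightarrow> g \<in> Q \<Longrightarrow> f + g \<in> Q"
    and Qmult: "\<And>f g. f \<in> Q \<Longrightarrow> poly_vars g \<subseteq> {0..N} \<Longrightarrow> g * f \<in> Q"
    and Qtriple: "\<And>a b c. a \<in> {1..N} \<Longrightarrow> b \<in> {1..N} \<Longrightarrow> c \<in> {1..N} \<Longrightarrow> y a * y b * y c \<in> Q"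
    and m: "m \<in> monomials N (2 + e)"
  shows "\<exists>x. single m 1 - (\<Sum>\<beta>\<in>monomials N 2. Const (x \<beta>) * (mon_eval y \<beta> * Var 0 ^ e)) \<in> Q"
proof -
  define W where "W e = {g. \<exists>x. g - (\<Sum>\<beta>\<in>monomials N 2. Const (x \<beta>) * (mon_eval y \<beta> * Var 0 ^ e)) \<in> Q}" for e
  have W_Q: "g \<in> W e" if "g \<in> Q" for g e
    unfolding W_def using that by (intro CollectI exI[of _ "\<lambda>_. 0"]) simp
  have W_gen: "mon_eval y \<beta> * Var 0 ^ e \<in> W e" if "\<beta> \<in> monomials N 2" for \<beta> e
  proof -
    have "(\<Sum>\<gamma>\<in>monomials N 2. Const (if \<gamma> = \<beta> then 1 else 0) * (mon_eval y \<gamma> * Var 0 ^ e)) =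
        (\<Sum>\<gamma>\<in>monomials N 2. if \<gamma> = \<beta> then mon_eval y \<beta> * Var 0 ^ e else 0)"
      by (intro sum.cong) auto
    also have "\<dots> = mon_eval y \<beta> * Var 0 ^ e" using that monomials_finite_card(1) by simp
    finally show ?thesis unfolding W_def using Q0
      by (intro CollectI exI[of _ "\<lambda>\<gamma>. if \<gamma> = \<beta> then 1 else 0"]) simp
  qed
  have W_add: "f + g \<in> W e" if fg: "f \<in> W e" "g \<in> W e" for f g e
  proof -
    obtain x x' where
      "f - (\<Sum>\<beta>\<in>monomials N 2. Const (x \<beta>) * (mon_eval y \<beta> * Var 0 ^ e)) \<in> Q"
      "g - (\<Sum>\<beta>\<in>monomials N 2. Const (x' \<beta>) * (mon_eval y \<beta> * Var 0 ^ e)) \<in> Q"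
      using fg by (auto simp: W_def)
    from Qadd[OF this]
    have "(f + g) - (\<Sum>\<beta>\<in>monomials N 2. Const (x \<beta> + x' \<beta>) * (mon_eval y \<beta> * Var 0 ^ e)) \<in> Q"
      by (simp add: single_add distrib_right sum.distrib algebra_simps)
    then show ?thesis unfolding W_def by (intro CollectI exI[of _ "\<lambda>\<beta>. x \<beta> + x' \<beta>"])
  qed
  have W_scale: "Const c * f \<in> W e" if f: "f \<in> W e" for c f e
  proof -
    obtain x where "f - (\<Sum>\<beta>\<in>monomials N 2. Const (x \<beta>) * (mon_eval y \<beta> * Var 0 ^ e)) \<in> Q"
      using f by (auto simp: W_def)
    from Qmult[OF this poly_vars_C, of c]
    have "Const c * f - (\<Sum>\<beta>\<in>monomials N 2. Const (c * x \<beta>) * (mon_eval y \<beta> * Var 0 ^ e)) \<in> Q"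
      by (simp add: right_diff_distrib sum_distrib_left mult_single mult.assoc[symmetric])
    then show ?thesis unfolding W_def by (intro CollectI exI[of _ "\<lambda>\<beta>. c * x \<beta>"])
  qed
  have W_sum: "(\<Sum>i\<in>I. f i) \<in> W e" if "\<And>i. i \<in> I \<Longrightarrow> f i \<in> W e" for I :: "(nat \<Rightarrow>\<^sub>0 nat) set" and f e
    using that by (induction I rule: infinite_finite_induct) (auto intro: W_add W_Q Q0)
  have quad: "single a 1 + single b 1 \<in> monomials N 2" if "a \<le> N" "b \<le> N" for a b
  proof -
    have "keys (single a 1 + single b (1::nat)) \<subseteq> {a, b}"
      using Poly_Mapping.keys_add[of "single a 1" "single b (1::nat)"] by (simp add: insert_commute)
    then show ?thesis using that by (auto simp: monomials_def total_degree_add simp del: One_nat_def)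
  qed
  have vX: "poly_vars (Var l :: (nat, 'k) mpoly) \<subseteq> {0..N}" if "l \<le> N" for l
    by (rule poly_vars_X) (use that in simp)
  define w' where "w' l = (if l = 0 then 0 else w l)" for l
  have Xy: "Var l = y l + Const (w' l) * y 0" for l by (simp add: y_def w'_def)
  have y_quad: "y a * y b * Var 0 ^ e \<in> W e" if "a \<le> N" "b \<le> N" for a b e
    using W_gen[OF quad[OF that], of e] by (simp add: mon_eval_add)
  have W_y: "y l * (mon_eval y \<beta> * Var 0 ^ e) \<in> W (Suc e)" if l: "l \<le> N" and \<beta>: "\<beta> \<in> monomials N 2" for l \<beta> e
  proof -
    obtain a b where ab: "a \<le> N" "b \<le> N" "\<beta> = single a 1 + single b 1" by (rule monomials_2E[OF \<beta>])
    have eq: "mon_eval y \<beta> = y a * y b" unfolding ab(3) by (simp add: mon_eval_add)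
    have y0: "y 0 = Var 0" by (simp add: y_def)
    show ?thesis
    proof (cases "l = 0 \<or> a = 0 \<or> b = 0")
      case True
      then obtain c d where cd: "c \<le> N" "d \<le> N" "y l * (y a * y b) = y c * y d * Var 0"
      proof -
        from True consider "l = 0" | "a = 0" | "b = 0" by blast
        then show thesis
        proof cases
          case 1
          show thesis by (rule that[OF ab(1,2)]) (simp only: 1 y0 mult_ac)
        next
          case 2
          show thesis by (rule that[OF l ab(2)]) (simp only: 2 y0 mult_ac)
        next
          case 3
          show thesis by (rule that[OF l ab(1)]) (simp only: 3 y0 mult_ac)
        qed
      qed
      have "y l * (mon_eval y \<beta> * Var 0 ^ e) = y l * (y a * y b) * Var 0 ^ e"
        unfolding eq by (simp only: mult.assoc)
      also have "\<dots> = y c * y d * Var 0 ^ Suc e" unfolding cd(3) power_Suc by (simp only: mult.assoc)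
      finally show ?thesis using y_quad[OF cd(1,2), of "Suc e"] by (simp only:)
    next
      case False
      then have "y l * y a * y b \<in> Q" using l ab by (intro Qtriple) auto
      from Qmult[OF this poly_vars_power[OF vX[of 0]], of e]
      have "y l * (mon_eval y \<beta> * Var 0 ^ e) \<in> Q" unfolding eq by (simp add: mult_ac)
      then show ?thesis by (rule W_Q)
    qed
  qed
  have step: "Var l * g \<in> W (Suc e)" if l: "l \<le> N" and g: "g \<in> W e" for l g e
  proof -
    obtain x where x: "g - (\<Sum>\<beta>\<in>monomials N 2. Const (x \<beta>) * (mon_eval y \<beta> * Var 0 ^ e)) \<in> Q"
      using g by (auto simp: W_def)
    have a: "Var l * (g - (\<Sum>\<beta>\<in>monomials N 2. Const (x \<beta>) * (mon_eval y \<beta> * Var 0 ^ e))) \<in> W (Suc e)"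
      by (intro W_Q Qmult x vX l)
    have b: "Var l * (\<Sum>\<beta>\<in>monomials N 2. Const (x \<beta>) * (mon_eval y \<beta> * Var 0 ^ e)) \<in> W (Suc e)"
    proof -
      have "Var l * (Const (x \<beta>) * (mon_eval y \<beta> * Var 0 ^ e)) \<in> W (Suc e)" if "\<beta> \<in> monomials N 2" for \<beta>
      proof -
        have "Var l * (Const (x \<beta>) * (mon_eval y \<beta> * Var 0 ^ e)) =
          Const (x \<beta>) * (y l * (mon_eval y \<beta> * Var 0 ^ e)) + Const (x \<beta>) * (Const (w' l) * (y 0 * (mon_eval y \<beta> * Var 0 ^ e)))"
          unfolding Xy[of l] by (simp only: algebra_simps)
        then show ?thesis using that l by (simp only:) (intro W_add W_scale W_y; simp)
      qed
      then show ?thesis unfolding sum_distrib_left by (rule W_sum)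
    qed
    show ?thesis using W_add[OF a b] by (simp add: right_diff_distrib)
  qed
  have "single m 1 \<in> W e" using m
  proof (induction e arbitrary: m)
    case 0
    then obtain a b where ab: "a \<le> N" "b \<le> N" "m = single a 1 + single b 1"
      using monomials_2E[of m N] by auto
    have "single m 1 = Var a * Var b" unfolding ab(3) by (simp add: mult_single)
    also have "\<dots> = y a * y b * Var 0 ^ 0 + Const (w' b) * (y a * y 0 * Var 0 ^ 0)
        + Const (w' a) * (y 0 * y b * Var 0 ^ 0) + Const (w' a) * (Const (w' b) * (y 0 * y 0 * Var 0 ^ 0))"
      unfolding Xy[of a] Xy[of b] by (simp add: algebra_simps)
    also have "\<dots> \<in> W 0" by (intro W_add W_scale y_quad ab) auto
    finally show ?case .
  next
    case (Suc e)
    have "m \<in> monomials N (Suc (2 + e))" using Suc.prems by simp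
    then obtain l m' where lm: "l \<le> N" "m' \<in> monomials N (2 + e)" "m = single l 1 + m'"
      by (rule monomials_SucE)
    have eq: "single m 1 = Var l * single m' 1" unfolding lm(3) by (simp add: mult_single)
    show ?case unfolding eq by (rule step[OF lm(1) Suc.IH[OF lm(2)]])
  qed
  then show ?thesis by (simp add: W_def)
qed

section \<open>Symbolic powers of the ideal of a set of points\<close>

lemma coordinate_ring_simps:
  "carrier (coordinate_ring N) = {f :: (nat, 'k::field) mpoly. poly_vars f \<subseteq> {0..N}}"
  "f \<otimes>\<^bsub>coordinate_ring N\<^esub> g = f * (g :: (nat, 'k) mpoly)"
  "f \<oplus>\<^bsub>coordinate_ring N\<^esub> g = f + g"
  "\<one>\<^bsub>coordinate_ring N\<^esub> = (1 :: (nat, 'k) mpoly)"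
  "\<zero>\<^bsub>coordinate_ring N\<^esub> = (0 :: (nat, 'k) mpoly)"
  by (simp_all add: coordinate_ring_def poly_ring_def)

lemma coordinate_ring_cring: "cring (coordinate_ring N :: (nat, 'k::field) mpoly ring)"
  unfolding coordinate_ring_def by (rule poly_ring_cring)

text \<open>The points are given by representatives whose first coordinate is not zero. Different indices may
give the same point.\<close>

locale cone_points =
  fixes N s :: nat and v :: "nat \<Rightarrow> nat \<Rightarrow> 'k::field"
  assumes inf: "infinite (UNIV :: 'k set)"
    and v0: "\<And>i. i \<in> {1..s} \<Longrightarrow> v i 0 \<noteq> 0"
begin

abbreviation R :: "(nat, 'k) mpoly ring" where "R \<equiv> coordinate_ring N"

sublocale R: cring R by (rule coordinate_ring_cring)

definition vanishing_ideal :: "nat set \<Rightarrow> (nat, 'k) mpoly set" where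
  "vanishing_ideal A = {f. poly_vars f \<subseteq> {0..N} \<and> (\<forall>i\<in>A. cone_zero (v i) f)}"

lemma a_inv_eq: "poly_vars f \<subseteq> {0..N} \<Longrightarrow> \<ominus>\<^bsub>R\<^esub> f = - f"
  by (rule R.minus_equality) (simp_all add: coordinate_ring_simps poly_vars_closed)

lemma ideal_vanishing: "ideal (vanishing_ideal A) R"
proof (rule idealI)
  show "ring R" by (rule R.ring_axioms)
  show "subgroup (vanishing_ideal A) (add_monoid R)"
  proof (rule R.add.subgroupI)
    show "vanishing_ideal A \<subseteq> carrier R"
      by (auto simp: vanishing_ideal_def coordinate_ring_simps)
    have "0 \<in> vanishing_ideal A"
      by (simp add: vanishing_ideal_def poly_vars_closed cone_zero_def poly_eval_simps)
    then show "vanishing_ideal A \<noteq> {}" by blast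
  next
    fix f assume f: "f \<in> vanishing_ideal A"
    then have "\<ominus>\<^bsub>R\<^esub> f = - f" by (intro a_inv_eq) (simp add: vanishing_ideal_def)
    moreover have "- f \<in> vanishing_ideal A"
      using f by (simp add: vanishing_ideal_def poly_vars_closed cone_zero_def poly_eval_simps)
    ultimately show "\<ominus>\<^bsub>R\<^esub> f \<in> vanishing_ideal A" by simp
  next
    fix f g assume "f \<in> vanishing_ideal A" "g \<in> vanishing_ideal A"
    then show "f \<oplus>\<^bsub>R\<^esub> g \<in> vanishing_ideal A"
      by (simp add: vanishing_ideal_def poly_vars_closed cone_zero_def poly_eval_simps coordinate_ring_simps)
  qed
  fix f g assume "f \<in> vanishing_ideal A" "g \<in> carrier R"
  then show "g \<otimes>\<^bsub>R\<^esub> f \<in> vanishing_ideal A" "f \<otimes>\<^bsub>R\<^esub> g \<in> vanishing_ideal A"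
    by (simp_all add: vanishing_ideal_def poly_vars_closed cone_zero_def poly_eval_simps coordinate_ring_simps)
qed

definition points :: "(nat \<Rightarrow> 'k) set set" where
  "points = (\<lambda>i. projective_point N (v i)) ` {1..s}"

definition I :: "(nat, 'k) mpoly set" where "I = defining_ideal N points"

lemma zero_on_point:
  assumes "poly_vars f \<subseteq> {0..N}"
  shows "(\<forall>u\<in>projective_point N (v i). poly_eval u f = 0) \<longleftrightarrow> cone_zero (v i) f"
proof -
  have "poly_eval (restrict (\<lambda>j. c * v i j) {0..N}) f = poly_eval (\<lambda>j. c * v i j) f" for c
    by (rule poly_eval_cong) (use assms in auto)
  then show ?thesis by (auto simp: projective_point_def cone_zero_def)
qed

lemma form_in_I:
  assumes "homogeneous_of_degree d f" "poly_vars f \<subseteq> {0..N}" "\<And>i. i \<in> {1..s} \<Longrightarrow> cone_zero (v i) f"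
  shows "f \<in> I"
proof -
  let ?G = "{f \<in> carrier R. (\<exists>d. homogeneous_of_degree d f) \<and> (\<forall>P\<in>points. \<forall>v\<in>P. poly_eval v f = 0)}"
  have "f \<in> ?G" using assms zero_on_point[OF assms(2)] by (auto simp: coordinate_ring_simps points_def)
  moreover have "?G \<subseteq> Idl\<^bsub>R\<^esub> ?G" by (rule R.genideal_self) blast
  ultimately show ?thesis unfolding I_def defining_ideal_def by blast
qed

lemma ideal_I: "ideal I R"
  unfolding I_def defining_ideal_def by (rule R.genideal_ideal) blast

text \<open>The ideal is generated by forms only. It contains the other polynomials that vanish on the lines over
the points because, over an infinite field, their homogeneous parts vanish there too.\<close>

lemma I_eq: "I = vanishing_ideal {1..s}"
proof
  have "{f \<in> carrier R. (\<exists>d. homogeneous_of_degree d f) \<and> (\<forall>P\<in>points. \<forall>v\<in>P. poly_eval v f = 0)}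
      \<subseteq> vanishing_ideal {1..s}"
    using zero_on_point by (auto simp: vanishing_ideal_def coordinate_ring_simps points_def)
  then show "I \<subseteq> vanishing_ideal {1..s}"
    unfolding I_def defining_ideal_def by (intro R.genideal_minimal ideal_vanishing)
  show "vanishing_ideal {1..s} \<subseteq> I"
  proof
    fix f assume f: "f \<in> vanishing_ideal {1..s}"
    interpret I: ideal I R by (rule ideal_I)
    have part: "hom_part d f \<in> I" for d
    proof (rule form_in_I)
      show hom: "homogeneous_of_degree d (hom_part d f)"
        by (simp add: homogeneous_of_degree_def hom_part_keys)
      show "poly_vars (hom_part d f) \<subseteq> {0..N}"
        using f by (auto simp: vanishing_ideal_def poly_vars_def hom_part_keys)
      fix i assume "i \<in> {1..s}"
      then have "cone_zero (v i) f" using f by (simp add: vanishing_ideal_def)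
      then show "cone_zero (v i) (hom_part d f)"
        unfolding cone_zero_form[OF hom] by (rule cone_zero_hom_part[OF inf])
    qed
    have "(\<Sum>d\<in>D. hom_part d f) \<in> I" for D
      by (induction D rule: infinite_finite_induct)
        (use I.zero_closed I.a_closed part in \<open>auto simp: coordinate_ring_simps\<close>)
    then show "f \<in> I" using hom_part_sum[of f] by metis
  qed
qed

definition ipow :: "nat \<Rightarrow> (nat, 'k) mpoly set" where
  "ipow n = I [^]\<^bsub>ideals_set R\<^esub> n"

lemma ipow_0: "ipow 0 = carrier R"
  by (simp add: ipow_def nat_pow_def ideals_set_def)

lemma ipow_Suc: "ipow (Suc n) = ideal_prod R (ipow n) I"
  by (simp add: ipow_def nat_pow_def ideals_set_def)

lemma ideal_ipow: "ideal (ipow n) R"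
  by (induction n) (simp_all add: ipow_0 ipow_Suc R.oneideal R.ideal_prod_is_ideal ideal_I)

lemma ipow_mult_carrier: "f \<in> ipow n \<Longrightarrow> poly_vars g \<subseteq> {0..N} \<Longrightarrow> g * f \<in> ipow n"
  using ideal.I_l_closed[OF ideal_ipow, of f n g] by (simp add: coordinate_ring_simps)

lemma ipow_add_closed: "f \<in> ipow n \<Longrightarrow> g \<in> ipow n \<Longrightarrow> f + g \<in> ipow n"
  using additive_subgroup.a_closed[OF ideal.axioms(1)[OF ideal_ipow], of f n g]
  by (simp add: coordinate_ring_simps)

lemma ipow_zero: "0 \<in> ipow n"
  using additive_subgroup.zero_closed[OF ideal.axioms(1)[OF ideal_ipow], of n]
  by (simp add: coordinate_ring_simps)

lemma ipow_SucI: "f \<in> ipow n \<Longrightarrow> g \<in> I \<Longrightarrow> f * g \<in> ipow (Suc n)"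
  unfolding ipow_Suc using ideal_prod.prod[of f "ipow n" g I R] by (simp add: coordinate_ring_simps)

lemma ipow_mult: "f \<in> ipow m \<Longrightarrow> g \<in> ipow n \<Longrightarrow> f * g \<in> ipow (m + n)"
proof (induction n arbitrary: g)
  case 0
  then show ?case using ipow_mult_carrier[of f m g] by (simp add: ipow_0 coordinate_ring_simps mult.commute)
next
  case (Suc n)
  from Suc.prems(2) show ?case unfolding ipow_Suc
  proof (induction rule: ideal_prod.induct)
    case (prod i j)
    then have "(f * i) * j \<in> ipow (Suc (m + n))" using Suc.IH Suc.prems(1) by (intro ipow_SucI) auto
    then show ?case by (simp add: coordinate_ring_simps mult.assoc)
  next
    case (sum s1 s2)
    then show ?case using ipow_add_closed by (simp add: coordinate_ring_simps distrib_left)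
  qed
qed

lemma ipow_vanishes:
  "f \<in> ipow t \<Longrightarrow> i \<in> {1..s} \<Longrightarrow> c \<noteq> 0 \<Longrightarrow> vanishes_to_order t (\<lambda>j. c * v i j) f"
proof (induction t arbitrary: f)
  case 0
  then show ?case by simp
next
  case (Suc t)
  from Suc.prems(1) show ?case unfolding ipow_Suc
  proof (induction rule: ideal_prod.induct)
    case (prod g h)
    have "vanishes_to_order 1 (\<lambda>j. c * v i j) h"
      using prod(2) Suc.prems unfolding vanishes_to_order_1_iff
      by (auto simp: I_eq vanishing_ideal_def cone_zero_def)
    then show ?case
      using vanishes_to_order_mult[OF Suc.IH[OF prod(1) Suc.prems(2,3)], of 1 h]
      by (simp add: coordinate_ring_simps)
  next
    case (sum s1 s2)
    then show ?case using vanishes_to_order_add by (simp add: coordinate_ring_simps)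
  qed
qed

lemma same_point:
  assumes "projective_point N (v i) = projective_point N (v j)" "poly_vars f \<subseteq> {0..N}"
  shows "cone_zero (v i) f \<longleftrightarrow> cone_zero (v j) f"
  using zero_on_point[OF assms(2), of i] zero_on_point[OF assms(2), of j] assms(1) by simp

lemma separating_linear_form:
  assumes i: "i \<in> {1..s}" and j: "j \<in> {1..s}"
    and neq: "projective_point N (v i) \<noteq> projective_point N (v j)"
  shows "\<exists>h. homogeneous_of_degree 1 h \<and> poly_vars h \<subseteq> {0..N} \<and> poly_eval (v j) h = 0 \<and> poly_eval (v i) h \<noteq> 0"
proof -
  have "\<exists>l\<le>N. v i l * v j 0 \<noteq> v i 0 * v j l"
  proof (rule ccontr)
    assume "\<not> ?thesis"
    then have *: "v i l * v j 0 = v i 0 * v j l" if "l \<le> N" for l using that by blast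
    define q where "q = v i 0 / v j 0"
    have q: "q \<noteq> 0" using v0 i j by (simp add: q_def)
    have vi: "v i l = q * v j l" if "l \<le> N" for l
      using *[OF that] v0[OF j] by (simp add: q_def field_simps)
    have "projective_point N (v i) = projective_point N (v j)"
    proof
      show "projective_point N (v i) \<subseteq> projective_point N (v j)"
      proof
        fix u assume "u \<in> projective_point N (v i)"
        then obtain c where c: "c \<noteq> 0" "u = restrict (\<lambda>l. c * v i l) {0..N}"
          by (auto simp: projective_point_def)
        have "u = restrict (\<lambda>l. (c * q) * v j l) {0..N}"
          unfolding c(2) by (rule restrict_ext) (simp add: vi mult.assoc)
        then show "u \<in> projective_point N (v j)" using c(1) q by (auto simp: projective_point_def)
      qed
      show "projective_point N (v j) \<subseteq> projective_point N (v i)"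
      proof
        fix u assume "u \<in> projective_point N (v j)"
        then obtain c where c: "c \<noteq> 0" "u = restrict (\<lambda>l. c * v j l) {0..N}"
          by (auto simp: projective_point_def)
        have "u = restrict (\<lambda>l. (c / q) * v i l) {0..N}"
          unfolding c(2) by (rule restrict_ext) (use q in \<open>simp add: vi\<close>)
        moreover have "c / q \<noteq> 0" using c(1) q by simp
        ultimately show "u \<in> projective_point N (v i)" unfolding projective_point_def by blast
      qed
    qed
    then show False using neq by contradiction
  qed
  then obtain l where l: "l \<le> N" "v i l * v j 0 \<noteq> v i 0 * v j l" by blast
  let ?h = "single (single l 1) (v j 0) - single (single 0 1) (v j l)"
  show ?thesis
  proof (intro exI[of _ ?h] conjI)
    show "homogeneous_of_degree 1 ?h" by (intro homogeneous_diff homogeneous_single) auto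
    show "poly_vars ?h \<subseteq> {0..N}" by (intro poly_vars_closed poly_vars_single) (use l in auto)
    show "poly_eval (v j) ?h = 0" by (simp add: poly_eval_simps)
    show "poly_eval (v i) ?h \<noteq> 0" using l(2) by (simp add: poly_eval_simps mult.commute)
  qed
qed

lemma separating_form:
  assumes i: "i \<in> {1..s}"
  shows "\<exists>h d. homogeneous_of_degree d h \<and> poly_vars h \<subseteq> {0..N} \<and> poly_eval (v i) h \<noteq> 0 \<and>
    (\<forall>j\<in>{1..s}. projective_point N (v j) \<noteq> projective_point N (v i) \<longrightarrow> poly_eval (v j) h = 0)"
proof -
  have "\<exists>h d. homogeneous_of_degree d h \<and> poly_vars h \<subseteq> {0..N} \<and> poly_eval (v i) h \<noteq> 0 \<and>
    (\<forall>j\<in>J. projective_point N (v j) \<noteq> projective_point N (v i) \<longrightarrow> poly_eval (v j) h = 0)"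
    if "finite J" "J \<subseteq> {1..s}" for J
    using that
  proof (induction J rule: finite_induct)
    case empty
    show ?case by (intro exI[of _ 1] exI[of _ 0]) (simp add: homogeneous_1 poly_vars_closed poly_eval_simps)
  next
    case (insert j J)
    then obtain h d where h: "homogeneous_of_degree d h" "poly_vars h \<subseteq> {0..N}" "poly_eval (v i) h \<noteq> 0"
      "\<forall>j\<in>J. projective_point N (v j) \<noteq> projective_point N (v i) \<longrightarrow> poly_eval (v j) h = 0" by auto
    show ?case
    proof (cases "projective_point N (v j) = projective_point N (v i)")
      case True
      then show ?thesis using h by blast
    next
      case False
      then obtain l where l: "homogeneous_of_degree 1 l" "poly_vars l \<subseteq> {0..N}" "poly_eval (v j) l = 0"
        "poly_eval (v i) l \<noteq> 0"
        using separating_linear_form[OF i, of j] insert.prems by auto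
      show ?thesis
        by (intro exI[of _ "h * l"] exI[of _ "d + 1"] conjI homogeneous_mult poly_vars_closed)
          (use h l in \<open>auto simp: poly_eval_simps\<close>)
    qed
  qed
  then show ?thesis by blast
qed

text \<open>A form that vanishes at all the other points. It is compared by points and not by indices because
points may be repeated.\<close>

definition separator :: "nat \<Rightarrow> (nat, 'k) mpoly" where
  "separator i = (SOME h. \<exists>d. homogeneous_of_degree d h \<and> poly_vars h \<subseteq> {0..N} \<and> poly_eval (v i) h \<noteq> 0 \<and>
    (\<forall>j\<in>{1..s}. projective_point N (v j) \<noteq> projective_point N (v i) \<longrightarrow> poly_eval (v j) h = 0))"

lemma separator:
  assumes "i \<in> {1..s}"
  shows "poly_vars (separator i) \<subseteq> {0..N}" "poly_eval (v i) (separator i) \<noteq> 0"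
    "\<not> cone_zero (v i) (separator i)"
    "j \<in> {1..s} \<Longrightarrow> projective_point N (v j) \<noteq> projective_point N (v i) \<Longrightarrow> cone_zero (v j) (separator i)"
proof -
  obtain d where d: "homogeneous_of_degree d (separator i)" "poly_vars (separator i) \<subseteq> {0..N}" "poly_eval (v i) (separator i) \<noteq> 0"
    "\<forall>j\<in>{1..s}. projective_point N (v j) \<noteq> projective_point N (v i) \<longrightarrow> poly_eval (v j) (separator i) = 0"
    using someI_ex[OF separating_form[OF assms]] unfolding separator_def by blast
  then show "poly_vars (separator i) \<subseteq> {0..N}" "poly_eval (v i) (separator i) \<noteq> 0" "\<not> cone_zero (v i) (separator i)"
    "j \<in> {1..s} \<Longrightarrow> projective_point N (v j) \<noteq> projective_point N (v i) \<Longrightarrow> cone_zero (v j) (separator i)"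
    by (auto simp: cone_zero_form[OF d(1)])
qed

lemma separator_mult_in_I:
  assumes "i \<in> {1..s}" "poly_vars f \<subseteq> {0..N}" "cone_zero (v i) f"
  shows "separator i * f \<in> I"
proof -
  have "cone_zero (v j) (separator i * f)" if "j \<in> {1..s}" for j
    using separator(4)[OF assms(1) that] same_point[OF _ assms(2), of j i] assms(3)
    unfolding cone_zero_mult[OF inf] by blast
  then show ?thesis using separator(1)[OF assms(1)] assms(2) by (simp add: I_eq vanishing_ideal_def poly_vars_closed)
qed

text \<open>The ideal of the \<open>i\<close>-th point is \<open>(I : separator i)\<close>.\<close>

lemma point_ideal_associated:
  assumes i: "i \<in> {1..s}"
  shows "vanishing_ideal {i} \<in> associated_primes R I"
proof -
  have "primeideal (vanishing_ideal {i}) R"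
  proof (rule primeidealI)
    show "carrier R \<noteq> vanishing_ideal {i}"
    proof
      assume "carrier R = vanishing_ideal {i}"
      then have "separator i \<in> vanishing_ideal {i}" using separator(1)[OF i] by (auto simp: coordinate_ring_simps)
      then show False using separator(3)[OF i] by (simp add: vanishing_ideal_def)
    qed
  next
    fix f g assume "f \<in> carrier R" "g \<in> carrier R" "f \<otimes>\<^bsub>R\<^esub> g \<in> vanishing_ideal {i}"
    then show "f \<in> vanishing_ideal {i} \<or> g \<in> vanishing_ideal {i}"
      by (simp add: vanishing_ideal_def coordinate_ring_simps cone_zero_mult[OF inf])
  qed (rule ideal_vanishing, rule R.cring_axioms)
  moreover have "vanishing_ideal {i} = {g \<in> carrier R. g \<otimes>\<^bsub>R\<^esub> separator i \<in> I}"
  proof (intro equalityI subsetI)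
    fix g assume "g \<in> vanishing_ideal {i}"
    then have "poly_vars g \<subseteq> {0..N}" "cone_zero (v i) g" by (simp_all add: vanishing_ideal_def)
    then show "g \<in> {g \<in> carrier R. g \<otimes>\<^bsub>R\<^esub> separator i \<in> I}"
      using separator_mult_in_I[OF i, of g] by (simp add: coordinate_ring_simps mult.commute)
  next
    fix g assume "g \<in> {g \<in> carrier R. g \<otimes>\<^bsub>R\<^esub> separator i \<in> I}"
    then show "g \<in> vanishing_ideal {i}"
      using i separator(3)[OF i] by (auto simp: I_eq vanishing_ideal_def coordinate_ring_simps cone_zero_mult[OF inf])
  qed
  moreover have "separator i \<in> carrier R" using separator(1)[OF i] by (simp add: coordinate_ring_simps)
  ultimately show ?thesis unfolding associated_primes_def by blast
qed

text \<open>If \<open>p = (I : f)\<close>, then \<open>p\<close> lies in the prime ideal of any point at which \<open>f\<close> does not vanish. This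
inclusion suffices to see that powers of a separator are admissible denominators.\<close>

lemma associated_prime_le:
  assumes "p \<in> associated_primes R I"
  shows "\<exists>i\<in>{1..s}. p \<subseteq> vanishing_ideal {i}"
proof -
  obtain f where p: "primeideal p R" "f \<in> carrier R" "p = {g \<in> carrier R. g \<otimes>\<^bsub>R\<^esub> f \<in> I}"
    using assms by (auto simp: associated_primes_def)
  have "f \<notin> I"
  proof
    assume "f \<in> I"
    then have "carrier R = p" using p(3) ideal.I_l_closed[OF ideal_I] by auto
    then show False using primeideal.I_notcarr[OF p(1)] by contradiction
  qed
  then obtain i where i: "i \<in> {1..s}" "\<not> cone_zero (v i) f"
    using p(2) by (auto simp: I_eq vanishing_ideal_def coordinate_ring_simps)
  have "p \<subseteq> vanishing_ideal {i}"
    using i unfolding p(3) by (auto simp: I_eq vanishing_ideal_def coordinate_ring_simps cone_zero_mult[OF inf])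
  then show ?thesis using i(1) by blast
qed

text \<open>The denominator \<open>g\<close> does not vanish at some representative of the point, so that \<open>f\<close> has there at least
the order of \<open>g * f\<close>.\<close>

lemma symbolic_power_vanishes:
  assumes f: "f \<in> symbolic_power R I t" "homogeneous_of_degree d f" and i: "i \<in> {1..s}"
  shows "vanishes_to_order t (v i) f"
proof -
  have "f \<in> localization_contraction R (vanishing_ideal {i}) (ipow t)"
    using f(1) point_ideal_associated[OF i] unfolding symbolic_power_def ipow_def by blast
  then obtain g where g: "poly_vars g \<subseteq> {0..N}" "g \<notin> vanishing_ideal {i}" "g * f \<in> ipow t"
    by (auto simp: localization_contraction_def coordinate_ring_simps)
  then obtain c where c: "c \<noteq> 0" "poly_eval (\<lambda>j. c * v i j) g \<noteq> 0"
    by (auto simp: vanishing_ideal_def cone_zero_def)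
  have "vanishes_to_order t (\<lambda>j. c * v i j) f"
    by (rule vanishes_to_order_cancel[OF ipow_vanishes[OF g(3) i c(1)] c(2)])
  then show ?thesis by (rule vanishes_to_order_scale[OF f(2) c(1)])
qed

lemma in_symbolic_powerI:
  assumes "poly_vars f \<subseteq> {0..N}" "\<And>i. i \<in> {1..s} \<Longrightarrow> separator i ^ n * f \<in> ipow t"
  shows "f \<in> symbolic_power R I t"
  unfolding symbolic_power_def
proof (intro IntI INT_I)
  show "f \<in> carrier R" using assms(1) by (simp add: coordinate_ring_simps)
  fix p assume "p \<in> associated_primes R I"
  then obtain i where i: "i \<in> {1..s}" "p \<subseteq> vanishing_ideal {i}" using associated_prime_le by blast
  have "poly_eval (v i) (separator i ^ n) \<noteq> 0" using separator(2)[OF i(1)] by (simp add: poly_eval_simps)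
  then have "\<not> cone_zero (v i) (separator i ^ n)" by (auto simp: cone_zero_def intro!: exI[of _ 1])
  then have "separator i ^ n \<in> carrier R - p"
    using i separator(1)[OF i(1)] by (auto simp: coordinate_ring_simps vanishing_ideal_def intro: poly_vars_power[THEN subsetD])
  then show "f \<in> localization_contraction R p (I [^]\<^bsub>ideals_set R\<^esub> t)"
    using assms i(1) unfolding localization_contraction_def ipow_def[symmetric]
    by (auto simp: coordinate_ring_simps)
qed

lemma symbolic_power_mult:
  assumes "f \<in> symbolic_power R I t" "g \<in> symbolic_power R I u"
  shows "f * g \<in> symbolic_power R I (t + u)"
  unfolding symbolic_power_def
proof (intro IntI INT_I)
  have "poly_vars f \<subseteq> {0..N}" "poly_vars g \<subseteq> {0..N}"
    using assms unfolding symbolic_power_def coordinate_ring_simps by blast+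
  then show fg: "f * g \<in> carrier R" by (simp add: coordinate_ring_simps poly_vars_closed)
  fix p assume p: "p \<in> associated_primes R I"
  then interpret p: primeideal p R by (simp add: associated_primes_def)
  have "f \<in> localization_contraction R p (ipow t)" "g \<in> localization_contraction R p (ipow u)"
    using assms p unfolding symbolic_power_def ipow_def by blast+
  then obtain a b where a: "a \<in> carrier R - p" "a * f \<in> ipow t" and b: "b \<in> carrier R - p" "b * g \<in> ipow u"
    unfolding localization_contraction_def coordinate_ring_simps(2) by blast
  have "a * b \<in> carrier R - p"
    using a(1) b(1) p.I_prime[of a b] R.m_closed[of a b] unfolding coordinate_ring_simps(2) by blast
  moreover have "(a * b) * (f * g) \<in> ipow (t + u)" using ipow_mult[OF a(2) b(2)] by (simp add: mult_ac)
  ultimately show "f * g \<in> localization_contraction R p (I [^]\<^bsub>ideals_set R\<^esub> (t + u))"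
    using fg unfolding localization_contraction_def ipow_def[symmetric] coordinate_ring_simps(2) by blast
qed

text \<open>The equations \<open>y\<^sub>1, \<dots>, y\<^sub>N\<close> of the \<open>i\<close>-th point are multiplied into \<open>I\<close> by the separator, hence their
triple products into the third power of \<open>I\<close> by its cube. The polynomials with the latter property
form the ideal modulo which the conditions are counted.\<close>

lemma ex_triple_form:
  assumes count: "s * ((N + 2) choose 2) < (N + (2 + e)) choose N"
  shows "\<exists>f. f \<noteq> 0 \<and> homogeneous_of_degree (2 + e) f \<and> poly_vars f \<subseteq> {0..N} \<and> f \<in> symbolic_power R I 3"
proof -
  define w where "w i l = v i l / v i 0" for i l
  define y where "y i l = (if l = 0 then Var 0 else Var l - Const (w i l) * Var 0)" for i l
  define Q where "Q i = {f. separator i ^ 3 * f \<in> ipow 3}" for i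
  have yI: "separator i * y i l \<in> I" if i: "i \<in> {1..s}" and l: "l \<in> {1..N}" for i l
  proof (rule separator_mult_in_I[OF i])
    have "y i l = Var l - Const (w i l) * Var 0" using l by (simp add: y_def)
    then show "poly_vars (y i l) \<subseteq> {0..N}"
      using l by (simp only:) (intro poly_vars_closed poly_vars_X poly_vars_C; simp)
    show "cone_zero (v i) (y i l)"
      using l v0[OF i] by (auto simp: cone_zero_def y_def w_def poly_eval_simps)
  qed
  have span: "\<exists>x. single m 1 - (\<Sum>\<beta>\<in>monomials N 2. Const (x \<beta>) * (mon_eval (y i) \<beta> * Var 0 ^ e)) \<in> Q i"
    if i: "i \<in> {1..s}" and m: "m \<in> monomials N (2 + e)" for i m
    unfolding y_def
  proof (rule spanning_quadrics)
    show "0 \<in> Q i" by (simp add: Q_def ipow_zero)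
    show "f + g \<in> Q i" if "f \<in> Q i" "g \<in> Q i" for f g
      using that ipow_add_closed by (simp add: Q_def distrib_left)
    show "g * f \<in> Q i" if "f \<in> Q i" "poly_vars g \<subseteq> {0..N}" for f g
      using ipow_mult_carrier[of "separator i ^ 3 * f" 3 g] that by (simp add: Q_def mult_ac)
    show "(if a = 0 then Var 0 else Var a - Const (w i a) * Var 0) * (if b = 0 then Var 0 else Var b - Const (w i b) * Var 0) *
        (if c = 0 then Var 0 else Var c - Const (w i c) * Var 0) \<in> Q i"
      if abc: "a \<in> {1..N}" "b \<in> {1..N}" "c \<in> {1..N}" for a b c
    proof -
      have "1 \<in> ipow 0" by (simp add: ipow_0 coordinate_ring_simps poly_vars_closed)
      then have "1 * (separator i * y i a) * (separator i * y i b) * (separator i * y i c) \<in> ipow (Suc (Suc (Suc 0)))"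
        by (intro ipow_SucI yI i abc)
      then have "separator i ^ 3 * (y i a * y i b * y i c) \<in> ipow 3"
        by (simp add: power3_eq_cube numeral_3_eq_3 mult_ac)
      then show ?thesis by (simp add: Q_def y_def)
    qed
  qed (rule m)
  define x where "x i m = (SOME x. single m 1 - (\<Sum>\<beta>\<in>monomials N 2. Const (x \<beta>) * (mon_eval (y i) \<beta> * Var 0 ^ e)) \<in> Q i)" for i m
  have x: "single m 1 - (\<Sum>\<beta>\<in>monomials N 2. Const (x i m \<beta>) * (mon_eval (y i) \<beta> * Var 0 ^ e)) \<in> Q i"
    if "i \<in> {1..s}" "m \<in> monomials N (2 + e)" for i m
    unfolding x_def by (rule someI_ex[OF span[OF that]])
  have card: "card ({1..s} \<times> monomials N 2) < card (monomials N (2 + e))"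
    using count binomial_symmetric[of 2 "N + 2"] by (simp add: card_cartesian_product monomials_finite_card)
  obtain z where z: "\<exists>m\<in>monomials N (2 + e). z m \<noteq> 0"
    "\<forall>r\<in>{1..s} \<times> monomials N 2. (\<Sum>m\<in>monomials N (2 + e). x (fst r) m (snd r) * z m) = 0"
    using ex_nontrivial_kernel[OF _ _ card, of "\<lambda>r m. x (fst r) m (snd r)"] monomials_finite_card(1) by auto
  define f where "f = (\<Sum>m\<in>monomials N (2 + e). single m (z m))"
  define T where "T i \<beta> = mon_eval (y i) \<beta> * Var 0 ^ e" for i \<beta>
  have fQ: "f \<in> Q i" if i: "i \<in> {1..s}" for i
  proof -
    have sumQ: "(\<Sum>m\<in>M. g m) \<in> Q i" if "\<And>m. m \<in> M \<Longrightarrow> g m \<in> Q i" for M :: "(nat \<Rightarrow>\<^sub>0 nat) set" and g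
      using that
      by (induction M rule: infinite_finite_induct) (auto simp: Q_def distrib_left ipow_zero intro: ipow_add_closed)
    have C_sum: "Const (\<Sum>m\<in>M. g m) = (\<Sum>m\<in>M. Const (g m))" for M :: "(nat \<Rightarrow>\<^sub>0 nat) set" and g :: "_ \<Rightarrow> 'k"
      by (induction M rule: infinite_finite_induct) (auto simp: single_add)
    have CC: "Const a * (Const b * t) = Const (b * a) * t" for a b :: 'k and t :: "(nat, 'k) mpoly"
    proof -
      have "Const a * Const b = (Const (b * a) :: (nat, 'k) mpoly)" by (simp add: mult_single mult.commute)
      then show ?thesis by (simp add: mult.assoc[symmetric])
    qed
    have "(\<Sum>m\<in>monomials N (2 + e). Const (z m) * (single m 1 - (\<Sum>\<beta>\<in>monomials N 2. Const (x i m \<beta>) * T i \<beta>))) \<in> Q i"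
    proof (rule sumQ)
      fix m assume m: "m \<in> monomials N (2 + e)"
      have "separator i ^ 3 * (single m 1 - (\<Sum>\<beta>\<in>monomials N 2. Const (x i m \<beta>) * T i \<beta>)) \<in> ipow 3"
        using x[OF i m] unfolding Q_def T_def mem_Collect_eq .
      from ipow_mult_carrier[OF this poly_vars_C, of "z m"]
      show "Const (z m) * (single m 1 - (\<Sum>\<beta>\<in>monomials N 2. Const (x i m \<beta>) * T i \<beta>)) \<in> Q i"
        by (simp add: Q_def mult.left_commute)
    qed
    also have "(\<Sum>m\<in>monomials N (2 + e). Const (z m) * (single m 1 - (\<Sum>\<beta>\<in>monomials N 2. Const (x i m \<beta>) * T i \<beta>))) =
        f - (\<Sum>\<beta>\<in>monomials N 2. Const (\<Sum>m\<in>monomials N (2 + e). x i m \<beta> * z m) * T i \<beta>)"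
    proof -
      have "(\<Sum>m\<in>monomials N (2 + e). Const (z m) * (\<Sum>\<beta>\<in>monomials N 2. Const (x i m \<beta>) * T i \<beta>)) =
          (\<Sum>\<beta>\<in>monomials N 2. \<Sum>m\<in>monomials N (2 + e). Const (x i m \<beta> * z m) * T i \<beta>)"
        unfolding sum_distrib_left CC by (rule sum.swap)
      also have "\<dots> = (\<Sum>\<beta>\<in>monomials N 2. Const (\<Sum>m\<in>monomials N (2 + e). x i m \<beta> * z m) * T i \<beta>)"
        by (simp only: C_sum sum_distrib_right)
      finally show ?thesis
        by (simp add: right_diff_distrib sum_subtractf f_def mult_single)
    qed
    also have "\<dots> = f"
    proof -
      have "(\<Sum>m\<in>monomials N (2 + e). x i m \<beta> * z m) = 0" if "\<beta> \<in> monomials N 2" for \<beta>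
        using z(2)[rule_format, of "(i, \<beta>)"] i that by simp
      then have "(\<Sum>\<beta>\<in>monomials N 2. Const (\<Sum>m\<in>monomials N (2 + e). x i m \<beta> * z m) * T i \<beta>) = 0"
        by (intro sum.neutral ballI) simp
      then show ?thesis by simp
    qed
    finally show ?thesis .
  qed
  have "f \<noteq> 0"
  proof -
    obtain m where "m \<in> monomials N (2 + e)" "z m \<noteq> 0" using z(1) by blast
    then have "lookup f m \<noteq> 0" by (simp add: f_def lookup_form_of_coeffs)
    then show ?thesis by auto
  qed
  moreover have "f \<in> symbolic_power R I 3"
    by (rule in_symbolic_powerI[of _ 3]) (use fQ in \<open>auto simp: f_def form_of_coeffs Q_def\<close>)
  ultimately show ?thesis unfolding f_def using form_of_coeffs by blast
qed

end

section \<open>Binomial inequalities\<close>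

lemma double_choose_two: "2 * ((n + 2) choose 2) = (n + 2) * (n + 1)"
  by (simp add: choose_two)

lemma binomial_diag:
  assumes "n' = Suc n"
  shows "((n' + j) choose n') * n' = ((n + j) choose n) * (n' + j)"
  using Suc_times_binomial_eq[of "n + j" n] assms by (simp add: mult_ac)

lemma binomial_up: "((n + (j + 1)) choose n) * (j + 1) = ((n + j) choose n) * (n + j + 1)"
proof -
  have "((n + (j + 1)) choose (j + 1)) * (j + 1) = ((n + j) choose j) * (n + j + 1)"
    using Suc_times_binomial_eq[of "n + j" j] by (simp add: mult_ac)
  then show ?thesis
    using binomial_symmetric[of n "n + (j + 1)"] binomial_symmetric[of n "n + j"] by simp
qed

lemma mult_chain:
  fixes b B c c' P x y :: nat
  assumes "c' * x = c * y" "c * P = b * B"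
  shows "c' * (P * x) = b * (B * y)"
proof -
  have "c' * (P * x) = (c' * x) * P" by simp
  also have "\<dots> = (c * P) * y" unfolding assms(1) by simp
  finally show ?thesis unfolding assms(2) by simp
qed

lemma binomial_step_1:
  "((n + 1 + (j + 1)) choose (n + 1)) * ((j + 1) * (n + 1)) = ((n + j) choose n) * ((n + j + 1) * (n + 1 + (j + 1)))"
  by (rule mult_chain[OF binomial_diag binomial_up]) simp

lemma binomial_step_2:
  "((n + 2 + (j + 1)) choose (n + 2)) * ((j + 1) * (n + 1) * (n + 2)) =
    ((n + j) choose n) * ((n + j + 1) * (n + 1 + (j + 1)) * (n + 2 + (j + 1)))"
  by (rule mult_chain[OF binomial_diag binomial_step_1]) simp

lemma binomial_step_3:
  "((n + 3 + (j + 1)) choose (n + 3)) * ((j + 1) * (n + 1) * (n + 2) * (n + 3)) =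
    ((n + j) choose n) * ((n + j + 1) * (n + 1 + (j + 1)) * (n + 2 + (j + 1)) * (n + 3 + (j + 1)))"
  by (rule mult_chain[OF binomial_diag binomial_step_2]) simp

lemma binomial_step_4:
  "((n + 4 + (j + 1)) choose (n + 4)) * ((j + 1) * (n + 1) * (n + 2) * (n + 3) * (n + 4)) =
    ((n + j) choose n) * ((n + j + 1) * (n + 1 + (j + 1)) * (n + 2 + (j + 1)) * (n + 3 + (j + 1)) * (n + 4 + (j + 1)))"
  by (rule mult_chain[OF binomial_diag binomial_step_3]) simp

lemma binomial_step_5:
  "((n + 5 + (j + 1)) choose (n + 5)) * ((j + 1) * (n + 1) * (n + 2) * (n + 3) * (n + 4) * (n + 5)) =
    ((n + j) choose n) * ((n + j + 1) * (n + 1 + (j + 1)) * (n + 2 + (j + 1)) * (n + 3 + (j + 1)) * (n + 4 + (j + 1)) * (n + 5 + (j + 1)))"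
  by (rule mult_chain[OF binomial_diag binomial_step_4]) simp

text \<open>The induction step for inequalities \<open>K * ((N + 2) choose 2) \<le> (N + j) choose N\<close>, where
\<open>P = (N + 2) * (N + 1)\<close> is twice the first binomial coefficient, \<open>K\<close> grows by the factor \<open>\<kappa>\<close>, and
\<open>c' / c = B / R\<close>.\<close>

lemma growth_step:
  fixes c c' K P P' Q R B \<kappa> :: nat
  assumes "K * P \<le> 2 * c" "c' * R = c * B" "R = P * Q" "\<kappa> * P' * Q \<le> B" "R > 0"
  shows "\<kappa> * K * P' \<le> 2 * c'"
proof -
  have "\<kappa> * K * P' * R = (\<kappa> * P' * Q) * (K * P)" unfolding assms(3) by (simp only: mult_ac)
  also have "\<dots> \<le> B * (2 * c)" by (rule mult_mono[OF assms(4,1)]) auto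
  also have "\<dots> = 2 * (c' * R)" unfolding assms(2) by (simp only: mult_ac)
  finally have "\<kappa> * K * P' * R \<le> 2 * c' * R" by (simp only: mult_ac)
  then show ?thesis using assms(5) by simp
qed

lemma choose_two_mult: "2 * (((N + 2) choose 2) * X) = X * ((N + 2) * (N + 1))"
proof -
  have "2 * (((N + 2) choose 2) * X) = (2 * ((N + 2) choose 2)) * X" by (rule mult.assoc[symmetric])
  then show ?thesis unfolding double_choose_two by (simp only: mult_ac)
qed

text \<open>In this and the next two lemmas \<open>N\<close> grows by 2, 3 and 5 while the degree grows by 1, in
step with the quotient in the statement; the induction runs separately for every residue of \<open>N\<close>.\<close>

lemma two_power_le_binomial: 
  assumes "N \<ge> 2"
  shows "((N + 2) choose 2) * 2 ^ N \<le> (N + 4 + (N + 2) div 2) choose N"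
proof -
  have gen: "4 ^ m * 2 ^ n0 * ((n0 + 2 * m + 2) * (n0 + 2 * m + 1)) \<le> 2 * ((n0 + 2 * m + (6 + m)) choose (n0 + 2 * m))"
    if "n0 = 2 \<or> n0 = 3" for n0 m :: nat
  proof (induction m)
    case 0
    show ?case using that by (auto simp: binomial_fact' fact_numeral)
  next
    case (Suc m)
    have eq: "n0 + 2 * Suc m = (n0 + 2 * m) + 2" "6 + Suc m = (6 + m) + 1"
      "4 ^ Suc m * 2 ^ n0 = 4 * (4 ^ m * 2 ^ n0 :: nat)" by simp_all
    show ?case unfolding eq
    proof (rule growth_step[OF Suc.IH binomial_step_2, where Q = "6 + m + 1"], goal_cases)
      case 1
      show ?case by (simp only: mult_ac)
    next
      case 2
      show ?case using that by (auto simp: algebra_simps)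
    qed simp
  qed
  obtain n0 m :: nat where N: "N = n0 + 2 * m" "n0 = 2 \<or> n0 = 3"
  proof -
    have "N = (2 + N mod 2) + 2 * (N div 2 - 1)" using assms by presburger
    moreover have "2 + N mod 2 = 2 \<or> 2 + N mod 2 = (3::nat)" by presburger
    ultimately show ?thesis using that by blast
  qed
  have d: "(N + 2) div 2 = 2 + m" "2 ^ N = 4 ^ m * (2 ^ n0 :: nat)"
    using N by (auto simp: power_add power_mult)
  have "2 * (((N + 2) choose 2) * 2 ^ N) = 2 ^ N * ((N + 2) * (N + 1))"
    by (rule choose_two_mult)
  also have "\<dots> \<le> 2 * ((N + (6 + m)) choose N)" using gen[OF N(2), of m] d(2) N(1) by simp
  also have "N + (6 + m) = N + 4 + (N + 2) div 2" using d(1) by linarith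
  finally show ?thesis by linarith
qed

lemma three_groups_le_binomial: 
  assumes "N \<ge> 9"
  shows "((N + 2) choose 2) * (3 * 2 ^ (N - N div 3)) \<le> (N + 4 + (N + 2) div 3) choose N"
proof -
  have gen: "4 ^ m * K * ((n0 + 3 * m + 2) * (n0 + 3 * m + 1)) \<le> 2 * ((n0 + 3 * m + (D + 4 + m)) choose (n0 + 3 * m))"
    if "(n0, D, K) \<in> {(9, 3, 3 * 2 ^ 6), (10, 4, 3 * 2 ^ 7), (11, 4, 3 * 2 ^ 8)}" for n0 D K m :: nat
  proof (induction m)
    case 0
    show ?case using that by (auto simp: binomial_fact' fact_numeral)
  next
    case (Suc m)
    have eq: "n0 + 3 * Suc m = (n0 + 3 * m) + 3" "D + 4 + Suc m = (D + 4 + m) + 1"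
      "4 ^ Suc m * K = 4 * (4 ^ m * K :: nat)" by simp_all
    show ?case unfolding eq
    proof (rule growth_step[OF Suc.IH binomial_step_3, where Q = "(n0 + 3 * m + 3) * (D + 4 + m + 1)"], goal_cases)
      case 1
      show ?case by (simp only: mult_ac)
    next
      case 2
      show ?case using that by (auto simp: algebra_simps)
    qed simp
  qed
  obtain n0 D K m :: nat where N: "N = n0 + 3 * m" "(n0, D, K) \<in> {(9, 3, 3 * 2 ^ 6), (10, 4, 3 * 2 ^ 7), (11, 4, 3 * 2 ^ 8)}"
  proof -
    have "N = (9 + N mod 3) + 3 * (N div 3 - 3)" using assms by presburger
    moreover have "9 + N mod 3 = 9 \<or> 9 + N mod 3 = 10 \<or> 9 + N mod 3 = (11::nat)" by presburger
    ultimately show ?thesis using that by blast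
  qed
  have d: "(N + 2) div 3 = D + m" using N by auto
  have e: "3 * 2 ^ (N - N div 3) = 4 ^ m * K"
  proof -
    have "(4::nat) ^ m = 2 ^ (2 * m)" by (simp add: power_mult)
    moreover have "N - N div 3 = 2 * m + (n0 - n0 div 3)" using N by auto
    ultimately show ?thesis using N(2) by (auto simp: power_add)
  qed
  have "2 * (((N + 2) choose 2) * (3 * 2 ^ (N - N div 3))) = 3 * 2 ^ (N - N div 3) * ((N + 2) * (N + 1))"
    by (rule choose_two_mult)
  also have "\<dots> \<le> 2 * ((N + (D + 4 + m)) choose N)" using gen[OF N(2), of m] e N(1) by simp
  also have "N + (D + 4 + m) = N + 4 + (N + 2) div 3" using d by linarith
  finally show ?thesis by linarith
qed

lemma two_groups_le_binomial: 
  assumes "N \<ge> 8"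
  shows "((N + 2) choose 2) * (2 * 2 ^ ((N + 1) div 2)) \<le> (N + 4 + (N + 2) div 5) choose N"
proof -
  have gen: "8 ^ m * K * ((n0 + 5 * m + 2) * (n0 + 5 * m + 1)) \<le> 2 * ((n0 + 5 * m + (6 + m)) choose (n0 + 5 * m))"
    if "(n0, K) \<in> {(8, 2 ^ 5), (9, 2 ^ 6), (10, 2 ^ 6), (11, 2 ^ 7), (12, 2 ^ 7)}" for n0 K m :: nat
  proof (induction m)
    case 0
    show ?case using that by (auto simp: binomial_fact' fact_numeral)
  next
    case (Suc m)
    have eq: "n0 + 5 * Suc m = (n0 + 5 * m) + 5" "6 + Suc m = (6 + m) + 1"
      "8 ^ Suc m * K = 8 * (8 ^ m * K :: nat)" by simp_all
    show ?case unfolding eq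
    proof (rule growth_step[OF Suc.IH binomial_step_5, where Q = "(n0 + 5 * m + 3) * (n0 + 5 * m + 4) * (n0 + 5 * m + 5) * (6 + m + 1)"], goal_cases)
      case 1
      show ?case by (simp only: mult_ac)
    next
      case 2
      show ?case using that by (auto simp: algebra_simps)
    qed simp
  qed
  obtain n0 K m :: nat where N: "N = n0 + 5 * m" "(n0, K) \<in> {(8, 2 ^ 5), (9, 2 ^ 6), (10, 2 ^ 6), (11, 2 ^ 7), (12, 2 ^ 7)}"
  proof -
    define m where "m = (N - 8) div 5"
    define n0 where "n0 = 8 + (N - 8) mod 5"
    have "N = n0 + 5 * m"
      using div_mult_mod_eq[of "N - 8" 5] assms unfolding n0_def m_def by linarith
    moreover have "n0 = 8 \<or> n0 = 9 \<or> n0 = 10 \<or> n0 = 11 \<or> n0 = 12"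
    proof -
      have "(N - 8) mod 5 < 5" by simp
      then have "n0 \<ge> 8" "n0 < 13" unfolding n0_def by linarith+
      then show ?thesis by linarith
    qed
    ultimately show ?thesis using that by blast
  qed
  have d: "(N + 2) div 5 = 2 + m" using N by auto
  have e: "2 * 2 ^ ((N + 1) div 2) \<le> 8 ^ m * K"
  proof -
    have "(N + 1) div 2 \<le> 3 * m + (n0 + 1) div 2" using N by auto
    then have "(2::nat) ^ ((N + 1) div 2) \<le> 2 ^ (3 * m + (n0 + 1) div 2)" by (rule power_increasing) simp
    also have "\<dots> = 8 ^ m * 2 ^ ((n0 + 1) div 2)" by (simp add: power_add power_mult)
    finally show ?thesis using N(2) by auto
  qed
  have "2 * (((N + 2) choose 2) * (2 * 2 ^ ((N + 1) div 2))) = 2 * 2 ^ ((N + 1) div 2) * ((N + 2) * (N + 1))"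
    by (rule choose_two_mult)
  also have "\<dots> \<le> 8 ^ m * K * ((N + 2) * (N + 1))" using e by (intro mult_right_mono) auto
  also have "\<dots> \<le> 2 * ((N + (6 + m)) choose N)" using gen[OF N(2), of m] N(1) by simp
  also have "N + (6 + m) = N + 4 + (N + 2) div 5" using d by linarith
  finally show ?thesis by linarith
qed

text \<open>The induction leads from \<open>(N - 3, i - 1)\<close> to \<open>(N, i)\<close>. Up to lower order terms the step amounts to
\<open>(N + i) ^ 4 \<ge> 6 * i * N ^ 3\<close>, which holds as \<open>(N + i) ^ 4 - 6 * i * N ^ 3 \<ge>
N ^ 2 * (N ^ 2 - 2 * i * N + 6 * i ^ 2)\<close>.\<close>

lemma six_power_less_binomial:
  "N \<ge> 15 \<Longrightarrow> i \<ge> 1 \<Longrightarrow> 5 * i \<le> N + 2 \<Longrightarrow>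
    (N + 2) * (N + 1) * (N + i + 2) * 6 ^ i < 8 * i * ((N + (3 + i)) choose N)"
proof (induction N arbitrary: i rule: less_induct)
  case (less N)
  show ?case
  proof (cases "i = 1")
    case True
    have C: "24 * ((N + (3 + 1)) choose N) = (N + 4) * (N + 3) * (N + 2) * (N + 1)"
    proof -
      have "((N + (3 + 1)) choose N) * 4 = ((N + 3) choose N) * (N + 4)"
        "((N + 3) choose N) * 3 = ((N + 2) choose N) * (N + 3)"
        "((N + 2) choose N) * 2 = ((N + 1) choose N) * (N + 2)"
        using binomial_up[of N 3] binomial_up[of N 2] binomial_up[of N 1] by (simp_all add: numeral_eq_Suc)
      moreover have "(N + 1) choose N = N + 1" using binomial_symmetric[of 1 "N + 1"] by simp
      ultimately have c: "((N + (3 + 1)) choose N) * 4 = ((N + 3) choose N) * (N + 4)"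
        "((N + 3) choose N) * 3 = ((N + 2) choose N) * (N + 3)"
        "((N + 2) choose N) * 2 = (N + 1) * (N + 2)" by simp_all
      have "24 * ((N + (3 + 1)) choose N) = 6 * (((N + (3 + 1)) choose N) * 4)" by simp
      also have "\<dots> = 2 * (((N + 3) choose N) * 3) * (N + 4)" unfolding c(1) by simp
      also have "\<dots> = (((N + 2) choose N) * 2) * ((N + 3) * (N + 4))" unfolding c(2) by simp
      also have "\<dots> = (N + 4) * (N + 3) * (N + 2) * (N + 1)" unfolding c(3) by (simp only: mult_ac)
      finally show ?thesis .
    qed
    define Z where "Z = (N + 2) * (N + 1) * (N + 3)"
    have "(N + 2) * (N + 1) * (N + 3) * 18 < (N + 4) * (N + 3) * (N + 2) * (N + 1)"
    proof -
      have "(N + 2) * (N + 1) * (N + 3) * 18 < (N + 2) * (N + 1) * (N + 3) * (N + 4)"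
        using less.prems(1) by (intro mult_strict_left_mono) auto
      then show ?thesis by (simp only: mult_ac)
    qed
    then have "Z * 18 < 24 * ((N + (3 + 1)) choose N)" unfolding Z_def C .
    then have "Z * 6 < 8 * ((N + (3 + 1)) choose N)" by linarith
    moreover have "(N + 2) * (N + 1) * (N + 1 + 2) * 6 ^ 1 = Z * 6" unfolding Z_def by (simp only: power_one_right) (simp add: numeral_eq_Suc)
    ultimately show ?thesis unfolding True by simp
  next
    case False
    show ?thesis
    proof (cases "N < 18")
      case True
      then have "(N, i) \<in> {(15, 2), (16, 2), (17, 2), (15, 3), (16, 3), (17, 3)}"
      proof -
        have "N = 15 \<or> N = 16 \<or> N = 17" using True less.prems by linarith
        moreover have "i = 2 \<or> i = 3" using True False less.prems by linarith
        ultimately show ?thesis by blast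
      qed
      then show ?thesis by (auto simp: binomial_fact' fact_numeral)
    next
      case big: False
      define n k where "n = N - 3" and "k = i - 1"
      have N: "N = n + 3" and i: "i = k + 1" and k: "k \<ge> 1"
        using big False less.prems by (auto simp: n_def k_def)
      have n: "n \<ge> 15" "5 * k \<le> n + 2" using big less.prems N i by auto
      have IH: "(n + 2) * (n + 1) * (n + k + 2) * 6 ^ k < 8 * k * ((n + (3 + k)) choose n)"
        by (rule less.IH) (use N n k in auto)
      have step: "((N + (3 + i)) choose N) * ((n + 2) * (n + 1) * ((n + 3) * (k + 4))) =
          ((n + (3 + k)) choose n) * ((n + k + 4) * (n + k + 5) * (n + k + 6) * (n + k + 7))"
      proof -
        have e: "3 + i = 3 + k + 1" "n + 3 = N" by (simp_all add: N i)
        have "((n + 2) * (n + 1) * ((n + 3) * (k + 4))) = (3 + k + 1) * (n + 1) * (n + 2) * (n + 3)"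
        proof -
          have "3 + k + 1 = k + 4" by simp
          then show ?thesis by (simp only: mult_ac)
        qed
        moreover have "(n + k + 4) * (n + k + 5) * (n + k + 6) * (n + k + 7) =
            (n + (3 + k) + 1) * (n + 1 + (3 + k + 1)) * (n + 2 + (3 + k + 1)) * (n + 3 + (3 + k + 1))"
          by (simp add: add_ac)
        ultimately show ?thesis using binomial_step_3[of n "3 + k"] unfolding e by (simp only:)
      qed
      have poly: "6 * k * (k + 4) * ((n + 3) * (n + 4) * (n + 5)) \<le>
          (k + 1) * (n + k + 2) * ((n + k + 4) * (n + k + 5) * (n + k + 7))"
      proof (cases "k = 1")
        case True
        obtain y where "n = 8 + y" using n le_Suc_ex[of 8 n] by auto
        then show ?thesis by (simp add: True algebra_simps)
      next
        case False
        then obtain l where l: "k = 2 + l" using k le_Suc_ex[of 2 k] by auto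
        then obtain y where "n = 8 + 5 * l + y" using n le_Suc_ex[of "8 + 5 * l" n] by auto
        then show ?thesis by (simp add: l algebra_simps)
      qed
      let ?X = "(n + 2) * (n + 1) * ((n + 3) * (k + 4)) * (k * (n + k + 2))"
      have "(N + 2) * (N + 1) * (N + i + 2) * 6 ^ i * ?X =
          ((n + 2) * (n + 1) * (n + k + 2) * 6 ^ k) * (n + k + 6) * (6 * k * (k + 4) * ((n + 3) * (n + 4) * (n + 5)))"
      proof -
        have e: "N + 2 = n + 5" "N + 1 = n + 4" "N + i + 2 = n + k + 6" "6 ^ i = 6 * (6 ^ k :: nat)"
          by (simp_all add: N i)
        show ?thesis unfolding e by (simp only: mult_ac)
      qed
      also have "\<dots> < (8 * k * ((n + (3 + k)) choose n)) * (n + k + 6) *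
          ((k + 1) * (n + k + 2) * ((n + k + 4) * (n + k + 5) * (n + k + 7)))"
        using k by (intro mult_less_le_imp_less mult_strict_right_mono IH poly) auto
      also have "\<dots> = 8 * i * (((n + (3 + k)) choose n) * ((n + k + 4) * (n + k + 5) * (n + k + 6) * (n + k + 7))) *
          (k * (n + k + 2))"
        unfolding i by (simp only: mult_ac)
      also have "\<dots> = 8 * i * ((N + (3 + i)) choose N) * ?X"
        unfolding step[symmetric] by (simp only: mult_ac)
      finally show ?thesis by simp
    qed
  qed
qed

text \<open>One of three configurations with the bound \<open>1 + i / (N + 2)\<close> has few enough points. The number \<open>r\<close> of
groups is the largest one that gives this bound, and so is the number \<open>v\<close> of vertices.\<close>

definition cheap_configuration :: "nat \<Rightarrow> nat \<Rightarrow> bool" where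
  "cheap_configuration N i \<longleftrightarrow> (let r = (N + i + 2) div (2 * i); g = (N + r - 1) div r; v = min N ((N + 2) div i - 1);
      b = (N + 2) choose 2; c = (N + 3 + i) choose N in
    i * (2 * r - 1) \<le> N + 2 \<and> b * (r * (2 ^ g - 1)) < c \<or>
    b * (3 * 2 ^ (N - N div 3) - 1) < c \<or>
    i * (v + 1) \<le> N + 2 \<and> b * (2 ^ (N - v) + v - 1) < c)"

lemma cheap_configuration_small_dim: "list_all (\<lambda>N. list_all (cheap_configuration N) [1..<(N + 2) div 2 + 1]) [2..<15]"
  by (simp add: numeral_2_eq_2[symmetric] cheap_configuration_def upt_conv_Cons upt_conv_Nil binomial_fact' fact_numeral Let_def del: upt_Suc)

lemma three_power_le_binomial:
  assumes "N \<ge> 8"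
  shows "((N + 2) choose 2) * 3 ^ N \<le> (2 * N + 6) choose N"
proof -
  have gen: "3 ^ (8 + m) * ((8 + m + 2) * (8 + m + 1)) \<le> 2 * ((8 + m + (14 + m)) choose (8 + m))" for m :: nat
  proof (induction m)
    case 0
    show ?case by (simp add: binomial_fact' fact_numeral)
  next
    case (Suc m)
    have eq: "8 + Suc m = 8 + m + 1" "14 + Suc m = 14 + m + 1" "3 ^ (8 + m + 1) = 3 * (3 ^ (8 + m) :: nat)"
      by (simp_all add: power_add)
    have step: "((8 + m + 1 + (14 + m + 1)) choose (8 + m + 1)) * ((14 + m + 1) * (8 + m + 1) * (8 + m + 2)) =
        ((8 + m + (14 + m)) choose (8 + m)) * ((8 + m + (14 + m) + 1) * (8 + m + 1 + (14 + m + 1)) * (8 + m + 2))"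
      by (simp only: mult.assoc[symmetric] binomial_step_1[of "8 + m" "14 + m", unfolded mult.assoc[symmetric]])
    show ?case unfolding eq
    proof (rule growth_step[OF Suc.IH step, where Q = "14 + m + 1"], goal_cases)
      case 1
      show ?case by (simp only: mult_ac)
    next
      case 2
      show ?case by (simp add: algebra_simps)
    qed simp
  qed
  obtain m where m: "N = 8 + m" using assms le_Suc_ex by blast
  have "2 * (((N + 2) choose 2) * 3 ^ N) = 3 ^ N * ((N + 2) * (N + 1))" by (rule choose_two_mult)
  also have "\<dots> \<le> 2 * ((8 + m + (14 + m)) choose (8 + m))" using gen[of m] unfolding m .
  also have "8 + m + (14 + m) = 2 * N + 6" using m by simp
  finally show ?thesis unfolding m by linarith
qed

text \<open>The binomial coefficients are products of the factors \<open>((N + 2) * k + 2 - i) / (N - i)\<close>, and each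
\<open>((N + 2) * k + 2 - i) / (k + 1)\<close> increases with \<open>k\<close>.\<close>

lemma binomial_ratio_mono:
  assumes "1 \<le> k0" "k0 \<le> k"
  shows "(((N + 2) * k0 + 2) choose N) * (k + 1) ^ N \<le> (((N + 2) * k + 2) choose N) * (k0 + 1) ^ N"
proof -
  let ?n = "\<lambda>k. (N + 2) * k + 2"
  have le: "N \<le> ?n j" if "1 \<le> j" for j
  proof -
    have "(N + 2) * 1 \<le> (N + 2) * j" using that by (intro mult_left_mono) auto
    then show ?thesis by simp
  qed
  have prod: "real ((?n j choose N) * m ^ N) = (\<Prod>i = 0..<N. real (?n j - i) / real (N - i) * real m)" if "1 \<le> j" for j m
    by (simp only: of_nat_mult of_nat_power binomial_altdef_of_nat[OF le[OF that]] prod.distrib prod_constant) simp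
  have "real ((?n k0 choose N) * (k + 1) ^ N) \<le> real ((?n k choose N) * (k0 + 1) ^ N)"
    unfolding prod[OF assms(1)] prod[OF order.trans[OF assms]]
  proof (rule prod_mono, rule conjI)
    fix i assume i: "i \<in> {0..<N}"
    obtain l where l: "k = k0 + l" using assms(2) le_Suc_ex by blast
    have "(?n k0 - i) * (k + 1) \<le> (?n k - i) * (k0 + 1)"
    proof -
      have a: "i \<le> ?n k0" "i \<le> ?n k" using le[OF assms(1)] le[of k] assms i by auto
      have "int ((?n k0 - i) * (k + 1)) \<le> int ((?n k - i) * (k0 + 1))"
        unfolding of_nat_mult of_nat_diff[OF a(1)] of_nat_diff[OF a(2)] by (simp add: l algebra_simps)
      then show ?thesis by linarith
    qed
    then have "real (?n k0 - i) * real (k + 1) \<le> real (?n k - i) * real (k0 + 1)"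
      by (metis of_nat_le_iff of_nat_mult)
    then show "real (?n k0 - i) / real (N - i) * real (k + 1) \<le> real (?n k - i) / real (N - i) * real (k0 + 1)"
      using i by (simp add: divide_right_mono del: of_nat_Suc of_nat_add of_nat_mult)
  qed simp
  then show ?thesis by linarith
qed

lemma grid_le_binomial:
  assumes "N \<ge> 3 \<and> k \<ge> 3 \<or> N \<ge> 8 \<and> k \<ge> 2"
  shows "((N + 2) choose 2) * (k + 1) ^ N \<le> ((N + 2) * k + 2) choose N"
proof -
  define k0 where "k0 = (if N \<ge> 8 then 2 else 3 :: nat)"
  have k0: "1 \<le> k0" "k0 \<le> k" using assms by (auto simp: k0_def)
  have base: "((N + 2) choose 2) * (k0 + 1) ^ N \<le> ((N + 2) * k0 + 2) choose N"
  proof (cases "N \<ge> 8")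
    case True
    have eq: "(N + 2) * 2 + 2 = 2 * N + 6" "2 + 1 = (3::nat)" "k0 = 2" using True by (simp_all add: k0_def)
    show ?thesis unfolding eq by (rule three_power_le_binomial[OF True])
  next
    case False
    then have "N = 3 \<or> N = 4 \<or> N = 5 \<or> N = 6 \<or> N = 7" using assms by linarith
    then show ?thesis by (auto simp: k0_def binomial_fact' fact_numeral)
  qed
  have "((N + 2) choose 2) * (k + 1) ^ N * (k0 + 1) ^ N = (((N + 2) choose 2) * (k0 + 1) ^ N) * (k + 1) ^ N"
    by (simp only: mult_ac)
  also have "\<dots> \<le> (((N + 2) * k0 + 2) choose N) * (k + 1) ^ N" using base by (intro mult_right_mono) auto
  also have "\<dots> \<le> (((N + 2) * k + 2) choose N) * (k0 + 1) ^ N" by (rule binomial_ratio_mono[OF k0])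
  finally show ?thesis by simp
qed

lemma group_size_power: "i \<ge> 1 \<Longrightarrow> 2 * (2 ^ (2 * i + (i - 2) div 2) - 1) \<le> (6 :: nat) ^ i"
proof (cases "i = 1")
  case False
  assume "i \<ge> 1"
  then obtain j where j: "i = 2 + j" using False le_Suc_ex[of 2 i] by auto
  have "(2::nat) ^ (5 + 2 * j + j div 2) \<le> 6 ^ (2 + j)"
  proof (induction j rule: induct_nat_012)
    case (ge2 n)
    then have "(2::nat) ^ (5 + 2 * n + n div 2) * 32 \<le> 6 ^ (2 + n) * 36" by (intro mult_mono) auto
    then show ?case by (simp add: power_add)
  qed simp_all
  moreover have "2 * (2 ^ (2 * i + (i - 2) div 2) - 1) \<le> (2::nat) ^ (5 + 2 * j + j div 2)"
    by (simp add: j power_add)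
  ultimately have "2 * (2 ^ (2 * i + (i - 2) div 2) - 1) \<le> (6::nat) ^ (2 + j)" by (rule order.trans[rotated])
  then show ?thesis by (simp only: j)
qed simp

section \<open>Choice of the degree and of the configuration\<close>

text \<open>The number \<open>(e + N) / (N + 2)\<close> is the right-hand side of the theorem when \<open>\<alpha>(I\<^sup>(\<^sup>3\<^sup>)) = e + 2\<close>.\<close>

definition achieves :: "'k::field itself \<Rightarrow> nat \<Rightarrow> nat \<Rightarrow> nat \<Rightarrow> bool" where
  "achieves TYPE('k) N s e \<longleftrightarrow> (\<exists>p q. has_bound TYPE('k) N s p q \<and> q > 0 \<and> (e + N) * q \<le> (N + 2) * p)"

lemma achieves_bound:
  assumes "has_bound TYPE('k::field) N c p q" "q > 0" "(e + N) * q \<le> (N + 2) * p" "c \<le> s"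
  shows "achieves TYPE('k) N s e"
  using assms has_bound_mono unfolding achieves_def by blast

lemma cost_le:
  fixes b c C s :: nat
  assumes "b * (c - 1) < C" "C \<le> s * b"
  shows "c \<le> s"
proof (rule ccontr)
  assume "\<not> c \<le> s"
  then have "s \<le> c - 1" by simp
  then have "s * b \<le> b * (c - 1)" by (simp add: mult.commute)
  then show False using assms by linarith
qed

lemma achieves_groups:
  assumes "i * (2 * r - 1) \<le> N + 2" "N \<le> r * g" "r \<ge> 1" "g \<ge> 1"
    and "b * (r * (2 ^ g - 1)) < C" "C \<le> s * b"
  shows "achieves TYPE('k::alg_closed_field) N s (2 + i)"
proof (rule achieves_bound[OF groups_bound[OF assms(2-4)]])
  show "1 + r * (2 ^ g - 1) \<le> s" by (rule cost_le[OF _ assms(6)]) (use assms(5) in simp)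
  obtain r' where r: "r = Suc r'" using assms(3) by (cases r) auto
  show "2 * r - 1 > 0" using assms(3) by simp
  show "(2 + i + N) * (2 * r - 1) \<le> (N + 2) * (2 * r)" using assms(1) by (simp add: r algebra_simps)
qed

lemma achieves_three_groups:
  assumes "2 * i \<le> N + 2" "b * (3 * 2 ^ (N - N div 3) - 1) < C" "C \<le> s * b"
  shows "achieves TYPE('k::alg_closed_field) N s (2 + i)"
  by (rule achieves_bound[OF three_groups_bound _ _ cost_le[OF assms(2,3)]]) (use assms(1) in auto)

lemma achieves_vertices:
  assumes "i * (v + 1) \<le> N + 2" "v \<le> N" "b * (2 ^ (N - v) + v - 1) < C" "C \<le> s * b"
  shows "achieves TYPE('k::alg_closed_field) N s (2 + i)"
  by (rule achieves_bound[OF cube_and_vertices_bound[OF assms(2)] _ _ cost_le[OF assms(3,4)]])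
    (use assms(1) in \<open>auto simp: algebra_simps\<close>)

lemma achieves_small_dim:
  assumes N: "2 \<le> N" "N < 15" and i: "1 \<le> i" "2 * i \<le> N + 2"
    and count: "(N + 3 + i) choose N \<le> s * ((N + 2) choose 2)"
  shows "achieves TYPE('k::alg_closed_field) N s (2 + i)"
proof -
  have "N \<in> set [2..<15]" unfolding set_upt using N by simp
  then have "list_all (cheap_configuration N) [1..<(N + 2) div 2 + 1]"
    using cheap_configuration_small_dim unfolding list_all_iff[of _ "[2..<15]"] by (rule bspec[rotated])
  moreover have "i \<in> set [1..<(N + 2) div 2 + 1]" unfolding set_upt using i by auto
  ultimately have "cheap_configuration N i" unfolding list_all_iff by (rule bspec)
  then consider
    (a) "i * (2 * ((N + i + 2) div (2 * i)) - 1) \<le> N + 2"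
      "((N + 2) choose 2) * ((N + i + 2) div (2 * i) * (2 ^ ((N + (N + i + 2) div (2 * i) - 1) div ((N + i + 2) div (2 * i))) - 1)) < (N + 3 + i) choose N"
  | (b) "((N + 2) choose 2) * (3 * 2 ^ (N - N div 3) - 1) < (N + 3 + i) choose N"
  | (c) "i * (min N ((N + 2) div i - 1) + 1) \<le> N + 2"
      "((N + 2) choose 2) * (2 ^ (N - min N ((N + 2) div i - 1)) + min N ((N + 2) div i - 1) - 1) < (N + 3 + i) choose N"
    unfolding cheap_configuration_def Let_def by blast
  then show ?thesis
  proof cases
    case a
    let ?r = "(N + i + 2) div (2 * i)"
    have "2 * i \<le> N + i + 2" using i(2) by linarith
    then have r: "?r \<ge> 1" using i(1) by (simp add: Suc_le_eq div_greater_zero_iff)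
    let ?g = "(N + ?r - 1) div ?r"
    have "N \<le> ?r * ?g"
    proof -
      have "?r * ?g + (N + ?r - 1) mod ?r = N + ?r - 1" by simp
      moreover have "(N + ?r - 1) mod ?r < ?r" using r by (intro mod_less_divisor) simp
      ultimately show ?thesis using r by linarith
    qed
    moreover from this have "?g \<ge> 1" using N(1) by (cases "?g = 0") auto
    ultimately show ?thesis by (intro achieves_groups[OF a(1) _ r _ a(2) count])
  next
    case b
    then show ?thesis by (rule achieves_three_groups[OF i(2) _ count])
  next
    case c
    then show ?thesis by (intro achieves_vertices[OF _ _ _ count]) auto
  qed
qed

text \<open>If forms of degree \<open>3 + i\<close> are too few for the count, then \<open>s\<close> is large enough for a configuration
with the bound \<open>1 + i / (N + 2)\<close>: two of three groups for \<open>i\<close> up to \<open>(N + 2) / 2\<close>, two groups up to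
\<open>(N + 2) / 3\<close>, and groups of about \<open>2 * i\<close> coordinates up to \<open>(N + 2) / 5\<close>.\<close>

lemma achieves_large_dim:
  assumes N: "N \<ge> 15" and i: "1 \<le> i" "2 * i \<le> N + 2"
    and count: "(N + 3 + i) choose N \<le> s * ((N + 2) choose 2)"
  shows "achieves TYPE('k::alg_closed_field) N s (2 + i)"
proof -
  let ?b = "(N + 2) choose 2" and ?C = "(N + 3 + i) choose N"
  have b: "?b > 0" by simp
  consider "i > (N + 2) div 3" | "i > (N + 2) div 5" "i \<le> (N + 2) div 3" | "i \<le> (N + 2) div 5" by linarith
  then show ?thesis
  proof cases
    case 1
    have "?b * (3 * 2 ^ (N - N div 3) - 1) < ?b * (3 * 2 ^ (N - N div 3))"
      using b by (intro mult_strict_left_mono) auto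
    also have "\<dots> \<le> (N + 4 + (N + 2) div 3) choose N" by (rule three_groups_le_binomial) (use N in simp)
    also have "\<dots> \<le> ?C" by (rule binomial_right_mono) (use 1 in linarith)
    finally show ?thesis by (rule achieves_three_groups[OF i(2) _ count])
  next
    case 2
    let ?g = "(N + 1) div 2"
    have "?b * (2 * (2 ^ ?g - 1)) < ?b * (2 * 2 ^ ?g)"
      using b by (intro mult_strict_left_mono) auto
    also have "\<dots> \<le> (N + 4 + (N + 2) div 5) choose N" by (rule two_groups_le_binomial) (use N in simp)
    also have "\<dots> \<le> ?C" by (rule binomial_right_mono) (use 2 in linarith)
    finally have less: "?b * (2 * (2 ^ ?g - 1)) < ?C" .
    have i3: "i * (2 * 2 - 1) \<le> N + 2"
    proof -
      have "i * 3 \<le> N + 2" using 2(2) by linarith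
      then show ?thesis by simp
    qed
    have g: "N \<le> 2 * ?g" "?g \<ge> 1" using N by linarith+
    show ?thesis by (rule achieves_groups[OF i3 g(1) _ g(2) less count]) simp
  next
    case 3
    define r where "r = (N + i + 2) div (2 * i)"
    define h where "h = (i - 2) div 2"
    define g where "g = 2 * i + h"
    have i5: "5 * i \<le> N + 2" using 3 by linarith
    have r_le: "r * (2 * i) \<le> N + i + 2" unfolding r_def by (rule div_times_less_eq_dividend)
    have r_gt: "N + i + 2 < 2 * i * r + 2 * i"
      using mod_less_divisor[of "2 * i" "N + i + 2"] mult_div_mod_eq[of "2 * i" "N + i + 2"] i(1)
      unfolding r_def by linarith
    have r3: "r \<ge> 3"
      using r_def i5 i(1) by (simp add: less_eq_div_iff_mult_less_eq)
    have "N \<le> r * g"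
    proof -
      have "i \<le> 2 * h + 3" unfolding h_def by linarith
      moreover have "3 * h \<le> r * h" using r3 by (rule mult_right_mono) simp
      ultimately have "i \<le> r * h + 3" by linarith
      moreover have "r * g = 2 * i * r + r * h" by (simp add: g_def algebra_simps)
      ultimately show ?thesis using r_gt by linarith
    qed
    moreover have "i * (2 * r - 1) \<le> N + 2"
      using r_le by (simp add: diff_mult_distrib2 mult_ac)
    moreover have "?b * (r * (2 ^ g - 1)) < ?C"
    proof -
      have "(?b * (r * (2 ^ g - 1))) * (4 * i) = ?b * (r * (2 * i)) * (2 * (2 ^ g - 1))" by (simp only: mult_ac)
      also have "\<dots> \<le> ?b * (N + i + 2) * 6 ^ i"
        unfolding g_def h_def by (intro mult_mono r_le group_size_power i(1)) auto
      also have "\<dots> < 4 * i * ?C"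
      proof -
        have "2 * (?b * ((N + i + 2) * 6 ^ i)) = (N + i + 2) * 6 ^ i * ((N + 2) * (N + 1))" by (rule choose_two_mult)
        also have "\<dots> = (N + 2) * (N + 1) * (N + i + 2) * 6 ^ i" by (simp only: mult_ac)
        also have "\<dots> < 8 * i * ((N + (3 + i)) choose N)" by (rule six_power_less_binomial[OF N i(1) i5])
        also have "\<dots> = 2 * (4 * i * ?C)" by (simp add: add.assoc)
        finally have "?b * ((N + i + 2) * 6 ^ i) < 4 * i * ?C" by linarith
        then show ?thesis by (simp only: mult.assoc)
      qed
      also have "4 * i * ?C = ?C * (4 * i)" by (rule mult.commute)
      finally show ?thesis by simp
    qed
    moreover have "g \<ge> 1" "r \<ge> 1" using i(1) r3 by (auto simp: g_def)
    ultimately show ?thesis by (intro achieves_groups[OF _ _ _ _ _ count]) auto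
  qed
qed

lemma ex_floor_root:
  fixes N s :: nat
  assumes "N \<ge> 1" "s \<ge> 1"
  shows "\<exists>k\<ge>1. k ^ N \<le> s \<and> s < (k + 1) ^ N"
proof -
  have bound: "k \<le> s" if "k ^ N \<le> s" for k :: nat
    using that self_le_power[of k N] assms(1) by (cases "k = 0") auto
  define k :: nat where "k = (GREATEST k. k ^ N \<le> s)"
  have "1 ^ N \<le> s" using assms(2) by simp
  then have k: "k ^ N \<le> s" unfolding k_def by (rule GreatestI_nat[where b = s]) (use bound in auto)
  have "k \<ge> 1" unfolding k_def
    by (rule Greatest_le_nat[where b = s]) (use bound assms(2) in auto)
  moreover have "\<not> (k + 1) ^ N \<le> s"
  proof
    assume "(k + 1) ^ N \<le> s"
    then have "k + 1 \<le> k" unfolding k_def by (rule Greatest_le_nat[where b = s]) (use bound in auto)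
    then show False by simp
  qed
  ultimately show ?thesis using k by (intro exI[of _ k]) auto
qed

lemma cube_regime:
  assumes "k \<ge> 1" "k ^ N \<le> s" "s * ((N + 2) choose 2) < ((N + 2) * k + 2) choose N"
  shows "\<exists>e. s * ((N + 2) choose 2) < (N + (2 + e)) choose N \<and> achieves TYPE('k::alg_closed_field) N s e"
proof (intro exI[of _ "(N + 2) * k - N"] conjI)
  have "(N + 2) * 1 \<le> (N + 2) * k" using assms(1) by (intro mult_left_mono) auto
  then have le: "N \<le> (N + 2) * k" by (rule order.trans[rotated]) simp
  then have "N + (2 + ((N + 2) * k - N)) = (N + 2) * k + 2" by linarith
  then show "s * ((N + 2) choose 2) < (N + (2 + ((N + 2) * k - N))) choose N" using assms(3) by simp
  show "achieves TYPE('k) N s ((N + 2) * k - N)"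
    by (rule achieves_bound[OF cube_bound[OF assms(1)] _ _ assms(2)]) (use le in auto)
qed

text \<open>In these dimensions the count can fail in degree \<open>N + 6\<close> although there are fewer than \<open>3 ^ N\<close> points;
the number of points then suffices for the bound \<open>12/5\<close>.\<close>

lemma two_grids_regime:
  assumes N: "2 \<le> N" "N \<le> 7" and s: "s < 3 ^ N" "(2 * N + 6) choose N \<le> s * ((N + 2) choose 2)"
  shows "\<exists>e. s * ((N + 2) choose 2) < (N + (2 + e)) choose N \<and> achieves TYPE('k::alg_closed_field) N s e"
proof (intro exI[of _ "12 * (N + 2) div 5 - N"] conjI)
  let ?x = "N div 2" and ?e = "12 * (N + 2) div 5 - N"
  let ?c = "3 ^ ?x * 2 ^ (N - ?x) + 2 ^ ?x * 3 ^ (N - ?x) - 2 ^ N :: nat"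
  have N': "N = 2 \<or> N = 3 \<or> N = 4 \<or> N = 5 \<or> N = 6 \<or> N = 7" using N by linarith
  \<comment> \<open>For \<open>N = 3\<close> this reads \<open>210 < 220\<close>, and for \<open>N = 2\<close> it reads \<open>42 < 45\<close>.\<close>
  have "((N + 2) choose 2) * (?c - 1) < (2 * N + 6) choose N"
    using N' by (elim disjE) (simp_all add: binomial_fact' fact_numeral)
  then have "?c \<le> s" by (rule cost_le[OF _ s(2)])
  then show "achieves TYPE('k) N s ?e"
    by (intro achieves_bound[OF two_grids_bound[of ?x N]]) auto
  have "s * ((N + 2) choose 2) \<le> (3 ^ N - 1) * ((N + 2) choose 2)" using s(1) by (intro mult_right_mono) auto
  also have "\<dots> < (N + (2 + ?e)) choose N"
    using N' by (elim disjE) (simp_all add: binomial_fact' fact_numeral)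
  finally show "s * ((N + 2) choose 2) < (N + (2 + ?e)) choose N" .
qed

text \<open>If \<open>4 + i\<close> is the least degree that satisfies the count, then its failure in degree \<open>3 + i\<close> bounds
\<open>s\<close> from below.\<close>

lemma few_points_regime:
  assumes N: "N \<ge> 2" and s: "1 \<le> s" "s < 2 ^ N"
  shows "\<exists>e. s * ((N + 2) choose 2) < (N + (2 + e)) choose N \<and> achieves TYPE('k::alg_closed_field) N s e"
proof -
  let ?P = "\<lambda>i. s * ((N + 2) choose 2) < (N + 4 + i) choose N"
  have top: "?P ((N + 2) div 2)"
  proof -
    have "s * ((N + 2) choose 2) < 2 ^ N * ((N + 2) choose 2)" using s(2) by (intro mult_strict_right_mono) auto
    also have "\<dots> \<le> (N + 4 + (N + 2) div 2) choose N" using two_power_le_binomial[OF N] by (simp add: mult.commute)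
    finally show ?thesis .
  qed
  define i where "i = (LEAST i. ?P i)"
  have i: "?P i" unfolding i_def by (rule LeastI, rule top)
  have i_le: "i \<le> (N + 2) div 2" unfolding i_def by (rule Least_le, rule top)
  have eq: "N + (2 + (2 + i)) = N + 4 + i" by simp
  have "s * ((N + 2) choose 2) < (N + (2 + (2 + i))) choose N" unfolding eq by (rule i)
  moreover have "achieves TYPE('k) N s (2 + i)"
  proof (cases "i = 0")
    case True
    then show ?thesis using s(1) by (intro achieves_bound[OF cube_bound[of 1]]) auto
  next
    case False
    have "\<not> ?P (i - 1)" unfolding i_def by (rule not_less_Least) (use False in \<open>simp add: i_def\<close>)
    then have "(N + 3 + i) choose N \<le> s * ((N + 2) choose 2)" using False by (simp add: numeral_eq_Suc)
    then show ?thesis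
      using achieves_small_dim[where N = N and i = i and s = s and ?'k = 'k]
        achieves_large_dim[where N = N and i = i and s = s and ?'k = 'k] N False i_le by (cases "N < 15") auto
  qed
  ultimately show ?thesis by blast
qed

lemma ex_degree_and_bound:
  assumes "N \<ge> 1" "s \<ge> 1"
  shows "\<exists>e. s * ((N + 2) choose 2) < (N + (2 + e)) choose N \<and> achieves TYPE('k::alg_closed_field) N s e"
proof -
  obtain k where k: "k \<ge> 1" "k ^ N \<le> s" "s < (k + 1) ^ N" using ex_floor_root[OF assms] by blast
  consider "N = 1" | "N \<ge> 2" "k = 1" | "N = 2" "k \<ge> 3" | "N \<ge> 3 \<and> k \<ge> 3 \<or> N \<ge> 8 \<and> k \<ge> 2" | "2 \<le> N" "N \<le> 7" "k = 2"
    using assms(1) k(1) by linarith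
  then show ?thesis
  proof cases
    case 1
    then show ?thesis using k by (intro cube_regime[OF k(1,2)]) (auto simp: numeral_eq_Suc)
  next
    case 2
    have "s < 2 ^ N" using k(3) unfolding 2(2) one_add_one .
    then show ?thesis using assms(2) by (intro few_points_regime 2(1))
  next
    case 3
    have "2 * ((4 * k + 2) choose 2) = (4 * k + 2) * (4 * k + 1)" using double_choose_two[of "4 * k"] by simp
    moreover have "6 * s + 6 \<le> 6 * (k + 1) ^ 2" using k(3) 3(1) by simp
    moreover have "12 * (k + 1) ^ 2 < (4 * k + 2) * (4 * k + 1) + 12"
    proof -
      obtain l where "k = 3 + l" using 3(2) le_Suc_ex by blast
      then show ?thesis by (simp add: power2_eq_square algebra_simps)
    qed
    ultimately have less: "6 * s < (4 * k + 2) choose 2" by linarith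
    have "s * ((N + 2) choose 2) = 6 * s" unfolding 3(1) by (simp add: binomial_fact' fact_numeral)
    moreover have "(N + 2) * k + 2 = 4 * k + 2" unfolding 3(1) by simp
    ultimately have "s * ((N + 2) choose 2) < ((N + 2) * k + 2) choose N" using less 3(1) by (simp only:)
    then show ?thesis by (rule cube_regime[OF k(1,2)])
  next
    case 4
    have "s * ((N + 2) choose 2) < (k + 1) ^ N * ((N + 2) choose 2)" using k(3) by (intro mult_strict_right_mono) auto
    also have "\<dots> \<le> ((N + 2) * k + 2) choose N" using grid_le_binomial[OF 4] by (simp add: mult.commute)
    finally show ?thesis by (rule cube_regime[OF k(1,2)])
  next
    case 5
    show ?thesis
    proof (cases "s * ((N + 2) choose 2) < ((N + 2) * k + 2) choose N")
      case True
      then show ?thesis by (rule cube_regime[OF k(1,2)])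
    next
      case False
      have eq: "(N + 2) * k + 2 = 2 * N + 6" "k + 1 = 3" using 5(3) by simp_all
      show ?thesis using False k(3) unfolding eq not_less by (intro two_grids_regime 5)
    qed
  qed
qed

section \<open>The Waldschmidt constant\<close>

lemma fekete:
  fixes a :: "nat \<Rightarrow> nat"
  assumes sub: "\<And>t u. a (t + u) \<le> a t + a u"
  shows "convergent (\<lambda>t. real (a t) / real t)"
proof -
  define L where "L = Inf ((\<lambda>t. real (a t) / real t) ` {1..})"
  have bdd: "bdd_below ((\<lambda>t. real (a t) / real t) ` {1..})" by (rule bdd_belowI[of _ 0]) auto
  have L_le: "L \<le> real (a t) / real t" if "t \<ge> 1" for t
    unfolding L_def by (rule cInf_lower[OF _ bdd]) (use that in auto)
  have mult: "a (q * n + r) \<le> q * a n + a r" for q n r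
  proof (induction q)
    case (Suc q)
    have "a (Suc q * n + r) = a (n + (q * n + r))" by (simp add: add.assoc)
    also have "\<dots> \<le> a n + (q * a n + a r)" using sub[of n "q * n + r"] Suc.IH by linarith
    finally show ?case by simp
  qed simp
  have "(\<lambda>t. real (a t) / real t) \<longlonglongrightarrow> L"
  proof (rule LIMSEQ_I)
    fix e :: real assume e: "e > 0"
    have "\<exists>x\<in>(\<lambda>t. real (a t) / real t) ` {1..}. x < L + e / 2"
      by (rule ccontr) (use cInf_greatest[of "(\<lambda>t. real (a t) / real t) ` {1..}" "L + e / 2"] e in \<open>auto simp: L_def not_less\<close>)
    then obtain n where n: "n \<ge> 1" "real (a n) / real n < L + e / 2" by auto
    \<comment> \<open>A bound for the contribution of the remainder of \<open>t\<close> modulo \<open>n\<close>.\<close>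
    define M where "M = (\<Sum>r<n. a r)"
    obtain K :: nat where K: "real M / (e / 2) < real K" using reals_Archimedean2 by blast
    show "\<exists>no. \<forall>t\<ge>no. norm (real (a t) / real t - L) < e"
    proof (intro exI[of _ "max 1 K"] allI impI)
      fix t assume t: "max 1 K \<le> t"
      then have t0: "real t > 0" by simp
      have "a t \<le> (t div n) * a n + a (t mod n)" using mult[of "t div n" n "t mod n"] by simp
      also have "a (t mod n) \<le> M" unfolding M_def
        by (rule member_le_sum) (use n in auto)
      finally have "real (a t) \<le> real (t div n) * real (a n) + real M"
        by (metis add_le_cancel_left of_nat_add of_nat_le_iff of_nat_mult)
      also have "real (t div n) \<le> real t / real n" by (rule of_nat_div_le_of_nat)
      finally have "real (a t) \<le> real t / real n * real (a n) + real M"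
        by (simp add: mult_right_mono)
      then have "real (a t) / real t \<le> real (a n) / real n + real M / real t"
        using t0 by (simp add: field_simps)
      also have "real M / real t < e / 2"
      proof -
        have "real M / (e / 2) < real t" using K t by simp
        then show ?thesis using e t0 by (simp add: field_simps)
      qed
      finally have "real (a t) / real t < L + e" using n(2) by linarith
      moreover have "L \<le> real (a t) / real t" using L_le t by simp
      ultimately show "norm (real (a t) / real t - L) < e" by simp
    qed
  qed
  then show ?thesis by (rule convergentI)
qed

text \<open>Powers of a form in \<open>I\<close> show that all symbolic powers contain nonzero forms. Without this, the initial
degrees would be unspecified.\<close>

lemma (in cone_points) waldschmidt_constant_ge:
  assumes count: "s * ((N + 2) choose 2) < (N + (2 + e)) choose N"
    and pq: "q > 0" "(e + N) * q \<le> (N + 2) * p"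
    and none: "\<And>f d t. q * d < p * t \<Longrightarrow> f \<noteq> 0 \<Longrightarrow> poly_vars f \<subseteq> {0..N} \<Longrightarrow> homogeneous_of_degree d f
      \<Longrightarrow> \<exists>i\<in>{1..s}. \<not> vanishes_to_order t (v i) f"
  shows "waldschmidt_constant R I \<ge>
    (real (initial_degree (symbolic_power R I 3)) + real N - 2) / (real N + 2)"
proof -
  define a where "a t = initial_degree (symbolic_power R I t)" for t
  obtain g where g: "g \<noteq> 0" "homogeneous_of_degree (2 + e) g" "poly_vars g \<subseteq> {0..N}" "g \<in> symbolic_power R I 3"
    using ex_triple_form[OF count] by blast
  have a3: "a 3 \<le> 2 + e" unfolding a_def initial_degree_def by (rule Least_le) (use g in blast)
  have gI: "g \<in> I"
  proof (rule form_in_I[OF g(2,3)])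
    fix i assume i: "i \<in> {1..s}"
    have "vanishes_to_order 3 (v i) g" by (rule symbolic_power_vanishes[OF g(4,2) i])
    then have "vanishes_to_order 1 (v i) g" by (auto simp: vanishes_to_order_def)
    then show "cone_zero (v i) g" unfolding vanishes_to_order_1_iff cone_zero_form[OF g(2)] .
  qed
  have g_pow: "g ^ t \<in> ipow t" for t
  proof (induction t)
    case 0
    show ?case by (simp add: ipow_0 coordinate_ring_simps poly_vars_closed)
  next
    case (Suc t)
    then show ?case using ipow_SucI[OF Suc gI] by (simp add: mult.commute)
  qed
  have ex: "\<exists>f\<in>symbolic_power R I t. f \<noteq> 0 \<and> homogeneous_of_degree (a t) f" for t
  proof -
    have "g ^ t \<in> symbolic_power R I t"
      by (rule in_symbolic_powerI[of _ 0]) (use g_pow g(3) in \<open>auto intro: poly_vars_power[THEN subsetD]\<close>)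
    moreover have "g ^ t \<noteq> 0" using g(1) by simp
    ultimately have "\<exists>d. \<exists>f\<in>symbolic_power R I t. f \<noteq> 0 \<and> homogeneous_of_degree d f"
      using homogeneous_power[OF g(2), of t] by blast
    then show ?thesis unfolding a_def initial_degree_def by (rule LeastI_ex)
  qed
  have sub: "a (t + u) \<le> a t + a u" for t u
  proof -
    obtain f f' where f: "f \<in> symbolic_power R I t" "f \<noteq> 0" "homogeneous_of_degree (a t) f"
      and f': "f' \<in> symbolic_power R I u" "f' \<noteq> 0" "homogeneous_of_degree (a u) f'"
      using ex[of t] ex[of u] by blast
    have "f * f' \<in> symbolic_power R I (t + u)" "f * f' \<noteq> 0" "homogeneous_of_degree (a t + a u) (f * f')"
      using symbolic_power_mult[OF f(1) f'(1)] f(2) f'(2) homogeneous_mult[OF f(3) f'(3)] by auto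
    then show ?thesis unfolding a_def[of "t + u"] initial_degree_def by (intro Least_le) blast
  qed
  have lower: "p * t \<le> q * a t" for t
  proof (rule ccontr)
    assume "\<not> ?thesis"
    then have less: "q * a t < p * t" by simp
    obtain f where f: "f \<in> symbolic_power R I t" "f \<noteq> 0" "homogeneous_of_degree (a t) f" using ex[of t] by blast
    have "poly_vars f \<subseteq> {0..N}" using f(1) unfolding symbolic_power_def coordinate_ring_simps by blast
    from none[OF less f(2) this f(3)] symbolic_power_vanishes[OF f(1,3)] show False by blast
  qed
  have "real p / real q \<le> lim (\<lambda>t. real (a t) / real t)"
  proof (rule LIMSEQ_le_const)
    show "(\<lambda>t. real (a t) / real t) \<longlonglongrightarrow> lim (\<lambda>t. real (a t) / real t)"
      using fekete[of a, OF sub] by (simp add: convergent_LIMSEQ_iff)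
    show "\<exists>n. \<forall>t\<ge>n. real p / real q \<le> real (a t) / real t"
    proof (intro exI[of _ 1] allI impI)
      fix t :: nat assume "1 \<le> t"
      moreover have "real p * real t \<le> real q * real (a t)" using lower[of t] by (metis of_nat_le_iff of_nat_mult)
      ultimately show "real p / real q \<le> real (a t) / real t" using pq(1) by (simp add: field_simps)
    qed
  qed
  moreover have "(real (a 3) + real N - 2) / (real N + 2) \<le> real p / real q"
  proof -
    have "real (e + N) * real q \<le> real (N + 2) * real p" using pq(2) by (metis of_nat_le_iff of_nat_mult)
    then have "(real e + real N) / (real N + 2) \<le> real p / real q" using pq(1) by (simp add: field_simps)
    moreover have "(real (a 3) + real N - 2) / (real N + 2) \<le> (real e + real N) / (real N + 2)"
      using a3 by (intro divide_right_mono) auto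
    ultimately show ?thesis by linarith
  qed
  ultimately show ?thesis unfolding waldschmidt_constant_def a_def by linarith
qed

theorem mainTheorem3:
  fixes N s :: nat
  assumes "N \<ge> 1" and "s \<ge> 1"
  shows "holds_for_very_general_points N s
    (\<lambda>X :: (nat \<Rightarrow> 'k::alg_closed_field) set set.
       let R = coordinate_ring N; I = defining_ideal N X in
       waldschmidt_constant R I \<ge>
         (real (initial_degree (symbolic_power R I 3)) + real N - 2) / (real N + 2))"
proof -
  let ?A = "{1..s} \<times> {0..N}"
  obtain e p q where count: "s * ((N + 2) choose 2) < (N + (2 + e)) choose N"
    and bound: "has_bound TYPE('k) N s p q" and pq: "q > 0" "(e + N) * q \<le> (N + 2) * p"
    using ex_degree_and_bound[OF assms, where ?'k = 'k] unfolding achieves_def by blast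
  obtain P :: "(nat \<Rightarrow> 'k) set" where P: "finite P" "card P \<le> s" "waldschmidt_bound N P p q"
    using bound by (auto simp: has_bound_def)
  define good where "good = (\<lambda>t d (F :: (nat \<times> nat \<Rightarrow> 'k) \<Rightarrow> 'k). polyfun ?A F \<and> (\<exists>a\<in>affine_space ?A. F a \<noteq> 0) \<and>
    (\<forall>a f. F a \<noteq> 0 \<longrightarrow> f \<noteq> 0 \<longrightarrow> poly_vars f \<subseteq> {0..N} \<longrightarrow> homogeneous_of_degree d f \<longrightarrow>
      (\<exists>i\<in>{1..s}. \<not> vanishes_to_order t (row a i) f)))"
  define F where "F t d = (if q * d < p * t then SOME F. good t d F else (\<lambda>_. 1))" for t d
  \<comment> \<open>The first of the open sets ensures that the points have the representatives used above.\<close>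
  define F0 where "F0 = (\<lambda>a :: nat \<times> nat \<Rightarrow> 'k. \<Prod>i\<in>{1..s}. a (i, 0))"
  define G where "G n = (case n of 0 \<Rightarrow> F0 | Suc n \<Rightarrow> (case prod_decode n of (t, d) \<Rightarrow> F t d))" for n
  have goodF: "good t d (F t d)" if "q * d < p * t" for t d
    using someI_ex[OF generic_no_form[OF P that]] that unfolding good_def F_def by simp
  have one: "restrict (\<lambda>_. 1 :: 'k) ?A \<in> affine_space ?A" by (auto simp: affine_space_def)
  have F: "polyfun ?A (F t d) \<and> (\<exists>a\<in>affine_space ?A. F t d a \<noteq> 0)" for t d
  proof (cases "q * d < p * t")
    case True
    then show ?thesis using goodF[OF True] by (simp add: good_def)
  next
    case False
    then show ?thesis using one polyfun_const by (auto simp: F_def)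
  qed
  have F0: "polyfun ?A F0 \<and> (\<exists>a\<in>affine_space ?A. F0 a \<noteq> 0)"
  proof
    show "polyfun ?A F0" unfolding F0_def by (intro polyfun_prod polyfun_coord) auto
    have "F0 (restrict (\<lambda>_. 1) ?A) \<noteq> 0" by (simp add: F0_def)
    then show "\<exists>a\<in>affine_space ?A. F0 a \<noteq> 0" using one by blast
  qed
  have G: "polyfun ?A (G n) \<and> (\<exists>a\<in>affine_space ?A. G n a \<noteq> 0)" for n
    using F F0 by (auto simp: G_def split: nat.split prod.split)
  show ?thesis unfolding holds_for_very_general_points_def Let_def
  proof (intro exI[of _ "\<lambda>n. {a \<in> affine_space ?A. G n a \<noteq> 0}"] conjI allI ballI)
    fix n
    show "zariski_open ?A {a \<in> affine_space ?A. G n a \<noteq> 0}" using G by (intro zariski_open_nonzero) blast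
    show "{a \<in> affine_space ?A. G n a \<noteq> 0} \<noteq> {}" using G by blast
  next
    fix a assume a: "a \<in> (\<Inter>n. {a \<in> affine_space ?A. G n a \<noteq> 0})"
    have "G 0 a \<noteq> 0" using a by blast
    then have nz: "a (i, 0) \<noteq> 0" if "i \<in> {1..s}" for i
      using that by (auto simp: G_def F0_def)
    have Fa: "F t d a \<noteq> 0" for t d
    proof -
      have "G (Suc (prod_encode (t, d))) a \<noteq> 0" using a by blast
      then show ?thesis by (simp add: G_def)
    qed
    interpret cone_points N s "row a"
      by unfold_locales (use infinite_alg_closed nz in \<open>auto simp: row_def\<close>)
    have conf: "point_configuration N s a = points" by (simp add: point_configuration_def points_def row_def)
    show "point_configuration N s a \<subseteq> projective_space N"
    proof
      fix Q assume "Q \<in> point_configuration N s a"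
      then obtain i where i: "i \<in> {1..s}" "Q = projective_point N (row a i)"
        by (auto simp: conf points_def)
      have "Q = projective_point N (restrict (row a i) {0..N})"
        unfolding i(2) projective_point_def by (intro Collect_cong ex_cong1 conj_cong refl arg_cong2[of _ _ _ _ "(=)"]) (auto intro!: restrict_ext)
      moreover have "restrict (row a i) {0..N} \<in> affine_space {0..N}" by (auto simp: affine_space_def)
      moreover have "restrict (row a i) {0..N} 0 \<noteq> 0" using nz[OF i(1)] by (simp add: row_def)
      ultimately show "Q \<in> projective_space N" unfolding projective_space_def by fastforce
    qed
    have "waldschmidt_constant (coordinate_ring N) I \<ge>
        (real (initial_degree (symbolic_power (coordinate_ring N) I 3)) + real N - 2) / (real N + 2)"
    proof (rule waldschmidt_constant_ge[OF count pq])
      fix f :: "(nat, 'k) mpoly" and d t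
      assume less: "q * d < p * t" and f: "f \<noteq> 0" "poly_vars f \<subseteq> {0..N}" "homogeneous_of_degree d f"
      then show "\<exists>i\<in>{1..s}. \<not> vanishes_to_order t (row a i) f"
        using goodF[OF less] Fa[of t d] unfolding good_def by blast
    qed
    then show "waldschmidt_constant (coordinate_ring N) (defining_ideal N (point_configuration N s a)) \<ge>
        (real (initial_degree (symbolic_power (coordinate_ring N) (defining_ideal N (point_configuration N s a)) 3))
          + real N - 2) / (real N + 2)"
      unfolding conf I_def .
  qed
qed

end
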